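(* There exists a strongly polynomial time algorithm (with respect to $n$ and $d_i$, $i\in[n]$) that solves the following separation problem: given matrices $\tilde X(i,j)\in[0,1]^{d_i\times d_j}$ for all $1\le i<j\le n$ such that all row sums and all column sums of every $\tilde X(i,j)$ are at most $1$, decide whether $\tilde X$ satisfies all consistency inequalities or not, and in the latter case find a consistency inequality that is violated by $\tilde X$.
   Context: Write $[m]=\{1,\dots,m\}$. Let $n\ge 3$ and let $d_1,\dots,d_n\ge1$ be integers with $\max_i d_i\ge 2$. For matrices $X(i,j)\in\mathbb{R}^{d_i\times d_j}$, $1\le i<j\le n$, the consistency inequalities are the following, for all $1\le i<j<k\le n$: (1) $-\sum_{t\in D_1}\sum_{q\in D_2}X_{tq}(i,j)+\sum_{q\in D_2}X_{ql}(j,k)+\sum_{t\in D_1}X_{tl}(i,k)\le 1$ for all nonempty $D_1\subseteq[d_i]$, $D_2\subseteq[d_j]$ and all $l\in[d_k]$; (2) $\sum_{t\in D_1}X_{lt}(i,j)-\sum_{t\in D_1}\sum_{q\in D_2}X_{tq}(j,k)+\sum_{q\in D_2}X_{lq}(i,k)\le 1$ for all nonempty $D_1\subseteq[d_j]$, $D_2\subseteq[d_k]$ and all $l\in[d_i]$; (3) $\sum_{t\in D_1}X_{tl}(i,j)+\sum_{q\in D_2}X_{lq}(j,k)-\sum_{t\in D_1}\sum_{q\in D_2}X_{tq}(i,k)\le 1$ for all nonempty $D_1\subseteq[d_i]$, $D_2\subseteq[d_k]$ and all $l\in[d_j]$. An algorithm is strongly polynomial if it uses a number of elementary arithmetic operations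 and comparisons that is bounded by a polynomial in the dimension parameters ($n$ and the $d_i$), independently of the size of the numerical data, and runs in polynomial time. *)

theory Defs
  imports Complex_Main "HOL-Library.Log_Nat" "HOL-Computational_Algebra.Polynomial"
begin

text \<open>
  The algorithmic model is a real-arithmetic random access machine, presented as a deterministic
  while language. Memory consists of arrays of natural numbers (for indices, counters, pointers)
  and arrays of real numbers (for the numerical data), each addressed by an array name and a list
  of natural-number indices; the number of indices of an access is fixed by the program text.
  Real data are only subject to the operations \<open>+, -, *, /\<close> and comparison (there is no
  rounding and no conversion to natural numbers), and program constants are rational.
  Division by zero yields zero.
\<close>

datatype nexp =
    NConst nat
  | NArr string "nexp list"
  | NAdd nexp nexp
  | NSub nexp nexp

datatype rexp =
    RConst rat
  | RArr string "nexp list"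
  | RAdd rexp rexp
  | RSub rexp rexp
  | RMul rexp rexp
  | RDiv rexp rexp

datatype bexp =
    NLess nexp nexp
  | RLess rexp rexp
  | BNot bexp
  | BAnd bexp bexp

datatype com =
    Skip
  | NAssign string "nexp list" nexp
  | RAssign string "nexp list" rexp
  | Seq com com
  | Cond bexp com com
  | While bexp com

record state =
  nmem :: "string \<Rightarrow> nat list \<Rightarrow> nat"
  rmem :: "string \<Rightarrow> nat list \<Rightarrow> real"

fun nval :: "state \<Rightarrow> nexp \<Rightarrow> nat" where
  "nval s (NConst m) = m"
| "nval s (NArr x es) = nmem s x (map (nval s) es)"
| "nval s (NAdd a b) = nval s a + nval s b"
| "nval s (NSub a b) = nval s a - nval s b"

fun rval :: "state \<Rightarrow> rexp \<Rightarrow> real" where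
  "rval s (RConst c) = of_rat c"
| "rval s (RArr x es) = rmem s x (map (nval s) es)"
| "rval s (RAdd a b) = rval s a + rval s b"
| "rval s (RSub a b) = rval s a - rval s b"
| "rval s (RMul a b) = rval s a * rval s b"
| "rval s (RDiv a b) = rval s a / rval s b"

fun bval :: "state \<Rightarrow> bexp \<Rightarrow> bool" where
  "bval s (NLess a b) = (nval s a < nval s b)"
| "bval s (RLess a b) = (rval s a < rval s b)"
| "bval s (BNot b) = (\<not> bval s b)"
| "bval s (BAnd a b) = (bval s a \<and> bval s b)"

text \<open>Unit cost: every constant, memory access, arithmetic operation, comparison and Boolean
  connective counts as one operation.\<close>

fun nops :: "nexp \<Rightarrow> nat" where
  "nops (NConst m) = 1"
| "nops (NArr x es) = 1 + sum_list (map nops es)"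
| "nops (NAdd a b) = 1 + nops a + nops b"
| "nops (NSub a b) = 1 + nops a + nops b"

fun rops :: "rexp \<Rightarrow> nat" where
  "rops (RConst c) = 1"
| "rops (RArr x es) = 1 + sum_list (map nops es)"
| "rops (RAdd a b) = 1 + rops a + rops b"
| "rops (RSub a b) = 1 + rops a + rops b"
| "rops (RMul a b) = 1 + rops a + rops b"
| "rops (RDiv a b) = 1 + rops a + rops b"

fun bops :: "bexp \<Rightarrow> nat" where
  "bops (NLess a b) = 1 + nops a + nops b"
| "bops (RLess a b) = 1 + rops a + rops b"
| "bops (BNot b) = 1 + bops b"
| "bops (BAnd a b) = 1 + bops a + bops b"

text \<open>Encoding lengths. \<^term>\<open>floorlog 2 m\<close> is the number of binary digits of \<^term>\<open>m\<close>.
  A rational number is encoded by numerator and denominator in lowest terms; the value of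
  \<open>real_bits\<close> at an irrational number is meaningless and is never used below.\<close>

definition nat_bits :: "nat \<Rightarrow> nat" where
  "nat_bits m = 1 + floorlog 2 m"

definition rat_bits :: "rat \<Rightarrow> nat" where
  "rat_bits r = (case quotient_of r of (a, b) \<Rightarrow> nat_bits (nat \<bar>a\<bar>) + nat_bits (nat \<bar>b\<bar>))"

definition real_bits :: "real \<Rightarrow> nat" where
  "real_bits x = rat_bits (THE r. x = of_rat r)"

text \<open>Logarithmic cost: every number that is read or computed, array indices included, is charged
  its encoding length. On rational data this is, up to a polynomial, running time on a Turing
  machine.\<close>

fun ncost :: "state \<Rightarrow> nexp \<Rightarrow> nat" where
  "ncost s (NConst m) = nat_bits m"
| "ncost s (NArr x es) = nat_bits (nval s (NArr x es)) + sum_list (map (ncost s) es)"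
| "ncost s (NAdd a b) = nat_bits (nval s (NAdd a b)) + ncost s a + ncost s b"
| "ncost s (NSub a b) = nat_bits (nval s (NSub a b)) + ncost s a + ncost s b"

fun rcost :: "state \<Rightarrow> rexp \<Rightarrow> nat" where
  "rcost s (RConst c) = rat_bits c"
| "rcost s (RArr x es) = real_bits (rval s (RArr x es)) + sum_list (map (ncost s) es)"
| "rcost s (RAdd a b) = real_bits (rval s (RAdd a b)) + rcost s a + rcost s b"
| "rcost s (RSub a b) = real_bits (rval s (RSub a b)) + rcost s a + rcost s b"
| "rcost s (RMul a b) = real_bits (rval s (RMul a b)) + rcost s a + rcost s b"
| "rcost s (RDiv a b) = real_bits (rval s (RDiv a b)) + rcost s a + rcost s b"

fun bcost :: "state \<Rightarrow> bexp \<Rightarrow> nat" where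
  "bcost s (NLess a b) = 1 + ncost s a + ncost s b"
| "bcost s (RLess a b) = 1 + rcost s a + rcost s b"
| "bcost s (BNot b) = 1 + bcost s b"
| "bcost s (BAnd a b) = 1 + bcost s a + bcost s b"

definition nwrite :: "string \<Rightarrow> nat list \<Rightarrow> nat \<Rightarrow> state \<Rightarrow> state" where
  "nwrite x is v s = s\<lparr>nmem := (nmem s)(x := (nmem s x)(is := v))\<rparr>"

definition rwrite :: "string \<Rightarrow> nat list \<Rightarrow> real \<Rightarrow> state \<Rightarrow> state" where
  "rwrite x is v s = s\<lparr>rmem := (rmem s)(x := (rmem s x)(is := v))\<rparr>"

text \<open>\<open>exec c s k b s'\<close>: started in \<open>s\<close>, the program \<open>c\<close> halts in \<open>s'\<close> after
  \<open>k\<close> operations, with logarithmic cost \<open>b\<close>.\<close>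

inductive exec :: "com \<Rightarrow> state \<Rightarrow> nat \<Rightarrow> nat \<Rightarrow> state \<Rightarrow> bool" where
  Skip: "exec Skip s 1 1 s"
| NAssign: "exec (NAssign x es e) s
    (1 + sum_list (map nops es) + nops e)
    (1 + sum_list (map (ncost s) es) + ncost s e)
    (nwrite x (map (nval s) es) (nval s e) s)"
| RAssign: "exec (RAssign x es e) s
    (1 + sum_list (map nops es) + rops e)
    (1 + sum_list (map (ncost s) es) + rcost s e)
    (rwrite x (map (nval s) es) (rval s e) s)"
| Seq: "exec c\<^sub>1 s k\<^sub>1 b\<^sub>1 s' \<Longrightarrow> exec c\<^sub>2 s' k\<^sub>2 b\<^sub>2 s'' \<Longrightarrow>
    exec (Seq c\<^sub>1 c\<^sub>2) s (k\<^sub>1 + k\<^sub>2) (b\<^sub>1 + b\<^sub>2) s''"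
| CondTrue: "bval s g \<Longrightarrow> exec c\<^sub>1 s k b s' \<Longrightarrow>
    exec (Cond g c\<^sub>1 c\<^sub>2) s (1 + bops g + k) (1 + bcost s g + b) s'"
| CondFalse: "\<not> bval s g \<Longrightarrow> exec c\<^sub>2 s k b s' \<Longrightarrow>
    exec (Cond g c\<^sub>1 c\<^sub>2) s (1 + bops g + k) (1 + bcost s g + b) s'"
| WhileFalse: "\<not> bval s g \<Longrightarrow> exec (While g c) s (1 + bops g) (1 + bcost s g) s"
| WhileTrue: "bval s g \<Longrightarrow> exec c s k\<^sub>1 b\<^sub>1 s' \<Longrightarrow> exec (While g c) s' k\<^sub>2 b\<^sub>2 s'' \<Longrightarrow>
    exec (While g c) s (1 + bops g + k\<^sub>1 + k\<^sub>2) (1 + bcost s g + b\<^sub>1 + b\<^sub>2) s''"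

inductive_cases exec_SkipE: "exec Skip s k b t"
inductive_cases exec_NAssignE: "exec (NAssign x es e) s k b t"
inductive_cases exec_RAssignE: "exec (RAssign x es e) s k b t"
inductive_cases exec_SeqE: "exec (Seq c\<^sub>1 c\<^sub>2) s k b t"
inductive_cases exec_CondE: "exec (Cond g c\<^sub>1 c\<^sub>2) s k b t"
inductive_cases exec_WhileE: "exec (While g c) s k b t"

lemma exec_deterministic:
  assumes "exec c s k b t" and "exec c s k' b' t'"
  shows "k' = k \<and> b' = b \<and> t' = t"
  using assms
proof (induction arbitrary: k' b' t' rule: exec.induct)
  case (Skip s)
  from Skip.prems show ?case by (rule exec_SkipE) simp
next
  case (NAssign x es e s)
  from NAssign.prems show ?case by (rule exec_NAssignE) simp
next
  case (RAssign x es e s)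
  from RAssign.prems show ?case by (rule exec_RAssignE) simp
next
  case (Seq c\<^sub>1 s k\<^sub>1 b\<^sub>1 s' c\<^sub>2 k\<^sub>2 b\<^sub>2 s'')
  from Seq.prems obtain k3 b3 u k4 b4
    where "k' = k3 + k4" "b' = b3 + b4" and 1: "exec c\<^sub>1 s k3 b3 u" and "exec c\<^sub>2 u k4 b4 t'"
    by (rule exec_SeqE)
  with Seq.IH(1)[OF 1] Seq.IH(2) show ?case by metis
next
  case (CondTrue s g c\<^sub>1 k b s' c\<^sub>2)
  from CondTrue.prems CondTrue.hyps obtain k3 b3
    where "k' = 1 + bops g + k3" "b' = 1 + bcost s g + b3" "exec c\<^sub>1 s k3 b3 t'"
    by (auto elim: exec_CondE)
  with CondTrue.IH show ?case by metis
next
  case (CondFalse s g c\<^sub>2 k b s' c\<^sub>1)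
  from CondFalse.prems CondFalse.hyps obtain k3 b3
    where "k' = 1 + bops g + k3" "b' = 1 + bcost s g + b3" "exec c\<^sub>2 s k3 b3 t'"
    by (auto elim: exec_CondE)
  with CondFalse.IH show ?case by metis
next
  case (WhileFalse s g c)
  from WhileFalse.prems WhileFalse.hyps show ?case
    by (auto elim: exec_WhileE)
next
  case (WhileTrue s g c k\<^sub>1 b\<^sub>1 s' k\<^sub>2 b\<^sub>2 s'')
  from WhileTrue.prems obtain k3 b3 u k4 b4
    where "k' = 1 + bops g + k3 + k4" "b' = 1 + bcost s g + b3 + b4"
      and 1: "exec c s k3 b3 u" and "exec (While g c) u k4 b4 t'"
    by (rule exec_WhileE) (use WhileTrue.hyps(1) in auto)
  with WhileTrue.IH(1)[OF 1] WhileTrue.IH(2) show ?case by metis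
qed

text \<open>
  A program solves a computational problem, given by a set \<open>I\<close> of instances, their representation
  \<open>ld\<close> in memory, and a relation \<open>Q\<close> between instances and correct final states.
\<close>

definition solves :: "com \<Rightarrow> 'i set \<Rightarrow> ('i \<Rightarrow> state) \<Rightarrow> ('i \<Rightarrow> state \<Rightarrow> bool) \<Rightarrow> bool" where
  "solves P I ld Q \<longleftrightarrow> (\<forall>x\<in>I. \<exists>k b t. exec P (ld x) k b t \<and> Q x t)"

text \<open>
  The number of operations is bounded by a polynomial in the dimension \<open>dm\<close> of the instance,
  whatever the real data are; and on instances with rational data (\<open>rl\<close>) the running time is
  bounded by a polynomial in the encoding length \<open>len\<close>.
\<close>

definition strongly_polynomial ::
  "com \<Rightarrow> 'i set \<Rightarrow> ('i \<Rightarrow> state) \<Rightarrow> ('i \<Rightarrow> nat) \<Rightarrow> ('i \<Rightarrow> bool) \<Rightarrow> ('i \<Rightarrow> nat) \<Rightarrow> bool" where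
  "strongly_polynomial P I ld dm rl len \<longleftrightarrow>
     (\<exists>p :: nat poly. \<forall>x\<in>I. \<exists>k b t. exec P (ld x) k b t \<and> k \<le> poly p (dm x)) \<and>
     (\<exists>q :: nat poly. \<forall>x\<in>I. rl x \<longrightarrow> (\<exists>k b t. exec P (ld x) k b t \<and> b \<le> poly q (len x)))"

text \<open>\<open>X i j t q\<close> is the entry in row \<open>t\<close> and column \<open>q\<close> of the matrix \<open>X(i,j)\<close>. Only the values
  with \<open>1 \<le> i < j \<le> n\<close>, \<open>1 \<le> t \<le> d i\<close>, \<open>1 \<le> q \<le> d j\<close> are relevant.\<close>

type_synonym matrices = "nat \<Rightarrow> nat \<Rightarrow> nat \<Rightarrow> nat \<Rightarrow> real"

text \<open>\<open>Cons1 i j k D1 D2 l\<close>, \<open>Cons2 i j k D1 D2 l\<close>, \<open>Cons3 i j k D1 D2 l\<close> name the members of the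
  three families of consistency inequalities; each has the form \<open>cons_lhs X c \<le> 1\<close>.\<close>

datatype cons_ineq =
    Cons1 nat nat nat "nat set" "nat set" nat
  | Cons2 nat nat nat "nat set" "nat set" nat
  | Cons3 nat nat nat "nat set" "nat set" nat

fun is_cons_ineq :: "nat \<Rightarrow> (nat \<Rightarrow> nat) \<Rightarrow> cons_ineq \<Rightarrow> bool" where
  "is_cons_ineq n d (Cons1 i j k D1 D2 l) \<longleftrightarrow> 1 \<le> i \<and> i < j \<and> j < k \<and> k \<le> n \<and>
     D1 \<noteq> {} \<and> D1 \<subseteq> {1..d i} \<and> D2 \<noteq> {} \<and> D2 \<subseteq> {1..d j} \<and> l \<in> {1..d k}"
| "is_cons_ineq n d (Cons2 i j k D1 D2 l) \<longleftrightarrow> 1 \<le> i \<and> i < j \<and> j < k \<and> k \<le> n \<and>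
     D1 \<noteq> {} \<and> D1 \<subseteq> {1..d j} \<and> D2 \<noteq> {} \<and> D2 \<subseteq> {1..d k} \<and> l \<in> {1..d i}"
| "is_cons_ineq n d (Cons3 i j k D1 D2 l) \<longleftrightarrow> 1 \<le> i \<and> i < j \<and> j < k \<and> k \<le> n \<and>
     D1 \<noteq> {} \<and> D1 \<subseteq> {1..d i} \<and> D2 \<noteq> {} \<and> D2 \<subseteq> {1..d k} \<and> l \<in> {1..d j}"

fun cons_lhs :: "matrices \<Rightarrow> cons_ineq \<Rightarrow> real" where
  "cons_lhs X (Cons1 i j k D1 D2 l) =
     - (\<Sum>t\<in>D1. \<Sum>q\<in>D2. X i j t q) + (\<Sum>q\<in>D2. X j k q l) + (\<Sum>t\<in>D1. X i k t l)"
| "cons_lhs X (Cons2 i j k D1 D2 l) =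
     (\<Sum>t\<in>D1. X i j l t) - (\<Sum>t\<in>D1. \<Sum>q\<in>D2. X j k t q) + (\<Sum>q\<in>D2. X i k l q)"
| "cons_lhs X (Cons3 i j k D1 D2 l) =
     (\<Sum>t\<in>D1. X i j t l) + (\<Sum>q\<in>D2. X j k l q) - (\<Sum>t\<in>D1. \<Sum>q\<in>D2. X i k t q)"

type_synonym sep_input = "nat \<times> (nat \<Rightarrow> nat) \<times> matrices"

definition sep_inputs :: "sep_input set" where
  "sep_inputs = {(n, d, X).
     n \<ge> 3 \<and> (\<forall>i\<in>{1..n}. d i \<ge> 1) \<and> Max (d ` {1..n}) \<ge> 2 \<and>
     (\<forall>i j. 1 \<le> i \<and> i < j \<and> j \<le> n \<longrightarrow>
        (\<forall>t\<in>{1..d i}. \<forall>q\<in>{1..d j}. 0 \<le> X i j t q \<and> X i j t q \<le> 1) \<and>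
        (\<forall>t\<in>{1..d i}. (\<Sum>q\<in>{1..d j}. X i j t q) \<le> 1) \<and>
        (\<forall>q\<in>{1..d j}. (\<Sum>t\<in>{1..d i}. X i j t q) \<le> 1))}"

fun sep_dim :: "sep_input \<Rightarrow> nat" where
  "sep_dim (n, d, X) = n + (\<Sum>i\<in>{1..n}. d i)"

fun sep_rational :: "sep_input \<Rightarrow> bool" where
  "sep_rational (n, d, X) \<longleftrightarrow>
     (\<forall>i j. 1 \<le> i \<and> i < j \<and> j \<le> n \<longrightarrow> (\<forall>t\<in>{1..d i}. \<forall>q\<in>{1..d j}. X i j t q \<in> \<rat>))"

fun sep_length :: "sep_input \<Rightarrow> nat" where
  "sep_length (n, d, X) = nat_bits n + (\<Sum>i\<in>{1..n}. nat_bits (d i)) +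
     (\<Sum>i\<in>{1..n}. \<Sum>j\<in>{i<..n}. \<Sum>t\<in>{1..d i}. \<Sum>q\<in>{1..d j}. real_bits (X i j t q))"

text \<open>All memory cells outside the input are initially zero.\<close>

fun sep_load :: "sep_input \<Rightarrow> state" where
  "sep_load (n, d, X) =
     \<lparr>nmem = (\<lambda>x is.
        if x = ''n'' \<and> is = [] then n
        else if x = ''d'' then (case is of [i] \<Rightarrow> if i \<in> {1..n} then d i else 0 | _ \<Rightarrow> 0)
        else 0),
      rmem = (\<lambda>x is.
        if x = ''X'' then
          (case is of [i, j, t, q] \<Rightarrow>
             if 1 \<le> i \<and> i < j \<and> j \<le> n \<and> t \<in> {1..d i} \<and> q \<in> {1..d j} then X i j t q else 0
           | _ \<Rightarrow> 0)
        else 0)\<rparr>"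

text \<open>The answer is read off from the integer memory: \<open>type = 0\<close> means that no inequality is
  violated; otherwise \<open>type\<close> is the family of the reported inequality, and \<open>D1\<close>, \<open>D2\<close> are given by
  their characteristic vectors.\<close>

definition sep_output :: "state \<Rightarrow> cons_ineq option" where
  "sep_output s =
     (let i = nmem s ''i'' []; j = nmem s ''j'' []; k = nmem s ''k'' []; l = nmem s ''l'' [];
          D1 = {t. nmem s ''D1'' [t] = 1}; D2 = {q. nmem s ''D2'' [q] = 1};
          ty = nmem s ''type'' []
      in if ty = 0 then None
         else if ty = 1 then Some (Cons1 i j k D1 D2 l)
         else if ty = 2 then Some (Cons2 i j k D1 D2 l)
         else Some (Cons3 i j k D1 D2 l))"

fun sep_correct :: "sep_input \<Rightarrow> state \<Rightarrow> bool" where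
  "sep_correct (n, d, X) s \<longleftrightarrow>
     (case sep_output s of
        None \<Rightarrow> \<forall>c. is_cons_ineq n d c \<longrightarrow> cons_lhs X c \<le> 1
      | Some c \<Rightarrow> is_cons_ineq n d c \<and> \<not> cons_lhs X c \<le> 1)"

end

theory Submission
  imports Defs
begin

text \<open>
  Fix \<open>i < j < k\<close>, one of the three families and the index \<open>l\<close>. After renaming the roles of
  \<open>i, j, k\<close>, the left-hand sides of the inequalities with these data are
  \<open>(\<Sum>t\<in>D\<^sub>1. a t) + (\<Sum>q\<in>D\<^sub>2. b q) - (\<Sum>t\<in>D\<^sub>1. \<Sum>q\<in>D\<^sub>2. w t q)\<close> with \<open>w \<ge> 0\<close>. Let the indices \<open>t\<close> and
  \<open>q\<close> be the nodes of a bipartite network and encode \<open>(D\<^sub>1, D\<^sub>2)\<close> by the node set \<open>S\<close> that consists of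
  \<open>D\<^sub>1\<close> and of the complement of \<open>D\<^sub>2\<close>. Up to the constant \<open>\<Sum>q. b q\<close>, the left-hand side is then
  the sum of a node weight (\<open>a\<close> on the left, \<open>-b\<close> on the right) over \<open>S\<close>, minus the weight of the arcs
  that leave \<open>S\<close>. Maximizing it is a minimum cut problem. A set \<open>S\<close> whose value exceeds 1
  yields a consistency inequality, with nonempty \<open>D\<^sub>1\<close> and \<open>D\<^sub>2\<close>: if one of them is empty, what remains is
  part of a row or column sum, hence at most 1.

  The cut problem is solved by a push-relabel method without source and sink. A state consists of excesses
  \<open>e\<close>, residual capacities \<open>r\<close> and heights \<open>h\<close>; a push along an arc changes \<open>e\<close> and \<open>r\<close> but not the
  quantity \<open>(\<Sum>u\<in>S. e u) - (\<Sum>u\<in>S. \<Sum>v\<notin>S. r u v)\<close>, for any \<open>S\<close> (\<open>push_cut_gain\<close>). Nodes of positive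
  excess are processed only below a height cap that exceeds the number of nodes by two. When no such node
  is left, some level \<open>g\<close> below the cap is free of nodes by the pigeonhole principle
  (\<open>exists_gap\<close>), no residual arc crosses the gap downwards, and the nodes above it form an optimal
  \<open>S\<close> (\<open>gap_cut_optimal\<close>). As long as such nodes exist, a pass that discharges every node once
  either raises some height or lowers the maximal height of such a node; hence cubically many
  passes in the number of nodes suffice (\<open>push_relabel_optimal\<close>). The number of passes is fixed in
  advance, and the program then tries all levels \<open>g\<close> and compares the value of the cut with 1.

  Since it needs only bounded loops, the program is written in a small language of loop programs that
  has a total semantics and is compiled to while programs. If the loop bounds are sums of
  \<open>n\<close>, entries of \<open>d\<close> and constants, the number of operations is polynomial in the dimension for
  syntactic reasons (\<open>exec_compile\<close>, \<open>poly_bounded_op_bound\<close>). Bit lengths are controlled just as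
  syntactically: without multiplication and division, every operation on rationals with a common
  denominator \<open>L\<close> yields a multiple of \<open>1/L\<close> and adds at most one bit to the numerator, so that
  polynomially many operations have polynomial logarithmic cost (\<open>exec_bits\<close>). Correctness is then a
  statement about the total semantics alone (\<open>separation_prog_correct\<close>).
\<close>

section \<open>Loop programs\<close>


text \<open>
  A \<open>PFor x e p\<close> runs \<open>p\<close> with \<open>x = 1, ..., e\<close>. The bound is meant to be evaluated only once, at the
  start, which makes the semantics total; the condition \<open>well_bounded\<close> below ensures that the compiled
  while loop, which evaluates the bound in every round, behaves in the same way.
\<close>

datatype prog =
    PSkip
  | PNat string "nexp list" nexp
  | PReal string "nexp list" rexp
  | PSeq prog prog
  | PIf bexp prog prog
  | PFor string nexp prog

primrec compile :: "prog \<Rightarrow> com" where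
  "compile PSkip = Skip"
| "compile (PNat x es e) = NAssign x es e"
| "compile (PReal x es e) = RAssign x es e"
| "compile (PSeq p q) = Seq (compile p) (compile q)"
| "compile (PIf g p q) = Cond g (compile p) (compile q)"
| "compile (PFor x e p) = Seq (NAssign x [] (NConst 1))
     (While (BNot (NLess e (NArr x []))) (Seq (compile p) (NAssign x [] (NAdd (NArr x []) (NConst 1)))))"

text \<open>
  The counter of a finished loop holds the first value beyond the bound, as after the while loop.
\<close>

primrec sem :: "prog \<Rightarrow> state \<Rightarrow> state" where
  "sem PSkip s = s"
| "sem (PNat x es e) s = nwrite x (map (nval s) es) (nval s e) s"
| "sem (PReal x es e) s = rwrite x (map (nval s) es) (rval s e) s"
| "sem (PSeq p q) s = sem q (sem p s)"
| "sem (PIf g p q) s = (if bval s g then sem p s else sem q s)"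
| "sem (PFor x e p) s = nwrite x [] (Suc (nval s e))
     (fold (\<lambda>m s. sem p (nwrite x [] m s)) [1..<Suc (nval s e)] s)"

primrec writes :: "prog \<Rightarrow> string set" where
  "writes PSkip = {}"
| "writes (PNat x es e) = {x}"
| "writes (PReal x es e) = {x}"
| "writes (PSeq p q) = writes p \<union> writes q"
| "writes (PIf g p q) = writes p \<union> writes q"
| "writes (PFor x e p) = insert x (writes p)"

text \<open>
  Number and real arrays have separate memories, but a name outside \<open>W\<close> is protected in both. One set
  of names then describes the frame of a program.
\<close>

definition same_except :: "string set \<Rightarrow> state \<Rightarrow> state \<Rightarrow> bool" where
  "same_except W s t \<longleftrightarrow> (\<forall>x. x \<notin> W \<longrightarrow> nmem t x = nmem s x \<and> rmem t x = rmem s x)"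

lemma nmem_nwrite [simp]: "nmem (nwrite x is v s) = (nmem s)(x := (nmem s x)(is := v))"
  and rmem_nwrite [simp]: "rmem (nwrite x is v s) = rmem s"
  and nmem_rwrite [simp]: "nmem (rwrite x is a s) = nmem s"
  and rmem_rwrite [simp]: "rmem (rwrite x is a s) = (rmem s)(x := (rmem s x)(is := a))"
  by (simp_all add: nwrite_def rwrite_def)

lemma nwrite_nwrite [simp]: "nwrite x is v (nwrite x is v' s) = nwrite x is v s"
  by (simp add: nwrite_def)

lemma same_except_trans:
  "same_except W s t \<Longrightarrow> same_except W' t u \<Longrightarrow> W \<subseteq> W'' \<Longrightarrow> W' \<subseteq> W'' \<Longrightarrow> same_except W'' s u"
  unfolding same_except_def by (metis subsetD)

lemma same_except_nwrite: "x \<in> W \<Longrightarrow> same_except W s (nwrite x is v s)"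
  and same_except_rwrite: "x \<in> W \<Longrightarrow> same_except W s (rwrite x is a s)"
  by (auto simp: same_except_def)

lemma same_except_refl: "same_except W s s"
  by (simp add: same_except_def)

lemma same_except_fold:
  assumes "\<And>m s. m \<in> set ms \<Longrightarrow> same_except W s (f m s)"
  shows "same_except W s (fold f ms s)"
  using assms
proof (induction ms arbitrary: s)
  case (Cons m ms)
  have "same_except W s (f m s)" "same_except W (f m s) (fold f ms (f m s))"
    using Cons by auto
  then show ?case
    by (auto simp: same_except_def)
qed (simp add: same_except_refl)

lemma sem_same_except: "same_except (writes p) s (sem p s)"
proof (induction p arbitrary: s)
  case (PSeq p q)
  have "same_except (writes p) s (sem p s)" "same_except (writes q) (sem p s) (sem q (sem p s))"
    by (rule PSeq.IH)+
  then show ?case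
    by (auto simp: same_except_def)
next
  case (PIf g p q)
  have "same_except (writes p) s (sem p s)" "same_except (writes q) s (sem q s)"
    by (rule PIf.IH)+
  then show ?case
    by (auto simp: same_except_def)
next
  case (PFor x e p)
  let ?W = "insert x (writes p)"
  have "same_except ?W s (sem p (nwrite x [] m s))" for m s
    by (rule same_except_trans[OF same_except_nwrite PFor.IH]) auto
  then have "same_except ?W s (fold (\<lambda>m s. sem p (nwrite x [] m s)) [1..<Suc (nval s e)] s)"
    by (rule same_except_fold)
  then show ?case
    by (auto simp: same_except_def)
qed (auto simp: same_except_def)

fun nexp_names :: "nexp \<Rightarrow> string set" where
  "nexp_names (NConst m) = {}"
| "nexp_names (NArr x es) = insert x (\<Union>e\<in>set es. nexp_names e)"
| "nexp_names (NAdd a b) = nexp_names a \<union> nexp_names b"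
| "nexp_names (NSub a b) = nexp_names a \<union> nexp_names b"

lemma nval_same_except:
  assumes "same_except W s t" "nexp_names e \<inter> W = {}"
  shows "nval t e = nval s e"
  using assms(2)
proof (induction e)
  case (NArr x es)
  have "map (nval t) es = map (nval s) es"
    using NArr by auto
  moreover have "nmem t x = nmem s x"
    using assms(1) NArr.prems by (auto simp: same_except_def)
  ultimately show ?case
    by (simp del: map_eq_conv)
qed (auto simp: Int_Un_distrib2)

section \<open>Counting operations\<close>

text \<open>
  Every array access is replaced by \<open>N\<close>, whatever its indices, so that the bound does not depend on the
  memory apart from the size of its entries.
\<close>

fun bound :: "nexp \<Rightarrow> nat \<Rightarrow> nat" where
  "bound (NConst m) N = m"
| "bound (NArr x es) N = N"
| "bound (NAdd a b) N = bound a N + bound b N"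
| "bound (NSub a b) N = bound a N"

fun reads_only :: "string set \<Rightarrow> nexp \<Rightarrow> bool" where
  "reads_only I (NConst m) = True"
| "reads_only I (NArr x es) = (x \<in> I)"
| "reads_only I (NAdd a b) = (reads_only I a \<and> reads_only I b)"
| "reads_only I (NSub a b) = (reads_only I a \<and> reads_only I b)"

lemma nval_le_bound:
  assumes "\<And>x is. x \<in> I \<Longrightarrow> nmem s x is \<le> N" "reads_only I e"
  shows "nval s e \<le> bound e N"
  using assms(2) by (induction e) (auto simp: assms(1) intro: add_mono le_trans[OF diff_le_self])

text \<open>
  The loop bounds read only arrays in \<open>I\<close>, which the program never writes, so that their values are
  controlled by the input. The indices of these accesses may use other variables, for example counters of
  outer loops, but none that changes inside the loop.
\<close>

primrec well_bounded :: "string set \<Rightarrow> prog \<Rightarrow> bool" where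
  "well_bounded I PSkip = True"
| "well_bounded I (PNat x es e) = (x \<notin> I)"
| "well_bounded I (PReal x es e) = (x \<notin> I)"
| "well_bounded I (PSeq p q) = (well_bounded I p \<and> well_bounded I q)"
| "well_bounded I (PIf g p q) = (well_bounded I p \<and> well_bounded I q)"
| "well_bounded I (PFor x e p) = (x \<notin> I \<and> x \<notin> writes p \<and> reads_only I e \<and>
     nexp_names e \<inter> insert x (writes p) = {} \<and> well_bounded I p)"

text \<open>
  For a loop: 2 operations for the initialization, \<open>4 + nops e\<close> for each test of the bound and 4 for each
  increment of the counter.
\<close>

primrec op_bound :: "prog \<Rightarrow> nat \<Rightarrow> nat" where
  "op_bound PSkip N = 1"
| "op_bound (PNat x es e) N = 1 + sum_list (map nops es) + nops e"
| "op_bound (PReal x es e) N = 1 + sum_list (map nops es) + rops e"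
| "op_bound (PSeq p q) N = op_bound p N + op_bound q N"
| "op_bound (PIf g p q) N = 1 + bops g + op_bound p N + op_bound q N"
| "op_bound (PFor x e p) N = 6 + nops e + bound e N * (8 + nops e + op_bound p N)"

lemma well_bounded_not_written: "well_bounded I p \<Longrightarrow> x \<in> I \<Longrightarrow> x \<notin> writes p"
  by (induction p) auto

lemma well_bounded_sem_nmem: "well_bounded I p \<Longrightarrow> x \<in> I \<Longrightarrow> nmem (sem p s) x = nmem s x"
  using sem_same_except[of p s] well_bounded_not_written by (auto simp: same_except_def)

text \<open>
  In the induction for a loop, the invariant state is the one before the counter is set: a round starts by
  overwriting the counter, which hides whether the value was stored by the loop head or by the end of
  the previous round.
\<close>

lemma exec_compile:
  assumes "well_bounded I p" "\<And>x is. x \<in> I \<Longrightarrow> nmem s x is \<le> N"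
  shows "\<exists>k b. exec (compile p) s k b (sem p s) \<and> k \<le> op_bound p N"
  using assms
proof (induction p arbitrary: s)
  case PSkip
  show ?case using exec.Skip by fastforce
next
  case (PNat x es e)
  show ?case using exec.NAssign by fastforce
next
  case (PReal x es e)
  show ?case using exec.RAssign by fastforce
next
  case (PSeq p q)
  have "nmem (sem p s) x ks \<le> N" if "x \<in> I" for x ks
    using PSeq.prems that by (simp add: well_bounded_sem_nmem[OF _ that])
  then obtain k' b' where 1: "exec (compile q) (sem p s) k' b' (sem q (sem p s))" "k' \<le> op_bound q N"
    using PSeq.IH(2)[of "sem p s"] PSeq.prems(1) by auto
  obtain k b where 2: "exec (compile p) s k b (sem p s)" "k \<le> op_bound p N"
    using PSeq.IH(1)[of s] PSeq.prems by auto
  show ?case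
    using exec.Seq[OF 2(1) 1(1)] 1(2) 2(2) by (auto intro!: exI add_mono)
next
  case (PIf g p q)
  obtain k b where 1: "exec (compile p) s k b (sem p s)" "k \<le> op_bound p N"
    using PIf.IH(1)[of s] PIf.prems by auto
  obtain k' b' where 2: "exec (compile q) s k' b' (sem q s)" "k' \<le> op_bound q N"
    using PIf.IH(2)[of s] PIf.prems by auto
  show ?case
  proof (cases "bval s g")
    case True
    then show ?thesis
      using exec.CondTrue[OF True 1(1), of "compile q"] 1(2) by (fastforce intro!: exI)
  next
    case False
    then show ?thesis
      using exec.CondFalse[OF False 2(1), of "compile p"] 2(2) by (fastforce intro!: exI)
  qed
next
  case (PFor x e p)
  let ?g = "BNot (NLess e (NArr x []))"
  let ?c = "Seq (compile p) (NAssign x [] (NAdd (NArr x []) (NConst 1)))"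
  let ?f = "\<lambda>m s. sem p (nwrite x [] m s)"
  define B where "B = nval s e"
  have x: "x \<notin> writes p" "x \<notin> I" and e: "nexp_names e \<inter> insert x (writes p) = {}"
    using PFor.prems by auto
  have loop: "\<exists>k b. exec (While ?g ?c) (nwrite x [] m s) k b (nwrite x [] (Suc B) (fold ?f [m..<Suc B] s)) \<and>
      k \<le> 4 + nops e + (Suc B - m) * (8 + nops e + op_bound p N)"
    if "m \<le> Suc B" "nval s e = B" "\<And>x is. x \<in> I \<Longrightarrow> nmem s x is \<le> N" for m s
    using that
  proof (induction "Suc B - m" arbitrary: m s)
    case 0
    then have m: "m = Suc B" by simp
    have "nval (nwrite x [] m s) e = B"
      using nval_same_except[OF same_except_nwrite[of x "{x}" s "[]" m], of e] e 0 by auto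
    then have "\<not> bval (nwrite x [] m s) ?g"
      by (simp add: m)
    from exec.WhileFalse[OF this, of ?c] show ?case
      by (fastforce simp: m)
  next
    case (Suc r)
    let ?s = "nwrite x [] m s" and ?s' = "sem p (nwrite x [] m s)"
    have m: "m < Suc B" using Suc by simp
    have v: "nval ?s e = B"
      using nval_same_except[OF same_except_nwrite[of x "{x}" s "[]" m], of e] e Suc by auto
    have v': "nval ?s' e = B"
      using nval_same_except[OF sem_same_except, of e p ?s] e v by auto
    have N: "\<And>y is. y \<in> I \<Longrightarrow> nmem ?s y is \<le> N"
      using x Suc by auto
    have N': "nmem ?s' y ks \<le> N" if "y \<in> I" for y ks
      using PFor.prems(1) N[OF that] by (simp add: well_bounded_sem_nmem[OF _ that] del: nmem_nwrite)
    obtain k b where kb: "exec (compile p) ?s k b ?s'" "k \<le> op_bound p N"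
      using PFor.IH[of ?s] N PFor.prems(1) by auto
    have xm: "nmem ?s' x [] = m"
      using sem_same_except[of p ?s] x by (simp add: same_except_def)
    obtain b1 where b1: "exec (NAssign x [] (NAdd (NArr x []) (NConst 1))) ?s' 4 b1 (nwrite x [] (Suc m) ?s')"
      using exec.NAssign[of x "[]" "NAdd (NArr x []) (NConst 1)" ?s'] xm by (auto simp: eval_nat_numeral)
    have ih: "\<exists>k b. exec (While ?g ?c) (nwrite x [] (Suc m) ?s') k b
        (nwrite x [] (Suc B) (fold ?f [Suc m..<Suc B] ?s')) \<and>
        k \<le> 4 + nops e + (Suc B - Suc m) * (8 + nops e + op_bound p N)"
      by (rule Suc.hyps(1)) (use Suc.hyps m v' N' in auto)
    then obtain k2 b2 where 2: "exec (While ?g ?c) (nwrite x [] (Suc m) ?s') k2 b2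
        (nwrite x [] (Suc B) (fold ?f [Suc m..<Suc B] ?s'))"
        "k2 \<le> 4 + nops e + (Suc B - Suc m) * (8 + nops e + op_bound p N)"
      by blast
    have g: "bval ?s ?g"
      using m v by simp
    have "[m..<Suc B] = m # [Suc m..<Suc B]"
      using m by (rule upt_conv_Cons)
    then have "exec (While ?g ?c) ?s (1 + bops ?g + (k + 4) + k2) (1 + bcost ?s ?g + (b + b1) + b2)
        (nwrite x [] (Suc B) (fold ?f [m..<Suc B] s))"
      using exec.WhileTrue[OF g exec.Seq[OF kb(1) b1] 2(1)] by (simp only: fold_simps)
    moreover have "Suc B - m = Suc (Suc B - Suc m)"
      using m by simp
    then have "1 + bops ?g + (k + 4) + k2 \<le> 4 + nops e + (Suc B - m) * (8 + nops e + op_bound p N)"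
      using kb(2) 2(2) by (simp only: mult_Suc) simp
    ultimately show ?case by blast
  qed
  have "\<exists>k b. exec (While ?g ?c) (nwrite x [] 1 s) k b (nwrite x [] (Suc B) (fold ?f [1..<Suc B] s)) \<and>
      k \<le> 4 + nops e + (Suc B - 1) * (8 + nops e + op_bound p N)"
    by (rule loop) (use PFor.prems(2) in \<open>auto simp: B_def\<close>)
  then obtain k b where kb:
    "exec (While ?g ?c) (nwrite x [] 1 s) k b (nwrite x [] (Suc B) (fold ?f [1..<Suc B] s))"
    "k \<le> 4 + nops e + (Suc B - 1) * (8 + nops e + op_bound p N)"
    by blast
  have "B \<le> bound e N"
    unfolding B_def using PFor.prems by (intro nval_le_bound[of I]) auto
  then have le: "B * (8 + nops e + op_bound p N) \<le> bound e N * (8 + nops e + op_bound p N)"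
    by (rule mult_le_mono1)
  obtain b1 where b1: "exec (NAssign x [] (NConst 1)) s 2 b1 (nwrite x [] 1 s)"
    using exec.NAssign[of x "[]" "NConst 1" s] by (auto simp: eval_nat_numeral)
  have "exec (compile (PFor x e p)) s (2 + k) (b1 + b) (sem (PFor x e p) s)"
    using exec.Seq[OF b1 kb(1)] by (simp only: B_def compile.simps sem.simps)
  moreover have "2 + k \<le> op_bound (PFor x e p) N"
    using kb(2) le unfolding op_bound.simps diff_Suc_1 by linarith
  ultimately show ?case by blast
qed

definition poly_bounded :: "(nat \<Rightarrow> nat) \<Rightarrow> bool" where
  "poly_bounded f \<longleftrightarrow> (\<exists>p :: nat poly. \<forall>N. f N \<le> poly p N)"

lemma poly_bounded_const: "poly_bounded (\<lambda>N. c)"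
  unfolding poly_bounded_def by (rule exI[of _ "[:c:]"]) simp

lemma poly_bounded_id: "poly_bounded (\<lambda>N. N)"
  unfolding poly_bounded_def by (rule exI[of _ "[:0, 1:]"]) simp

lemma poly_bounded_add: "poly_bounded f \<Longrightarrow> poly_bounded g \<Longrightarrow> poly_bounded (\<lambda>N. f N + g N)"
  unfolding poly_bounded_def by (metis add_mono poly_add)

lemma poly_bounded_mult: "poly_bounded f \<Longrightarrow> poly_bounded g \<Longrightarrow> poly_bounded (\<lambda>N. f N * g N)"
  unfolding poly_bounded_def by (metis mult_le_mono poly_mult)

lemma poly_bounded_Suc: "poly_bounded f \<Longrightarrow> poly_bounded (\<lambda>N. Suc (f N))"
  using poly_bounded_add[OF poly_bounded_const[of 1]] by simp

lemmas poly_bounded_intros = poly_bounded_Suc poly_bounded_const poly_bounded_id poly_bounded_add poly_bounded_mult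

lemma poly_bounded_bound: "poly_bounded (bound e)"
proof (induction e)
  case (NSub a b)
  have "bound (NSub a b) = bound a" by auto
  then show ?case using NSub by simp
qed (simp_all add: poly_bounded_intros)

text \<open>
  A fixed program contains finitely many nested loops, and each multiplies the cost of its body by a
  polynomially bounded factor.
\<close>

lemma poly_bounded_op_bound: "poly_bounded (op_bound p)"
  by (induction p) (simp_all add: poly_bounded_intros poly_bounded_bound)

section \<open>Reasoning about loops\<close>

text \<open>
  Besides the invariant, the step may use that the current state agrees with the initial one outside
  the names that the loop writes. So invariants need not mention what stays unchanged. The last premise
  says that the invariant does not speak about the counter.
\<close>

lemma sem_For_invariant:
  assumes "I 0 s"
    and "\<And>m t. 1 \<le> m \<Longrightarrow> m \<le> nval s e \<Longrightarrow> same_except (insert x (writes p)) s t \<Longrightarrow> nmem t x [] = m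
      \<Longrightarrow> I (m - 1) t \<Longrightarrow> I m (sem p t)"
    and "\<And>m k t. I m t \<Longrightarrow> I m (nwrite x [] k t)"
  shows "I (nval s e) (sem (PFor x e p) s)"
proof -
  let ?W = "insert x (writes p)"
  have "k \<le> nval s e \<Longrightarrow> same_except ?W s (fold (\<lambda>m s. sem p (nwrite x [] m s)) [1..<Suc k] s) \<and>
      I k (fold (\<lambda>m s. sem p (nwrite x [] m s)) [1..<Suc k] s)" for k
  proof (induction k)
    case 0
    then show ?case using assms(1) by (simp add: same_except_refl)
  next
    case (Suc k)
    define t where "t = fold (\<lambda>m s. sem p (nwrite x [] m s)) [1..<Suc k] s"
    have t: "same_except ?W s t" "I k t"
      using Suc by (auto simp: t_def)
    have w: "same_except ?W s (nwrite x [] (Suc k) t)"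
      by (rule same_except_trans[OF t(1) same_except_nwrite[of x ?W]]) auto
    have "I (Suc k) (sem p (nwrite x [] (Suc k) t))"
      by (rule assms(2)) (use Suc.prems w assms(3) t(2) in auto)
    moreover have "same_except ?W s (sem p (nwrite x [] (Suc k) t))"
      by (rule same_except_trans[OF w sem_same_except]) auto
    ultimately show ?case
      by (simp add: t_def)
  qed
  from this[of "nval s e"] show ?thesis
    using assms(3) by simp
qed

text \<open>
  If the effect of the body on a view \<open>\<alpha>\<close> of the memory is the function \<open>f m\<close>, then the loop
  iterates these functions. This lifts single steps of the network algorithm to the whole algorithm.
\<close>

lemma sem_For_fold:
  assumes "\<And>m t. 1 \<le> m \<Longrightarrow> m \<le> nval s e \<Longrightarrow> same_except (insert x (writes p)) s t \<Longrightarrow> nmem t x [] = m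
      \<Longrightarrow> \<alpha> (sem p t) = f m (\<alpha> t)"
    and "\<And>k t. \<alpha> (nwrite x [] k t) = \<alpha> t"
  shows "\<alpha> (sem (PFor x e p) s) = fold f [1..<Suc (nval s e)] (\<alpha> s)"
proof (rule sem_For_invariant[where I = "\<lambda>m t. \<alpha> t = fold f [1..<Suc m] (\<alpha> s)"])
  fix m t
  assume m: "1 \<le> m" "m \<le> nval s e" "same_except (insert x (writes p)) s t" "nmem t x [] = m"
    "\<alpha> t = fold f [1..<Suc (m - 1)] (\<alpha> s)"
  have "[1..<Suc m] = [1..<Suc (m - 1)] @ [m]"
    using m(1) by simp
  then show "\<alpha> (sem p t) = fold f [1..<Suc m] (\<alpha> s)"
    using m assms(1) by simp
qed (simp_all add: assms(2))

section \<open>Bit lengths of additive programs\<close>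

text \<open>
  The bound 4 on constants is arbitrary; it only has to be covered by the two extra bits that are
  granted to every state below.
\<close>

fun small_consts :: "nexp \<Rightarrow> bool" where
  "small_consts (NConst m) = (m < 4)"
| "small_consts (NArr x es) = list_all small_consts es"
| "small_consts (NAdd a b) = (small_consts a \<and> small_consts b)"
| "small_consts (NSub a b) = (small_consts a \<and> small_consts b)"

fun additive_rexp :: "rexp \<Rightarrow> bool" where
  "additive_rexp (RConst c) = (c = 0 \<or> c = 1)"
| "additive_rexp (RArr x es) = list_all small_consts es"
| "additive_rexp (RAdd a b) = (additive_rexp a \<and> additive_rexp b)"
| "additive_rexp (RSub a b) = (additive_rexp a \<and> additive_rexp b)"
| "additive_rexp (RMul a b) = False"
| "additive_rexp (RDiv a b) = False"

fun additive_bexp :: "bexp \<Rightarrow> bool" where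
  "additive_bexp (NLess a b) = (small_consts a \<and> small_consts b)"
| "additive_bexp (RLess a b) = (additive_rexp a \<and> additive_rexp b)"
| "additive_bexp (BNot b) = additive_bexp b"
| "additive_bexp (BAnd a b) = (additive_bexp a \<and> additive_bexp b)"

fun additive :: "com \<Rightarrow> bool" where
  "additive Skip = True"
| "additive (NAssign x es e) = (list_all small_consts es \<and> small_consts e)"
| "additive (RAssign x es e) = (list_all small_consts es \<and> additive_rexp e)"
| "additive (Seq c d) = (additive c \<and> additive d)"
| "additive (Cond g c d) = (additive_bexp g \<and> additive c \<and> additive d)"
| "additive (While g c) = (additive_bexp g \<and> additive c)"

text \<open>
  All numbers have at most \<open>B\<close> bits, the reals over the common denominator \<open>L\<close>. The denominator never
  changes during an additive program, and \<open>B\<close> grows by one with each operation.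
\<close>

definition fits :: "nat \<Rightarrow> nat \<Rightarrow> state \<Rightarrow> bool" where
  "fits L B s \<longleftrightarrow> (\<forall>x ks. nmem s x ks < 2 ^ B) \<and>
     (\<forall>x ks. \<exists>z :: int. rmem s x ks = of_int z / of_nat L \<and> \<bar>z\<bar> < 2 ^ B)"

lemma fits_mono:
  assumes "fits L B s" "B \<le> C"
  shows "fits L C s"
proof -
  have "(2 :: nat) ^ B \<le> 2 ^ C" "(2 :: int) ^ B \<le> 2 ^ C"
    using assms(2) by (auto intro: power_increasing)
  then show ?thesis
    using assms(1) unfolding fits_def by (meson less_le_trans)
qed

lemma nat_bits_le: "m < 2 ^ B \<Longrightarrow> nat_bits m \<le> 1 + B"
  unfolding nat_bits_def by (simp add: floorlog_leI)

lemma less_nat_bits: "m < 2 ^ nat_bits m"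
proof -
  have "m < 2 ^ floorlog 2 m" by (rule floorlog_leD) auto
  also have "\<dots> \<le> 2 ^ nat_bits m" by (simp add: nat_bits_def)
  finally show ?thesis .
qed

text \<open>
  Passing to lowest terms replaces numerator and denominator by divisors, which are not longer.
\<close>

lemma real_bits_fraction:
  fixes z :: int and L :: nat
  assumes "0 < L" "L < 2 ^ B" "\<bar>z\<bar> < 2 ^ C"
  shows "real_bits (of_int z / of_nat L) \<le> 2 + B + C"
proof -
  define r :: rat where "r = of_int z / of_nat L"
  have r: "of_int z / of_nat L = (of_rat r :: real)"
    by (simp add: r_def of_rat_divide)
  have the: "(THE r'. of_int z / of_nat L = (of_rat r' :: real)) = r"
    unfolding r by (rule the_equality) auto
  obtain a b where q: "quotient_of r = (a, b)" by force
  have b: "0 < b" and cop: "coprime a b" and rab: "r = of_int a / of_int b"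
    using quotient_of_denom_pos[OF q] quotient_of_coprime[OF q] quotient_of_div[OF q] by auto
  have "of_int z * of_int b = (of_int a * of_nat L :: rat)"
    using rab b assms(1) unfolding r_def by (simp add: field_simps)
  then have eq: "z * b = a * int L"
    by (metis (mono_tags) of_int_eq_iff of_int_mult of_int_of_nat_eq)
  have "b dvd int L"
    using eq cop by (metis coprime_commute coprime_dvd_mult_right_iff dvd_triv_right)
  then have bL: "b \<le> int L"
    using assms(1) by (simp add: zdvd_imp_le)
  have "a dvd z"
    using eq cop by (metis coprime_dvd_mult_left_iff dvd_triv_left)
  moreover have "a = 0" if "z = 0"
    using eq that assms(1) by simp
  ultimately have az: "\<bar>a\<bar> \<le> \<bar>z\<bar>"
    by (metis dvd_imp_le_int order_refl)
  have "nat \<bar>a\<bar> < 2 ^ C"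
    using az assms(3) by (simp add: nat_less_iff)
  moreover have "nat \<bar>b\<bar> < 2 ^ B"
  proof -
    have "nat \<bar>b\<bar> \<le> L" using b bL by simp
    then show ?thesis using assms(2) by (rule le_less_trans)
  qed
  ultimately have "nat_bits (nat \<bar>a\<bar>) + nat_bits (nat \<bar>b\<bar>) \<le> (1 + C) + (1 + B)"
    by (intro add_mono nat_bits_le)
  then show ?thesis
    by (simp add: real_bits_def the rat_bits_def q)
qed

lemma sum_list_cost:
  fixes f g :: "'a \<Rightarrow> nat"
  assumes "\<And>e. e \<in> set es \<Longrightarrow> f e \<le> g e * W"
  shows "sum_list (map f es) \<le> sum_list (map g es) * W"
  using assms by (induction es) (auto simp: add_mult_distrib intro: add_mono)

lemma elem_le_sum_list_map: "e \<in> set es \<Longrightarrow> (g e :: nat) \<le> sum_list (map g es)"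
  by (induction es) auto

lemma double_power: "(2 :: 'a :: linordered_semidom) ^ (B + a) + 2 ^ (B + b) \<le> 2 ^ (B + Suc (a + b))"
proof -
  have "(2 :: 'a) ^ (B + a) \<le> 2 ^ (B + (a + b))" "(2 :: 'a) ^ (B + b) \<le> 2 ^ (B + (a + b))"
    by (rule power_increasing; simp)+
  then have "(2 :: 'a) ^ (B + a) + 2 ^ (B + b) \<le> 2 ^ (B + (a + b)) + 2 ^ (B + (a + b))"
    by (rule add_mono)
  then show ?thesis by (simp add: mult_2)
qed

text \<open>
  Evaluating \<open>e\<close> costs one memory access or operation per symbol, and each of them
  handles a number of at most \<open>M\<close> bits. The factor \<open>2 * M + 2\<close> leaves room for a numerator and a
  denominator, so that the same factor serves for real expressions.
\<close>

lemma nexp_bits: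
  assumes "fits L B s" "2 \<le> B" "small_consts e" "B + nops e \<le> M"
  shows "nval s e < 2 ^ (B + nops e) \<and> ncost s e \<le> nops e * (2 * M + 2)"
  using assms(3,4)
proof (induction e)
  case (NConst m)
  have "m < 2 ^ 2" using NConst by simp
  also have "(2 :: nat) ^ 2 \<le> 2 ^ (B + 1)" using assms(2) by (intro power_increasing) auto
  finally show ?case using nat_bits_le[of m "B + 1"] NConst by simp
next
  case (NArr x es)
  have "nmem s x ks < 2 ^ B" for ks using assms(1) by (simp add: fits_def)
  moreover have "(2 :: nat) ^ B \<le> 2 ^ (B + nops (NArr x es))" by (rule power_increasing) auto
  ultimately have v: "nval s (NArr x es) < 2 ^ B" "nval s (NArr x es) < 2 ^ (B + nops (NArr x es))"
    by (auto intro: less_le_trans)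
  have "ncost s e \<le> nops e * (2 * M + 2)" if e: "e \<in> set es" for e
    using NArr.IH[OF e] NArr.prems elem_le_sum_list_map[OF e, of nops] e by (auto simp: list_all_iff)
  then have "sum_list (map (ncost s) es) \<le> sum_list (map nops es) * (2 * M + 2)"
    by (rule sum_list_cost)
  then show ?case
    using v(2) nat_bits_le[OF v(1)] NArr.prems by simp
next
  case (NAdd a b)
  have ih: "nval s a < 2 ^ (B + nops a)" "nval s b < 2 ^ (B + nops b)"
      "ncost s a \<le> nops a * (2 * M + 2)" "ncost s b \<le> nops b * (2 * M + 2)"
    using NAdd by auto
  have "nval s (NAdd a b) < 2 ^ (B + nops (NAdd a b))"
    using ih(1,2) double_power[of B "nops a" "nops b", where ?'a = nat] by simp
  then show ?case
    using ih(3,4) nat_bits_le[of "nval s (NAdd a b)" "B + nops (NAdd a b)"] NAdd.prems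
    by (simp add: add_mult_distrib)
next
  case (NSub a b)
  have ih: "nval s a < 2 ^ (B + nops a)" "nval s b < 2 ^ (B + nops b)"
      "ncost s a \<le> nops a * (2 * M + 2)" "ncost s b \<le> nops b * (2 * M + 2)"
    using NSub by auto
  have "nval s (NSub a b) < 2 ^ (B + nops (NSub a b))"
    using ih(1,2) double_power[of B "nops a" "nops b", where ?'a = nat] by simp
  then show ?case
    using ih(3,4) nat_bits_le[of "nval s (NSub a b)" "B + nops (NSub a b)"] NSub.prems
    by (simp add: add_mult_distrib)
qed

lemma index_bits:
  assumes "fits L B s" "2 \<le> B" "list_all small_consts es" "B + sum_list (map nops es) \<le> M"
  shows "sum_list (map (ncost s) es) \<le> sum_list (map nops es) * (2 * M + 2)"
proof (rule sum_list_cost)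
  fix e assume e: "e \<in> set es"
  show "ncost s e \<le> nops e * (2 * M + 2)"
    using nexp_bits[OF assms(1,2), of e M] assms(3,4) elem_le_sum_list_map[OF e, of nops] e
    by (auto simp: list_all_iff)
qed

lemma rexp_bits:
  assumes "fits L B s" "2 \<le> B" "0 < L" "L < 2 ^ B" "additive_rexp e" "B + rops e \<le> M"
  shows "(\<exists>z :: int. rval s e = of_int z / of_nat L \<and> \<bar>z\<bar> < 2 ^ (B + rops e)) \<and>
    rcost s e \<le> rops e * (2 * M + 2)"
  using assms(5,6)
proof (induction e)
  case (RConst c)
  have "int L < 2 ^ B" using assms(4) by (metis of_nat_less_iff of_nat_numeral of_nat_power)
  also have "(2 :: int) ^ B \<le> 2 ^ (B + 1)" by (intro power_increasing) auto
  finally have L: "int L < 2 ^ (B + 1)" .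
  have "floorlog 2 0 \<le> 1" "floorlog 2 1 \<le> 1"
    by (auto intro: floorlog_leI)
  then have "rat_bits c \<le> 4"
    using RConst by (auto simp: rat_bits_def nat_bits_def)
  moreover have "\<exists>z :: int. of_rat c = (of_int z / of_nat L :: real) \<and> \<bar>z\<bar> < 2 ^ (B + 1)"
    using RConst.prems(1) L assms(3)
    by (auto intro: exI[of _ 0] exI[of _ "int L"])
  ultimately show ?case
    using RConst.prems assms(2) by simp
next
  case (RArr x es)
  obtain z :: int where z: "rval s (RArr x es) = of_int z / of_nat L" "\<bar>z\<bar> < 2 ^ B"
    using assms(1) unfolding fits_def rval.simps by blast
  have "(2 :: int) ^ B \<le> 2 ^ (B + rops (RArr x es))" by (rule power_increasing) auto
  then have z': "\<bar>z\<bar> < 2 ^ (B + rops (RArr x es))" using z(2) by simp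
  have "real_bits (rval s (RArr x es)) \<le> 2 + B + B"
    unfolding z(1) by (rule real_bits_fraction[OF assms(3,4) z(2)])
  moreover have "sum_list (map (ncost s) es) \<le> sum_list (map nops es) * (2 * M + 2)"
    using index_bits[OF assms(1,2), of es M] RArr.prems by simp
  ultimately have "rcost s (RArr x es) \<le> rops (RArr x es) * (2 * M + 2)"
    using RArr.prems by simp
  then show ?case using z(1) z' by blast
next
  case (RAdd a b)
  obtain y z :: int where ih: "rval s a = of_int y / of_nat L" "\<bar>y\<bar> < 2 ^ (B + rops a)"
      "rval s b = of_int z / of_nat L" "\<bar>z\<bar> < 2 ^ (B + rops b)"
      "rcost s a \<le> rops a * (2 * M + 2)" "rcost s b \<le> rops b * (2 * M + 2)"
    using RAdd by auto
  have v: "rval s (RAdd a b) = of_int (y + z) / of_nat L"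
    using ih by (simp add: add_divide_distrib)
  have b: "\<bar>y + z\<bar> < 2 ^ (B + rops (RAdd a b))"
    using ih(2,4) double_power[of B "rops a" "rops b", where ?'a = int] by simp
  have "real_bits (rval s (RAdd a b)) \<le> 2 + B + (B + rops (RAdd a b))"
    unfolding v by (rule real_bits_fraction[OF assms(3,4) b])
  then have "rcost s (RAdd a b) \<le> rops (RAdd a b) * (2 * M + 2)"
    using ih(5,6) RAdd.prems by (simp add: add_mult_distrib)
  then show ?case using v b by blast
next
  case (RSub a b)
  obtain y z :: int where ih: "rval s a = of_int y / of_nat L" "\<bar>y\<bar> < 2 ^ (B + rops a)"
      "rval s b = of_int z / of_nat L" "\<bar>z\<bar> < 2 ^ (B + rops b)"
      "rcost s a \<le> rops a * (2 * M + 2)" "rcost s b \<le> rops b * (2 * M + 2)"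
    using RSub by auto
  have v: "rval s (RSub a b) = of_int (y - z) / of_nat L"
    using ih by (simp add: diff_divide_distrib)
  have b: "\<bar>y - z\<bar> < 2 ^ (B + rops (RSub a b))"
    using ih(2,4) double_power[of B "rops a" "rops b", where ?'a = int] by simp
  have "real_bits (rval s (RSub a b)) \<le> 2 + B + (B + rops (RSub a b))"
    unfolding v by (rule real_bits_fraction[OF assms(3,4) b])
  then have "rcost s (RSub a b) \<le> rops (RSub a b) * (2 * M + 2)"
    using ih(5,6) RSub.prems by (simp add: add_mult_distrib)
  then show ?case using v b by blast
qed auto

lemma bexp_bits:
  assumes "fits L B s" "2 \<le> B" "0 < L" "L < 2 ^ B" "additive_bexp g" "B + bops g \<le> M"
  shows "bcost s g \<le> bops g * (2 * M + 2)"
  using assms(5,6)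
proof (induction g)
  case (NLess a b)
  have "ncost s a \<le> nops a * (2 * M + 2)" "ncost s b \<le> nops b * (2 * M + 2)"
    using nexp_bits[OF assms(1,2), of _ M] NLess by auto
  then show ?case by (simp add: add_mult_distrib)
next
  case (RLess a b)
  have "rcost s a \<le> rops a * (2 * M + 2)" "rcost s b \<le> rops b * (2 * M + 2)"
    using rexp_bits[OF assms(1-4), of _ M] RLess by auto
  then show ?case by (simp add: add_mult_distrib)
next
  case (BAnd a b)
  then have "bcost s a \<le> bops a * (2 * M + 2)" "bcost s b \<le> bops b * (2 * M + 2)"
    by auto
  then show ?case by (simp add: add_mult_distrib)
qed auto

lemma fits_nwrite:
  assumes "fits L B s" "v < 2 ^ C" "B \<le> C"
  shows "fits L C (nwrite x ks v s)"
  using fits_mono[OF assms(1,3)] assms(2) by (auto simp: fits_def)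

lemma fits_rwrite:
  assumes "fits L B s" "v = of_int z / of_nat L" "\<bar>z :: int\<bar> < 2 ^ C" "B \<le> C"
  shows "fits L C (rwrite x ks v s)"
  using fits_mono[OF assms(1,4)] assms(2,3) by (auto simp: fits_def)

text \<open>
  The parameter \<open>M\<close> bounds the bit length that is reached at the very end. It stays fixed in the
  induction, while \<open>B\<close> increases along the execution; so the costs of consecutive parts simply add up.
\<close>

lemma exec_bits:
  assumes "exec c s k b t" "additive c" "fits L B s" "2 \<le> B" "0 < L" "L < 2 ^ B" "B + k \<le> M"
  shows "fits L (B + k) t \<and> b \<le> k * (2 * M + 2)"
  using assms
proof (induction arbitrary: B rule: exec.induct)
  case (Skip s)
  then show ?case using fits_mono by auto
next
  case (NAssign x es e s)
  let ?k = "1 + sum_list (map nops es) + nops e"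
  have i: "sum_list (map (ncost s) es) \<le> sum_list (map nops es) * (2 * M + 2)"
    using NAssign.prems by (intro index_bits) auto
  have e: "nval s e < 2 ^ (B + nops e)" "ncost s e \<le> nops e * (2 * M + 2)"
    using nexp_bits[of L B s e M] NAssign.prems by auto
  have "(2 :: nat) ^ (B + nops e) \<le> 2 ^ (B + ?k)" by (rule power_increasing) auto
  then have "fits L (B + ?k) (nwrite x (map (nval s) es) (nval s e) s)"
    using e(1) NAssign.prems by (intro fits_nwrite[of L B]) auto
  then show ?case
    using i e(2) by (simp add: add_mult_distrib)
next
  case (RAssign x es e s)
  let ?k = "1 + sum_list (map nops es) + rops e"
  have i: "sum_list (map (ncost s) es) \<le> sum_list (map nops es) * (2 * M + 2)"
    using RAssign.prems by (intro index_bits) auto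
  obtain z :: int where e: "rval s e = of_int z / of_nat L" "\<bar>z\<bar> < 2 ^ (B + rops e)"
      "rcost s e \<le> rops e * (2 * M + 2)"
    using rexp_bits[of L B s e M] RAssign.prems by auto
  have "(2 :: int) ^ (B + rops e) \<le> 2 ^ (B + ?k)" by (rule power_increasing) auto
  then have "fits L (B + ?k) (rwrite x (map (nval s) es) (rval s e) s)"
    using e(1,2) RAssign.prems by (intro fits_rwrite[of L B _ _ z]) auto
  then show ?case
    using i e(3) by (simp add: add_mult_distrib)
next
  case (Seq c1 s k1 b1 s' c2 k2 b2 s'')
  have 1: "fits L (B + k1) s'" "b1 \<le> k1 * (2 * M + 2)"
    using Seq.IH(1)[of B] Seq.prems by auto
  have "L < 2 ^ (B + k1)"
    using Seq.prems(5) by (rule less_le_trans) (simp add: power_increasing)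
  then have "fits L (B + k1 + k2) s''" "b2 \<le> k2 * (2 * M + 2)"
    using Seq.IH(2)[of "B + k1"] Seq.prems 1 by auto
  then show ?case
    using 1 by (simp add: add_mult_distrib add.assoc)
next
  case (CondTrue s g c1 k b s' c2)
  have "bcost s g \<le> bops g * (2 * M + 2)"
    using CondTrue.prems by (intro bexp_bits) auto
  moreover have "fits L (B + k) s'" "b \<le> k * (2 * M + 2)"
    using CondTrue.IH[of B] CondTrue.prems by auto
  ultimately show ?case
    using fits_mono[of L "B + k" s' "B + (1 + bops g + k)"] by (simp add: add_mult_distrib)
next
  case (CondFalse s g c2 k b s' c1)
  have "bcost s g \<le> bops g * (2 * M + 2)"
    using CondFalse.prems by (intro bexp_bits) auto
  moreover have "fits L (B + k) s'" "b \<le> k * (2 * M + 2)"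
    using CondFalse.IH[of B] CondFalse.prems by auto
  ultimately show ?case
    using fits_mono[of L "B + k" s' "B + (1 + bops g + k)"] by (simp add: add_mult_distrib)
next
  case (WhileFalse s g c)
  have "bcost s g \<le> bops g * (2 * M + 2)"
    using WhileFalse.prems by (intro bexp_bits) auto
  then show ?case
    using fits_mono[OF WhileFalse.prems(2), of "B + (1 + bops g)"] by (simp add: add_mult_distrib)
next
  case (WhileTrue s g c k1 b1 s' k2 b2 s'')
  have g: "bcost s g \<le> bops g * (2 * M + 2)"
    using WhileTrue.prems by (intro bexp_bits) auto
  have 1: "fits L (B + k1) s'" "b1 \<le> k1 * (2 * M + 2)"
    using WhileTrue.IH(1)[of B] WhileTrue.prems by auto
  have "L < 2 ^ (B + k1)"
    using WhileTrue.prems(5) by (rule less_le_trans) (simp add: power_increasing)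
  then have "fits L (B + k1 + k2) s''" "b2 \<le> k2 * (2 * M + 2)"
    using WhileTrue.IH(2)[of "B + k1"] WhileTrue.prems 1 by auto
  then show ?case
    using 1 g fits_mono[of L "B + k1 + k2" s'' "B + (1 + bops g + k1 + k2)"]
    by (simp add: add_mult_distrib)
qed

section \<open>Encoding length of the input\<close>

definition denom :: "real \<Rightarrow> nat" where
  "denom x = nat (snd (quotient_of (THE r. x = of_rat r)))"

lemma denom_pos: "0 < denom x"
  by (simp add: denom_def quotient_of_denom_pos')

lemma denom_le: "denom x \<le> 2 ^ real_bits x"
proof -
  obtain a b where q: "quotient_of (THE r. x = of_rat r) = (a, b)" by force
  have "denom x < 2 ^ nat_bits (nat \<bar>b\<bar>)"
    using less_nat_bits[of "nat \<bar>b\<bar>"] quotient_of_denom_pos[OF q] by (simp add: denom_def q)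
  also have "\<dots> \<le> 2 ^ real_bits x"
    by (simp add: real_bits_def rat_bits_def q)
  finally show ?thesis by simp
qed

lemma real_bits_pos: "1 \<le> real_bits x"
  by (simp add: real_bits_def rat_bits_def nat_bits_def split_def)

text \<open>
  As \<open>x \<le> 1\<close>, the numerator needs no more bits than the denominator.
\<close>

lemma fraction_over_multiple:
  assumes "x \<in> \<rat>" "denom x dvd L" "0 \<le> x" "x \<le> 1" "0 < L"
  shows "\<exists>z :: int. x = of_int z / of_nat L \<and> \<bar>z\<bar> \<le> int L"
proof -
  obtain r where r: "x = of_rat r" using assms(1) by (auto elim: Rats_cases)
  have the: "(THE r. x = of_rat r) = r"
    unfolding r by (rule the_equality) auto
  obtain a b where q: "quotient_of r = (a, b)" by force
  have b: "0 < b" and rab: "r = of_int a / of_int b"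
    using quotient_of_denom_pos[OF q] quotient_of_div[OF q] by auto
  have "denom x = nat b" by (simp add: denom_def the q)
  then have "int (nat b) dvd int L" using assms(2) by (metis of_nat_dvd_iff)
  then obtain m where m: "int L = b * m" using b by auto
  have xab: "x = of_int a / of_int b" by (simp add: r rab of_rat_divide)
  have "real L = of_int b * of_int m" using m by (metis of_int_mult of_int_of_nat_eq)
  then have x: "x = of_int (a * m) / of_nat L"
    using xab b assms(5) by (auto simp: field_simps)
  then have "of_int (a * m) = x * of_nat L" using assms(5) by simp
  then have "\<bar>of_int (a * m)\<bar> \<le> (of_nat L :: real)"
    using assms(3,4) by (simp add: abs_mult mult_left_le_one_le)
  then have "\<bar>a * m\<bar> \<le> int L" by linarith
  then show ?thesis using x by blast
qed

text \<open>
  A product instead of a least common multiple: its bit length is at most the sum of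
  the bit lengths of the denominators, which is part of the encoding length.
\<close>

definition common_denom :: "sep_input \<Rightarrow> nat" where
  "common_denom = (\<lambda>(n, d, X).
     \<Prod>i\<in>{1..n}. \<Prod>j\<in>{i<..n}. \<Prod>t\<in>{1..d i}. \<Prod>q\<in>{1..d j}. denom (X i j t q))"

lemma common_denom_pos: "0 < common_denom (n, d, X)"
  by (simp add: common_denom_def prod_pos denom_pos)

lemma common_denom_le: "common_denom (n, d, X) \<le>
    2 ^ (\<Sum>i\<in>{1..n}. \<Sum>j\<in>{i<..n}. \<Sum>t\<in>{1..d i}. \<Sum>q\<in>{1..d j}. real_bits (X i j t q))"
  unfolding common_denom_def prod.case power_sum
  by (intro prod_mono conjI denom_le) auto

lemma denom_dvd_common_denom:
  assumes "1 \<le> i" "i < j" "j \<le> n" "t \<in> {1..d i}" "q \<in> {1..d j}"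
  shows "denom (X i j t q) dvd common_denom (n, d, X)"
proof -
  have "denom (X i j t q) dvd (\<Prod>q\<in>{1..d j}. denom (X i j t q))"
    using assms by (intro dvd_prodI) auto
  also have "\<dots> dvd (\<Prod>t\<in>{1..d i}. \<Prod>q\<in>{1..d j}. denom (X i j t q))"
    using assms by (intro dvd_prodI[of _ _ "\<lambda>t. \<Prod>q\<in>{1..d j}. denom (X i j t q)"]) auto
  also have "\<dots> dvd (\<Prod>j\<in>{i<..n}. \<Prod>t\<in>{1..d i}. \<Prod>q\<in>{1..d j}. denom (X i j t q))"
    using assms by (intro dvd_prodI[of _ _ "\<lambda>j. \<Prod>t\<in>{1..d i}. \<Prod>q\<in>{1..d j}. denom (X i j t q)"]) auto
  also have "\<dots> dvd common_denom (n, d, X)"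
    unfolding common_denom_def prod.case using assms
    by (intro dvd_prodI[of _ _ "\<lambda>i. \<Prod>j\<in>{i<..n}. \<Prod>t\<in>{1..d i}. \<Prod>q\<in>{1..d j}. denom (X i j t q)"]) auto
  finally show ?thesis .
qed

lemma sep_load_fits:
  assumes "x \<in> sep_inputs" "sep_rational x"
  shows "common_denom x < 2 ^ (sep_length x + 2)"
    and "fits (common_denom x) (sep_length x + 2) (sep_load x)"
proof -
  obtain n d X where x: "x = (n, d, X)" by (metis prod_cases3)
  let ?L = "common_denom x" and ?B = "sep_length x + 2"
  let ?S = "\<Sum>i\<in>{1..n}. \<Sum>j\<in>{i<..n}. \<Sum>t\<in>{1..d i}. \<Sum>q\<in>{1..d j}. real_bits (X i j t q)"
  have "?L \<le> 2 ^ ?S" using common_denom_le x by simp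
  also have "(2 :: nat) ^ ?S < 2 ^ ?B"
    by (rule power_strict_increasing) (simp_all add: x)
  finally show L: "?L < 2 ^ ?B" .
  have n: "n < 2 ^ ?B"
    by (rule less_le_trans[OF less_nat_bits power_increasing]) (simp_all add: x)
  have d: "d i < 2 ^ ?B" if "i \<in> {1..n}" for i
  proof (rule less_le_trans[OF less_nat_bits power_increasing])
    have "nat_bits (d i) \<le> (\<Sum>i\<in>{1..n}. nat_bits (d i))"
      using that by (intro member_le_sum) auto
    then show "nat_bits (d i) \<le> ?B" by (simp add: x)
  qed simp
  have zero: "\<exists>z :: int. 0 = (of_int z / of_nat ?L :: real) \<and> \<bar>z\<bar> < 2 ^ ?B"
    by (rule exI[of _ 0]) simp
  have X: "\<exists>z :: int. X i j t q = of_int z / of_nat ?L \<and> \<bar>z\<bar> < 2 ^ ?B"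
    if "1 \<le> i" "i < j" "j \<le> n" "t \<in> {1..d i}" "q \<in> {1..d j}" for i j t q
  proof -
    have dvd: "denom (X i j t q) dvd common_denom (n, d, X)"
      by (rule denom_dvd_common_denom) (use that in auto)
    have "X i j t q \<in> \<rat>" and X01: "0 \<le> X i j t q" "X i j t q \<le> 1"
      using assms that by (auto simp: x sep_inputs_def)
    then obtain z :: int where z: "X i j t q = of_int z / of_nat ?L" "\<bar>z\<bar> \<le> int ?L"
      using fraction_over_multiple[OF _ dvd X01 common_denom_pos]
      unfolding x by blast
    have "int ?L < 2 ^ ?B" using L by (metis of_nat_less_iff of_nat_numeral of_nat_power)
    then show ?thesis using z by (intro exI[of _ z]) auto
  qed
  show "fits ?L ?B (sep_load x)"
    unfolding fits_def
  proof (intro conjI allI)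
    show "nmem (sep_load x) y ks < 2 ^ ?B" for y ks
      using n d by (auto simp: x split: list.splits)
    show "\<exists>z :: int. rmem (sep_load x) y ks = of_int z / of_nat ?L \<and> \<bar>z\<bar> < 2 ^ ?B" for y ks
    proof (cases "y = ''X'' \<and> (\<exists>i j t q. ks = [i, j, t, q])")
      case True
      then obtain i j t q where "y = ''X''" "ks = [i, j, t, q]" by blast
      then show ?thesis using X[of i j t q] zero by (simp add: x)
    next
      case False
      then have "rmem (sep_load x) y ks = 0"
        unfolding x by (auto split: list.split)
      then show ?thesis using zero by simp
    qed
  qed
qed

text \<open>
  Each \<open>d i\<close> is at most the number of entries of a matrix in which \<open>i\<close> takes part, with \<open>n\<close> or \<open>1\<close> as
  partner, and each entry contributes at least one bit.
\<close>

lemma dim_le_length: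
  assumes "x \<in> sep_inputs"
  shows "sep_dim x \<le> sep_length x + sep_length x * sep_length x"
proof -
  obtain n d X where x: "x = (n, d, X)" by (metis prod_cases3)
  have n3: "3 \<le> n" and d1: "\<And>i. i \<in> {1..n} \<Longrightarrow> 1 \<le> d i"
    using assms by (auto simp: x sep_inputs_def)
  let ?f = "\<lambda>i j. \<Sum>t\<in>{1..d i}. \<Sum>q\<in>{1..d j}. real_bits (X i j t q)"
  have "n = (\<Sum>i\<in>{1..n}. 1)" by simp
  also have "\<dots> \<le> (\<Sum>i\<in>{1..n}. nat_bits (d i))"
    by (rule sum_mono) (simp add: nat_bits_def)
  finally have n: "n \<le> sep_length x" by (simp add: x)
  have block: "d i * d j \<le> sep_length x" if "1 \<le> i" "i < j" "j \<le> n" for i j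
  proof -
    have "d i * d j = (\<Sum>t\<in>{1..d i}. \<Sum>q\<in>{1..d j}. 1)" by simp
    also have "\<dots> \<le> ?f i j" by (intro sum_mono real_bits_pos)
    also have "\<dots> \<le> (\<Sum>j\<in>{i<..n}. ?f i j)"
      using that by (intro member_le_sum) auto
    also have "\<dots> \<le> (\<Sum>i\<in>{1..n}. \<Sum>j\<in>{i<..n}. ?f i j)"
      using that by (intro member_le_sum[of _ _ "\<lambda>i. \<Sum>j\<in>{i<..n}. ?f i j"]) auto
    finally show ?thesis by (simp add: x)
  qed
  have d: "d i \<le> sep_length x" if i: "i \<in> {1..n}" for i
  proof (cases "i < n")
    case True
    have "d i = d i * 1" by simp
    also have "\<dots> \<le> d i * d n" using d1[of n] n3 by (intro mult_le_mono2) auto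
    also have "\<dots> \<le> sep_length x" using block[of i n] True i by simp
    finally show ?thesis .
  next
    case False
    have "d i = 1 * d i" by simp
    also have "\<dots> \<le> d 1 * d i" using d1[of 1] n3 by (intro mult_le_mono1) auto
    also have "\<dots> \<le> sep_length x" using block[of 1 i] False i n3 by simp
    finally show ?thesis .
  qed
  have "(\<Sum>i\<in>{1..n}. d i) \<le> (\<Sum>i\<in>{1..n}. sep_length x)"
    by (rule sum_mono) (rule d)
  also have "\<dots> = n * sep_length x" by simp
  also have "\<dots> \<le> sep_length x * sep_length x"
    using n by (rule mult_le_mono1)
  finally show ?thesis using n by (simp add: x)
qed

lemma poly_nat_mono: "a \<le> b \<Longrightarrow> poly (p :: nat poly) a \<le> poly p b"
  by (induction p) (auto intro: add_mono mult_le_mono)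

lemma exec_on_input:
  assumes "well_bounded {''n'', ''d''} p" "x \<in> sep_inputs"
  shows "\<exists>k b. exec (compile p) (sep_load x) k b (sem p (sep_load x)) \<and> k \<le> op_bound p (sep_dim x)"
proof -
  obtain n d X where x: "x = (n, d, X)" by (metis prod_cases3)
  have "d i \<le> n + (\<Sum>i\<in>{1..n}. d i)" if "i \<in> {1..n}" for i
    using that by (intro trans_le_add2 member_le_sum) auto
  then have "nmem (sep_load x) y ks \<le> sep_dim x" for y ks
    by (auto simp: x split: list.splits)
  then show ?thesis
    by (rule exec_compile[OF assms(1)])
qed

text \<open>
  The bound on the operations is a polynomial in the dimension; composed with the quadratic bound of
  \<open>dim_le_length\<close> it bounds them in terms of the encoding length, and then \<open>exec_bits\<close> bounds the
  logarithmic cost.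
\<close>

theorem loop_program_strongly_polynomial:
  assumes "well_bounded {''n'', ''d''} p" "additive (compile p)"
  shows "strongly_polynomial (compile p) sep_inputs sep_load sep_dim sep_rational sep_length"
proof -
  obtain P where P: "\<And>N. op_bound p N \<le> poly P N"
    using poly_bounded_op_bound unfolding poly_bounded_def by blast
  have ex: "\<exists>k b. exec (compile p) (sep_load x) k b (sem p (sep_load x)) \<and> k \<le> poly P (sep_dim x)"
    if "x \<in> sep_inputs" for x
    using exec_on_input[OF assms(1) that] P le_trans by blast
  let ?R = "[:0, 1, 1:] :: nat poly"
  let ?Q = "pcompose P ?R"
  let ?C = "?Q * (2 * ([:2, 1:] + ?Q) + 2)"
  have "\<exists>k b t. exec (compile p) (sep_load x) k b t \<and> b \<le> poly ?C (sep_length x)"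
    if x: "x \<in> sep_inputs" "sep_rational x" for x
  proof -
    obtain k b where kb: "exec (compile p) (sep_load x) k b (sem p (sep_load x))"
        "k \<le> poly P (sep_dim x)"
      using ex x by blast
    have "poly P (sep_dim x) \<le> poly P (sep_length x + sep_length x * sep_length x)"
      by (rule poly_nat_mono[OF dim_le_length[OF x(1)]])
    then have k: "k \<le> poly ?Q (sep_length x)"
      using kb(2) by (simp add: poly_pcompose algebra_simps)
    let ?M = "sep_length x + 2 + poly ?Q (sep_length x)"
    have "0 < common_denom x"
      using common_denom_pos by (metis prod_cases3)
    then have "b \<le> k * (2 * ?M + 2)"
      using exec_bits[OF kb(1) assms(2) sep_load_fits(2)[OF x] _ _ sep_load_fits(1)[OF x], of ?M] k
      by simp
    also have "\<dots> \<le> poly ?Q (sep_length x) * (2 * ?M + 2)"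
      using k by (rule mult_le_mono1)
    also have "\<dots> = poly ?C (sep_length x)"
      by (simp add: algebra_simps)
    finally show ?thesis using kb(1) by blast
  qed
  then show ?thesis
    using ex unfolding strongly_polynomial_def by blast
qed

section \<open>Maximum cuts by push and relabel\<close>

text \<open>
  Excesses, residual capacities and heights.
\<close>

type_synonym network = "(nat \<Rightarrow> real) \<times> (nat \<times> nat \<Rightarrow> real) \<times> (nat \<Rightarrow> nat)"

text \<open>
  The quantity to be maximized over \<open>S \<subseteq> U\<close>. Node weights may have any sign; a node of
  positive weight is a source and a node of negative weight a sink.
\<close>

definition cut_gain :: "nat set \<Rightarrow> (nat \<Rightarrow> real) \<Rightarrow> (nat \<times> nat \<Rightarrow> real) \<Rightarrow> nat set \<Rightarrow> real" where
  "cut_gain U e r S = (\<Sum>u\<in>S. e u) - (\<Sum>u\<in>S. \<Sum>v\<in>U - S. r (u, v))"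

text \<open>
  In a valid labelling the condition \<open>h v < h u\<close> on a residual arc means \<open>h u = Suc (h v)\<close>, the usual
  admissibility. Nodes that have reached the cap \<open>H\<close> keep their excess for good.
\<close>

definition push :: "nat \<Rightarrow> nat \<Rightarrow> nat \<Rightarrow> network \<Rightarrow> network" where
  "push H u v = (\<lambda>(e, r, h).
     if h u < H \<and> 0 < e u \<and> 0 < r (u, v) \<and> h v < h u then
       let a = min (e u) (r (u, v)) in
         (e(u := e u - a, v := e v + a), r((u, v) := r (u, v) - a, (v, u) := r (v, u) + a), h)
     else (e, r, h))"

definition relabel :: "nat \<Rightarrow> nat \<Rightarrow> network \<Rightarrow> network" where
  "relabel H u = (\<lambda>(e, r, h). if h u < H \<and> 0 < e u then (e, r, h(u := Suc (h u))) else (e, r, h))"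

definition discharge :: "nat \<Rightarrow> nat list \<Rightarrow> nat \<Rightarrow> network \<Rightarrow> network" where
  "discharge H vs u N = relabel H u (fold (push H u) vs N)"

definition pass :: "nat \<Rightarrow> nat list \<Rightarrow> network \<Rightarrow> network" where
  "pass H vs N = fold (discharge H vs) vs N"

text \<open>
  Heights drop by at most one along residual arcs. A node of negative excess has never been active and
  is still at the bottom, like the sink of an ordinary flow network.
\<close>

definition valid :: "nat \<Rightarrow> nat set \<Rightarrow> network \<Rightarrow> bool" where
  "valid H U = (\<lambda>(e, r, h).
     (\<forall>u\<in>U. h u \<le> H \<and> (e u < 0 \<longrightarrow> h u = 0)) \<and>
     (\<forall>u\<in>U. \<forall>v\<in>U. 0 \<le> r (u, v) \<and> (0 < r (u, v) \<longrightarrow> h u \<le> Suc (h v))))"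

text \<open>
  Moving an amount from \<open>u\<close> to \<open>v\<close> changes a sum over \<open>S\<close> only if \<open>S\<close> separates the two nodes.
  The next lemma is the analogue for a pair of opposite arcs.
\<close>

lemma sum_move:
  fixes f :: "nat \<Rightarrow> real"
  assumes "finite S" "u \<noteq> v"
  shows "(\<Sum>x\<in>S. (f(u := f u - a, v := f v + a)) x) =
    (\<Sum>x\<in>S. f x) - (if u \<in> S then a else 0) + (if v \<in> S then a else 0)"
proof -
  have "(f(u := f u - a, v := f v + a)) x = f x - (if u = x then a else 0) + (if v = x then a else 0)" for x
    using assms(2) by auto
  then have "(\<Sum>x\<in>S. (f(u := f u - a, v := f v + a)) x) =
      (\<Sum>x\<in>S. f x - (if u = x then a else 0) + (if v = x then a else 0))"
    by simp
  also have "\<dots> = (\<Sum>x\<in>S. f x) - (\<Sum>x\<in>S. if u = x then a else 0) + (\<Sum>x\<in>S. if v = x then a else 0)"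
    by (simp add: sum.distrib sum_subtractf)
  also have "\<dots> = (\<Sum>x\<in>S. f x) - (if u \<in> S then a else 0) + (if v \<in> S then a else 0)"
    using assms(1) by (simp only: sum.delta')
  finally show ?thesis .
qed

lemma sum_rect_move:
  fixes r :: "nat \<times> nat \<Rightarrow> real"
  assumes "finite S" "finite T" "u \<noteq> v"
  shows "(\<Sum>x\<in>S. \<Sum>y\<in>T. (r((u, v) := r (u, v) - a, (v, u) := r (v, u) + a)) (x, y)) =
    (\<Sum>x\<in>S. \<Sum>y\<in>T. r (x, y)) - (if u \<in> S \<and> v \<in> T then a else 0) + (if v \<in> S \<and> u \<in> T then a else 0)"
proof -
  have "(r((u, v) := r (u, v) - a, (v, u) := r (v, u) + a)) p =
      r p - (if (u, v) = p then a else 0) + (if (v, u) = p then a else 0)" for p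
    using assms(3) by auto
  then have "(\<Sum>p\<in>S \<times> T. (r((u, v) := r (u, v) - a, (v, u) := r (v, u) + a)) p) =
      (\<Sum>p\<in>S \<times> T. r p - (if (u, v) = p then a else 0) + (if (v, u) = p then a else 0))"
    by simp
  also have "\<dots> = (\<Sum>p\<in>S \<times> T. r p) - (\<Sum>p\<in>S \<times> T. if (u, v) = p then a else 0) +
      (\<Sum>p\<in>S \<times> T. if (v, u) = p then a else 0)"
    by (simp add: sum.distrib sum_subtractf)
  also have "\<dots> = (\<Sum>p\<in>S \<times> T. r p) - (if (u, v) \<in> S \<times> T then a else 0) + (if (v, u) \<in> S \<times> T then a else 0)"
    using assms(1,2) by (simp only: sum.delta' finite_cartesian_product)
  finally show ?thesis
    unfolding sum.cartesian_product split_def prod.collapse by simp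
qed

text \<open>
  If \<open>u \<in> S\<close> and \<open>v \<notin> S\<close>, the excess of \<open>S\<close> and the residual capacity of the arcs that leave \<open>S\<close> drop by the same
  amount; if \<open>u \<notin> S\<close> and \<open>v \<in> S\<close>, both grow by it. If \<open>S\<close> does not separate the
  nodes, neither changes.
\<close>

lemma push_cut_gain:
  assumes "finite U" "S \<subseteq> U" "u \<in> U" "v \<in> U" "push H u v (e, r, h) = (e', r', h')"
  shows "cut_gain U e' r' S = cut_gain U e r S"
proof (cases "h u < H \<and> 0 < e u \<and> 0 < r (u, v) \<and> h v < h u")
  case True
  define a where "a = min (e u) (r (u, v))"
  have uv: "u \<noteq> v" using True by auto
  have fin: "finite S" "finite (U - S)"
    using assms(1,2) finite_subset by auto
  have eq: "e' = e(u := e u - a, v := e v + a)"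
    "r' = r((u, v) := r (u, v) - a, (v, u) := r (v, u) + a)"
    using assms(5) True by (auto simp: push_def a_def Let_def)
  show ?thesis
    unfolding cut_gain_def eq sum_move[OF fin(1) uv] sum_rect_move[OF fin uv]
    using assms(3,4) by auto
next
  case False
  then show ?thesis using assms(5) by (auto simp: push_def)
qed

text \<open>
  The only arc that can become residual is \<open>(v, u)\<close>, and it leads upwards.
\<close>

lemma push_valid:
  assumes "valid H U (e, r, h)" "u \<in> U" "v \<in> U"
  shows "valid H U (push H u v (e, r, h))"
proof (cases "h u < H \<and> 0 < e u \<and> 0 < r (u, v) \<and> h v < h u")
  case True
  define a where "a = min (e u) (r (u, v))"
  have a: "0 < a" "a \<le> e u" "a \<le> r (u, v)"
    using True by (auto simp: a_def)
  have eq: "push H u v (e, r, h) = (e(u := e u - a, v := e v + a),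
      r((u, v) := r (u, v) - a, (v, u) := r (v, u) + a), h)"
    using True by (auto simp: push_def a_def Let_def)
  show ?thesis
    unfolding eq valid_def prod.case
  proof (intro conjI ballI impI)
    fix x y assume xy: "x \<in> U" "y \<in> U"
    have r: "0 \<le> r (x, y)" "0 < r (x, y) \<longrightarrow> h x \<le> Suc (h y)" "0 \<le> r (v, u)"
      using assms xy by (auto simp: valid_def)
    show "0 \<le> (r((u, v) := r (u, v) - a, (v, u) := r (v, u) + a)) (x, y)"
      using r a by auto
    show "h x \<le> Suc (h y)" if "0 < (r((u, v) := r (u, v) - a, (v, u) := r (v, u) + a)) (x, y)"
      using r a True that by (auto split: if_splits)
  next
    fix x assume x: "x \<in> U"
    then show "h x \<le> H" using assms by (auto simp: valid_def)
    show "h x = 0" if "(e(u := e u - a, v := e v + a)) x < 0"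
      using assms a True that x by (auto simp: valid_def split: if_splits)
  qed
next
  case False
  then show ?thesis using assms(1) by (auto simp: push_def)
qed

text \<open>
  The last clause makes the relabelling sound: if excess remains at \<open>u\<close> after all arcs have been tried,
  then no residual arc leads down from \<open>u\<close>. The clause on positive excesses says that new active nodes lie
  strictly below \<open>u\<close>.
\<close>

lemma fold_push:
  assumes "finite U" "u \<in> U" "set vs \<subseteq> U" "valid H U (e, r, h)" "fold (push H u) vs (e, r, h) = (e', r', h')"
  shows "h' = h \<and> valid H U (e', r', h') \<and> (\<forall>S\<subseteq>U. cut_gain U e' r' S = cut_gain U e r S) \<and>
    (\<forall>x\<in>U. 0 < e' x \<longrightarrow> 0 < e x \<or> (0 < e u \<and> h u < H \<and> h x < h u)) \<and> e' u \<le> e u \<and>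
    (0 < e' u \<and> h u < H \<longrightarrow> (\<forall>v\<in>set vs. 0 < r' (u, v) \<longrightarrow> h u \<le> h v))"
  using assms(3,5)
proof (induction vs arbitrary: e' r' h' rule: rev_induct)
  case Nil
  then show ?case using assms by auto
next
  case (snoc v vs)
  obtain e1 r1 h1 where 1: "fold (push H u) vs (e, r, h) = (e1, r1, h1)"
    by (metis prod_cases3)
  have v: "v \<in> U" "set vs \<subseteq> U" using snoc.prems by auto
  note ih = snoc.IH[OF v(2) 1]
  have p: "push H u v (e1, r1, h1) = (e', r', h')"
    using snoc.prems(2) 1 by simp
  have val: "valid H U (e', r', h')"
    using push_valid[OF _ assms(2) v(1), of H e1 r1 h1] ih unfolding p by blast
  have cut: "\<forall>S\<subseteq>U. cut_gain U e' r' S = cut_gain U e r S"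
    using push_cut_gain[OF assms(1) _ assms(2) v(1) p] ih by auto
  have h: "h1 = h" using ih by simp
  show ?case
  proof (cases "h u < H \<and> 0 < e1 u \<and> 0 < r1 (u, v) \<and> h v < h u")
    case True
    define a where "a = min (e1 u) (r1 (u, v))"
    have a: "0 < a" "a \<le> e1 u" "a \<le> r1 (u, v)" "e1 u = a \<or> r1 (u, v) = a"
      using True by (auto simp: a_def)
    have eq: "e' = e1(u := e1 u - a, v := e1 v + a)"
        "r' = r1((u, v) := r1 (u, v) - a, (v, u) := r1 (v, u) + a)" "h' = h"
      using p True h by (auto simp: push_def a_def Let_def)
    have uv: "u \<noteq> v" using True by auto
    have "\<forall>x\<in>U. 0 < e' x \<longrightarrow> 0 < e x \<or> (0 < e u \<and> h u < H \<and> h x < h u)"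
      using ih True a unfolding eq by auto
    moreover have "e' u \<le> e u"
      using ih a uv unfolding eq by auto
    moreover have "\<forall>w\<in>set (vs @ [v]). 0 < r' (u, w) \<longrightarrow> h u \<le> h w" if "0 < e' u \<and> h u < H"
    proof -
      have "r1 (u, v) = a" using that a uv unfolding eq by auto
      moreover have "\<forall>w\<in>set vs. 0 < r1 (u, w) \<longrightarrow> h u \<le> h w"
        using ih True by auto
      ultimately show ?thesis using uv unfolding eq by auto
    qed
    ultimately show ?thesis
      using val cut eq(3) by auto
  next
    case False
    then have eq: "e' = e1" "r' = r1" "h' = h"
      using p h by (auto simp: push_def)
    have "\<forall>w\<in>set (vs @ [v]). 0 < r' (u, w) \<longrightarrow> h u \<le> h w" if "0 < e' u \<and> h u < H"
      using ih that False unfolding eq by auto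
    then show ?thesis
      using ih val cut unfolding eq by auto
  qed
qed

lemma discharge_step:
  assumes "finite U" "u \<in> U" "set vs = U" "valid H U (e, r, h)" "discharge H vs u (e, r, h) = (e', r', h')"
  shows "valid H U (e', r', h') \<and> (\<forall>S\<subseteq>U. cut_gain U e' r' S = cut_gain U e r S) \<and>
    (\<forall>x. h x \<le> h' x) \<and>
    ((0 < e u \<and> h u < H \<and> h u < h' u) \<or> (h' = h \<and> \<not> (0 < e' u \<and> h u < H) \<and>
     (\<forall>x\<in>U. 0 < e' x \<longrightarrow> 0 < e x \<or> (0 < e u \<and> h u < H \<and> h x < h u))))"
proof -
  obtain e1 r1 h1 where 1: "fold (push H u) vs (e, r, h) = (e1, r1, h1)"
    by (metis prod_cases3)
  note f = fold_push[OF assms(1,2) _ assms(4) 1]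
  have h: "h1 = h" using f assms(3) by simp
  have rel: "relabel H u (e1, r1, h) = (e', r', h')"
    using assms(5) 1 h by (simp add: discharge_def)
  show ?thesis
  proof (cases "h u < H \<and> 0 < e1 u")
    case True
    then have eq: "e' = e1" "r' = r1" "h' = h(u := Suc (h u))"
      using rel by (auto simp: relabel_def)
    have "valid H U (e', r', h')"
      using f assms(3) True h unfolding eq valid_def by (auto simp: le_Suc_eq)
    moreover have "\<forall>S\<subseteq>U. cut_gain U e' r' S = cut_gain U e r S"
      using f assms(3) unfolding eq by blast
    moreover have "0 < e u"
      using f assms(2,3) True by blast
    ultimately show ?thesis
      using True by (simp add: eq(3))
  next
    case False
    then have eq: "e' = e1" "r' = r1" "h' = h"
      using rel by (auto simp: relabel_def)
    then show ?thesis
      using f assms(3) False h by auto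
  qed
qed

text \<open>
  The parameter \<open>k\<close> bounds the number of passes after which no node is active, that is, has positive
  excess below the cap. The number \<open>m\<close> is a strict upper bound for the heights of active nodes. The total height still
  available is weighted by \<open>Suc H\<close>, so that raising a single node outweighs any increase of \<open>m\<close>; for
  \<open>m = 0\<close> there is no active node and the computation is finished.
\<close>

definition progress :: "nat \<Rightarrow> nat set \<Rightarrow> nat \<Rightarrow> network \<Rightarrow> bool" where
  "progress H U k = (\<lambda>(e, r, h). \<exists>m\<le>H. (\<forall>w\<in>U. 0 < e w \<and> h w < H \<longrightarrow> h w < m) \<and>
     (0 < m \<longrightarrow> (\<Sum>u\<in>U. H - h u) * Suc H + m \<le> k))"

text \<open>
  Consider a pass in which no height changes. A node is inactive after its own discharge, and it becomes active
  again only by a push from a higher active node; so its height is then at least two below the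
  strict bound \<open>m\<close>. The invariant records this for the nodes \<open>us\<close> already discharged. If \<open>m = 0\<close>, no node is
  active and nothing is raised.
\<close>

lemma fold_discharge:
  assumes "finite U" "set vs = U" "set us \<subseteq> U" "valid H U (e, r, h)"
    "fold (discharge H vs) us (e, r, h) = (e', r', h')" "\<forall>w\<in>U. 0 < e w \<and> h w < H \<longrightarrow> h w < m"
  shows "valid H U (e', r', h') \<and> (\<forall>S\<subseteq>U. cut_gain U e' r' S = cut_gain U e r S) \<and>
    (\<forall>x. h x \<le> h' x) \<and>
    ((0 < m \<and> (\<exists>x\<in>U. h x < h' x)) \<or>
     (\<forall>w\<in>U. 0 < e' w \<and> h w < H \<longrightarrow> h w < m \<and> (w \<in> set us \<longrightarrow> Suc (h w) < m)))"
  using assms(3,5)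
proof (induction us arbitrary: e' r' h' rule: rev_induct)
  case Nil
  then show ?case using assms by auto
next
  case (snoc u us)
  obtain e1 r1 h1 where 1: "fold (discharge H vs) us (e, r, h) = (e1, r1, h1)"
    by (metis prod_cases3)
  have u: "u \<in> U" "set us \<subseteq> U" using snoc.prems by auto
  note ih = snoc.IH[OF u(2) 1]
  have d: "discharge H vs u (e1, r1, h1) = (e', r', h')"
    using snoc.prems(2) 1 by simp
  have v1: "valid H U (e1, r1, h1)" using ih by blast
  note st = discharge_step[OF assms(1) u(1) assms(2) v1 d]
  have mono: "\<forall>x. h x \<le> h' x"
  proof
    fix x
    have "h x \<le> h1 x" "h1 x \<le> h' x"
      using ih st by blast+
    then show "h x \<le> h' x" by (rule le_trans)
  qed
  have prog: "(0 < m \<and> (\<exists>x\<in>U. h x < h' x)) \<or>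
     (\<forall>w\<in>U. 0 < e' w \<and> h w < H \<longrightarrow> h w < m \<and> (w \<in> set (us @ [u]) \<longrightarrow> Suc (h w) < m))"
  proof (cases "0 < m \<and> (\<exists>x\<in>U. h x < h' x)")
    case False
    have h1: "h x \<le> h1 x" "h1 x \<le> h' x" for x
      using ih st by auto
    have "\<not> (0 < m \<and> (\<exists>x\<in>U. h x < h1 x))"
      using False h1(2) by (meson less_le_trans)
    then have old: "\<forall>w\<in>U. 0 < e1 w \<and> h w < H \<longrightarrow> h w < m \<and> (w \<in> set us \<longrightarrow> Suc (h w) < m)"
      using ih by blast
    have not_relabelled: "\<not> (0 < e1 u \<and> h1 u < H \<and> h1 u < h' u)"
    proof
      assume a: "0 < e1 u \<and> h1 u < H \<and> h1 u < h' u"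
      then have "h u < H" "h u < h' u" using h1(1)[of u] by auto
      then show False using old a u(1) False by (metis gr_implies_not0 gr0I)
    qed
    have st': "h' = h1" "\<not> (0 < e' u \<and> h1 u < H)"
        "\<forall>x\<in>U. 0 < e' x \<longrightarrow> 0 < e1 x \<or> (0 < e1 u \<and> h1 u < H \<and> h1 x < h1 u)"
      using st not_relabelled by blast+
    have "h w < m \<and> (w \<in> set (us @ [u]) \<longrightarrow> Suc (h w) < m)" if w: "w \<in> U" "0 < e' w" "h w < H" for w
    proof (cases "m = 0")
      case True
      have "0 < e1 w \<or> (0 < e1 u \<and> h u < H)"
        using st'(3) w h1(1)[of u] by fastforce
      then show ?thesis using old w u(1) True by blast
    next
      case m: False
      then have eqU: "\<And>x. x \<in> U \<Longrightarrow> h1 x = h x"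
        using False st'(1) h1(1) by (metis bot_nat_0.not_eq_extremum le_neq_implies_less)
      have "w \<noteq> u" using st'(2) w eqU by auto
      moreover consider "0 < e1 w" | "0 < e1 u" "h u < H" "h w < h u"
        using st'(3) w eqU u(1) by auto
      then have "h w < m \<and> (w \<in> set us \<longrightarrow> Suc (h w) < m)"
      proof cases
        case 1
        then show ?thesis using old w by blast
      next
        case 2
        then have "h u < m" using old u(1) by blast
        then show ?thesis using 2(3) by simp
      qed
      ultimately show ?thesis by simp
    qed
    then show ?thesis by blast
  qed simp
  show ?case
    using st ih mono prog by auto
qed

text \<open>
  If a height rises, the weighted sum in the potential drops by at least \<open>Suc H\<close>, which outweighs the new
  \<open>m \<le> H\<close>. Otherwise the sum stays the same and \<open>m\<close> drops by one.
\<close>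

lemma pass_step:
  assumes "finite U" "set vs = U" "valid H U (e, r, h)" "progress H U k (e, r, h)"
    "pass H vs (e, r, h) = (e', r', h')"
  shows "valid H U (e', r', h') \<and> (\<forall>S\<subseteq>U. cut_gain U e' r' S = cut_gain U e r S) \<and>
    progress H U (k - 1) (e', r', h')"
proof -
  obtain m where m: "m \<le> H" "\<forall>w\<in>U. 0 < e w \<and> h w < H \<longrightarrow> h w < m"
      "0 < m \<longrightarrow> (\<Sum>u\<in>U. H - h u) * Suc H + m \<le> k"
    using assms(4) by (auto simp: progress_def)
  have f: "valid H U (e', r', h') \<and> (\<forall>S\<subseteq>U. cut_gain U e' r' S = cut_gain U e r S) \<and>
    (\<forall>x. h x \<le> h' x) \<and>
    ((0 < m \<and> (\<exists>x\<in>U. h x < h' x)) \<or>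
     (\<forall>w\<in>U. 0 < e' w \<and> h w < H \<longrightarrow> h w < m \<and> (w \<in> set vs \<longrightarrow> Suc (h w) < m)))"
    using assms(5) unfolding pass_def
    by (intro fold_discharge[OF assms(1,2) _ assms(3) _ m(2)]) (simp_all add: assms(2))
  have "progress H U (k - 1) (e', r', h')"
  proof (cases "0 < m \<and> (\<exists>x\<in>U. h x < h' x)")
    case True
    then obtain x where x: "x \<in> U" "h x < h' x" by blast
    have xH: "h' x \<le> H" using f x by (auto simp: valid_def)
    have "(\<Sum>u\<in>U. H - h' u) < (\<Sum>u\<in>U. H - h u)"
    proof (rule sum_strict_mono_ex1[OF assms(1)])
      show "\<forall>u\<in>U. H - h' u \<le> H - h u"
        using f by (auto intro: diff_le_mono2)
      show "\<exists>u\<in>U. H - h' u < H - h u"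
        using x xH by (intro bexI[of _ x]) auto
    qed
    then have "Suc (\<Sum>u\<in>U. H - h' u) * Suc H \<le> (\<Sum>u\<in>U. H - h u) * Suc H"
      by (intro mult_le_mono1) simp
    then have "(\<Sum>u\<in>U. H - h' u) * Suc H + H \<le> k - 1"
      using m(3) True by simp
    then show ?thesis
      unfolding progress_def by auto
  next
    case False
    then have act: "\<forall>w\<in>U. 0 < e' w \<and> h w < H \<longrightarrow> h w < m \<and> Suc (h w) < m"
      using f assms(2) by blast
    have "h w \<le> h' w" for w
      using f by blast
    show ?thesis
    proof (cases "m = 0")
      case True
      then have "\<forall>w\<in>U. \<not> (0 < e' w \<and> h' w < H)"
        using act f by (meson le_less_trans not_less0)
      then show ?thesis
        unfolding progress_def by auto
    next
      case mpos: False
      then have eqU: "\<And>x. x \<in> U \<Longrightarrow> h' x = h x"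
        using f False by (metis bot_nat_0.not_eq_extremum le_neq_implies_less)
      then have "(\<Sum>u\<in>U. H - h' u) = (\<Sum>u\<in>U. H - h u)" by simp
      moreover have "\<forall>w\<in>U. 0 < e' w \<and> h' w < H \<longrightarrow> h' w < m - 1"
        using act eqU by (auto simp: less_diff_conv)
      ultimately show ?thesis
        using m(1,3) mpos unfolding progress_def by (auto intro!: exI[of _ "m - 1"])
    qed
  qed
  then show ?thesis using f by blast
qed

lemma pass_funpow:
  assumes "finite U" "set vs = U" "valid H U (e, r, h)" "progress H U k (e, r, h)"
    "(pass H vs ^^ n) (e, r, h) = (e', r', h')"
  shows "valid H U (e', r', h') \<and> (\<forall>S\<subseteq>U. cut_gain U e' r' S = cut_gain U e r S) \<and>
    progress H U (k - n) (e', r', h')"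
  using assms(5)
proof (induction n arbitrary: e' r' h')
  case 0
  then show ?case using assms by simp
next
  case (Suc n)
  obtain e1 r1 h1 where 1: "(pass H vs ^^ n) (e, r, h) = (e1, r1, h1)"
    by (metis prod_cases3)
  note ih = Suc.IH[OF 1]
  have p: "pass H vs (e1, r1, h1) = (e', r', h')"
    using Suc.prems 1 by simp
  have v: "valid H U (e1, r1, h1)" "progress H U (k - n) (e1, r1, h1)"
    using ih by blast+
  show ?case
    using pass_step[OF assms(1,2) v p] ih by simp
qed

text \<open>
  Let \<open>G\<close> be the set above the gap. By validity no residual arc leaves \<open>G\<close>, so the gain of \<open>G\<close> is its total excess. The
  excesses in \<open>G\<close> are nonnegative as the heights there are positive, those outside are not positive as the
  nodes there lie below the cap without being active. So no set has a larger total excess, let alone a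
  larger gain.
\<close>

lemma gap_cut_optimal:
  assumes "finite U" "valid H U (e, r, h)" "\<forall>w\<in>U. \<not> (0 < e w \<and> h w < H)"
    "g < H" "\<forall>u\<in>U. h u \<noteq> g" "S \<subseteq> U"
  shows "cut_gain U e r S \<le> cut_gain U e r {u \<in> U. g < h u}"
proof -
  let ?G = "{u \<in> U. g < h u}"
  have v: "\<And>u. u \<in> U \<Longrightarrow> e u < 0 \<Longrightarrow> h u = 0"
      "\<And>u v. u \<in> U \<Longrightarrow> v \<in> U \<Longrightarrow> 0 \<le> r (u, v)"
      "\<And>u v. u \<in> U \<Longrightarrow> v \<in> U \<Longrightarrow> 0 < r (u, v) \<Longrightarrow> h u \<le> Suc (h v)"
    using assms(2) by (auto simp: valid_def)
  have zero: "r (u, w) = 0" if "u \<in> ?G" "w \<in> U - ?G" for u w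
  proof (rule ccontr)
    assume "r (u, w) \<noteq> 0"
    then have "h u \<le> Suc (h w)" using v(2,3)[of u w] that by force
    moreover have "h w < g" using that assms(5) by (metis (mono_tags, lifting) DiffE linorder_neqE_nat mem_Collect_eq)
    ultimately show False using that by simp
  qed
  have "cut_gain U e r S \<le> (\<Sum>u\<in>S. e u)"
    using v(2) assms(6) unfolding cut_gain_def by (auto intro!: sum_nonneg)
  also have "\<dots> \<le> (\<Sum>u\<in>S. if g < h u then e u else 0)"
  proof (rule sum_mono)
    fix u assume "u \<in> S"
    then have "\<not> (0 < e u \<and> h u < H)" using assms(3,6) by blast
    then show "e u \<le> (if g < h u then e u else 0)" using assms(4) by auto
  qed
  also have "\<dots> \<le> (\<Sum>u\<in>U. if g < h u then e u else 0)"
  proof (rule sum_mono2[OF assms(1,6)])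
    fix u assume "u \<in> U - S"
    then show "0 \<le> (if g < h u then e u else 0)" using v(1)[of u] by force
  qed
  also have "\<dots> = (\<Sum>u\<in>?G. e u)"
    using assms(1) by (simp add: sum.inter_filter)
  also have "\<dots> = cut_gain U e r ?G"
    unfolding cut_gain_def using zero by simp
  finally show ?thesis .
qed

text \<open>
  There is one more level than there are nodes.
\<close>

lemma exists_gap:
  fixes h :: "nat \<Rightarrow> nat"
  assumes "finite U"
  shows "\<exists>g\<in>{1..Suc (card U)}. \<forall>u\<in>U. h u \<noteq> g"
proof (rule ccontr)
  assume no_gap: "\<not> ?thesis"
  have "{1..Suc (card U)} \<subseteq> h ` U"
  proof
    fix g assume "g \<in> {1..Suc (card U)}"
    then obtain u where "u \<in> U" "h u = g" using no_gap by blast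
    then show "g \<in> h ` U" by blast
  qed
  then have "card {1..Suc (card U)} \<le> card (h ` U)"
    using assms by (intro card_mono) auto
  also have "\<dots> \<le> card U" by (rule card_image_le[OF assms])
  finally show False by simp
qed

text \<open>
  Initially all heights are 0, so every labelling condition holds trivially, and the potential is at most
  \<open>H * H * Suc H + H\<close>. The cubic number of passes is chosen as a product of three equal factors, which a
  program can realize by three nested loops without multiplying numbers.
\<close>

theorem push_relabel_optimal:
  assumes "finite U" "set vs = U" "\<forall>u\<in>U. \<forall>v\<in>U. 0 \<le> r (u, v)" "\<forall>u\<in>U. h u = 0"
    "H = card U + 2" "(pass H vs ^^ (Suc H * Suc H * Suc H)) (e, r, h) = (e', r', h')"
  shows "\<exists>g\<in>{1..Suc (card U)}. \<forall>S\<subseteq>U. cut_gain U e r S \<le> cut_gain U e r {u \<in> U. g < h' u}"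
proof -
  let ?K = "Suc H * Suc H * Suc H"
  have v: "valid H U (e, r, h)"
    using assms(3,4) by (auto simp: valid_def)
  have "(\<Sum>u\<in>U. H - h u) * Suc H + H = card U * H * Suc H + H"
    using assms(4) by simp
  also have "\<dots> \<le> H * H * Suc H + Suc H"
    using assms(5) by (intro add_mono mult_le_mono) auto
  also have "\<dots> \<le> ?K"
    by (simp add: algebra_simps)
  finally have p: "progress H U ?K (e, r, h)"
    unfolding progress_def using assms(4) by (auto intro!: exI[of _ H])
  have res: "valid H U (e', r', h')" "\<forall>S\<subseteq>U. cut_gain U e' r' S = cut_gain U e r S"
      "progress H U (?K - ?K) (e', r', h')"
    using pass_funpow[OF assms(1,2) v p assms(6)] by blast+
  have stop: "\<forall>w\<in>U. \<not> (0 < e' w \<and> h' w < H)"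
    using res(3) by (auto simp: progress_def)
  obtain g where g: "g \<in> {1..Suc (card U)}" "\<forall>u\<in>U. h' u \<noteq> g"
    using exists_gap[OF assms(1)] by blast
  have "cut_gain U e r S \<le> cut_gain U e r {u \<in> U. g < h' u}" if "S \<subseteq> U" for S
    using gap_cut_optimal[OF assms(1) res(1) stop _ g(2) that] g(1) assms(5) res(2) that by auto
  then show ?thesis using g(1) by blast
qed

section \<open>The separation program\<close>

abbreviation NVar :: "string \<Rightarrow> nexp" where "NVar x \<equiv> NArr x []"

text \<open>
  The role variables \<open>x, y, z\<close> hold a permutation of the three matrix indices: \<open>t\<close> ranges over the rows
  belonging to \<open>x\<close>, \<open>q\<close> over those belonging to \<open>y\<close>, and \<open>m\<close> is the fixed index belonging to \<open>z\<close>. Left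
  nodes have the numbers \<open>1, ..., d x\<close>, and right nodes follow.
\<close>

definition left_size :: nexp where "left_size = NArr ''d'' [NVar ''x'']"
definition right_size :: nexp where "right_size = NArr ''d'' [NVar ''y'']"
definition node_count :: nexp where "node_count = NAdd left_size right_size"
definition height_cap :: nexp where "height_cap = NAdd node_count (NConst 2)"

text \<open>
  The memory cells of \<open>X\<close> outside the input are zero, in particular those with the larger matrix index
  first. So the sum of both orientations reads an entry without knowing which of the two indices is larger.
\<close>

definition entry :: "string \<Rightarrow> string \<Rightarrow> nexp \<Rightarrow> nexp \<Rightarrow> rexp" where
  "entry x y p q = RAdd (RArr ''X'' [NVar x, NVar y, p, q]) (RArr ''X'' [NVar y, NVar x, q, p])"

text \<open>
  \<open>gain_inside\<close> is the coefficient of a node as an element of \<open>D\<^sub>1\<close>, \<open>gain_outside\<close> that as an element of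
  \<open>D\<^sub>2\<close>, and \<open>weight\<close> the capacity of an arc. The cells outside the input make case distinctions
  unnecessary: a right node exceeds the row range, and for a left node the truncated subtraction yields the
  index 0; in both cases zero is read.
\<close>

definition gain_inside :: "nexp \<Rightarrow> rexp" where
  "gain_inside u = entry ''x'' ''z'' u (NVar ''m'')"
definition gain_outside :: "nexp \<Rightarrow> rexp" where
  "gain_outside u = entry ''y'' ''z'' (NSub u left_size) (NVar ''m'')"
definition weight :: "nexp \<Rightarrow> nexp \<Rightarrow> rexp" where
  "weight u v = entry ''x'' ''y'' u (NSub v left_size)"

abbreviation (input) "Nu \<equiv> NVar ''u''"
abbreviation (input) "Nv \<equiv> NVar ''v''"
abbreviation (input) "Hu \<equiv> NArr ''h'' [NVar ''u'']"
abbreviation (input) "Hv \<equiv> NArr ''h'' [NVar ''v'']"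
abbreviation (input) "Eu \<equiv> RArr ''e'' [NVar ''u'']"
abbreviation (input) "Ev \<equiv> RArr ''e'' [NVar ''v'']"
abbreviation (input) "Ruv \<equiv> RArr ''r'' [NVar ''u'', NVar ''v'']"
abbreviation (input) "Rvu \<equiv> RArr ''r'' [NVar ''v'', NVar ''u'']"
abbreviation (input) "Val \<equiv> RArr ''val'' []"
abbreviation (input) "Amount \<equiv> RArr ''amount'' []"

definition setup_prog :: prog where
  "setup_prog = PFor ''u'' node_count
     (PSeq (PNat ''h'' [Nu] (NConst 0))
     (PSeq (PReal ''e'' [Nu] (RSub (gain_inside Nu) (gain_outside Nu)))
           (PFor ''v'' node_count (PReal ''r'' [Nu, Nv] (weight Nu Nv)))))"

definition push_prog :: prog where
  "push_prog = PIf (BAnd (NLess Hu height_cap) (BAnd (RLess (RConst 0) Eu)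
       (BAnd (RLess (RConst 0) Ruv) (NLess Hv Hu))))
     (PSeq (PIf (RLess Eu Ruv) (PReal ''amount'' [] Eu) (PReal ''amount'' [] Ruv))
     (PSeq (PReal ''e'' [Nu] (RSub Eu Amount))
     (PSeq (PReal ''e'' [Nv] (RAdd Ev Amount))
     (PSeq (PReal ''r'' [Nu, Nv] (RSub Ruv Amount))
           (PReal ''r'' [Nv, Nu] (RAdd Rvu Amount))))))
     PSkip"

definition discharge_prog :: prog where
  "discharge_prog = PSeq (PFor ''v'' node_count push_prog)
     (PIf (BAnd (NLess Hu height_cap) (RLess (RConst 0) Eu))
       (PNat ''h'' [Nu] (NAdd Hu (NConst 1))) PSkip)"

definition pass_prog :: prog where
  "pass_prog = PFor ''u'' node_count discharge_prog"

text \<open>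
  Three nested loops repeat the pass as often as \<open>push_relabel_optimal\<close> requires.
\<close>

definition rounds_prog :: prog where
  "rounds_prog = (let K = NAdd height_cap (NConst 1) in
     PFor ''r1'' K (PFor ''r2'' K (PFor ''r3'' K pass_prog)))"

definition value_prog :: prog where
  "value_prog = PSeq (PReal ''val'' [] (RConst 0)) (PFor ''u'' node_count
     (PIf (NLess (NVar ''g'') Hu)
       (PSeq (PReal ''val'' [] (RAdd Val (gain_inside Nu)))
         (PFor ''v'' node_count
           (PIf (NLess (NVar ''g'') Hv) PSkip (PReal ''val'' [] (RSub Val (weight Nu Nv))))))
       (PReal ''val'' [] (RAdd Val (gain_outside Nu)))))"

text \<open>
  The sets are written only once: the caller reports only while the family is still 0, and until then the
  characteristic vectors are zero.
\<close>

definition report_prog :: prog where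
  "report_prog = PSeq (PNat ''type'' [] (NVar ''ty''))
     (PSeq (PNat ''i'' [] (NVar ''a'')) (PSeq (PNat ''j'' [] (NVar ''b''))
     (PSeq (PNat ''k'' [] (NVar ''c'')) (PSeq (PNat ''l'' [] (NVar ''m''))
     (PFor ''u'' node_count
       (PIf (NLess (NVar ''g'') Hu)
         (PIf (NLess left_size Nu) PSkip (PNat ''D1'' [Nu] (NConst 1)))
         (PIf (NLess left_size Nu) (PNat ''D2'' [NSub Nu left_size] (NConst 1)) PSkip)))))))"

definition check_prog :: prog where
  "check_prog = PFor ''g'' (NAdd node_count (NConst 1)) (PSeq value_prog
     (PIf (BAnd (NLess (NVar ''type'') (NConst 1)) (RLess (RConst 1) Val)) report_prog PSkip))"

definition cut_prog :: prog where
  "cut_prog = PSeq setup_prog (PSeq rounds_prog check_prog)"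

definition role_prog :: "nat \<Rightarrow> string \<Rightarrow> string \<Rightarrow> string \<Rightarrow> prog" where
  "role_prog ty x y z = PSeq (PNat ''ty'' [] (NConst ty)) (PSeq (PNat ''x'' [] (NVar x))
     (PSeq (PNat ''y'' [] (NVar y)) (PSeq (PNat ''z'' [] (NVar z))
     (PFor ''m'' (NArr ''d'' [NVar ''z'']) cut_prog))))"

definition separation_prog :: prog where
  "separation_prog = PFor ''a'' (NVar ''n'') (PFor ''b'' (NVar ''n'') (PFor ''c'' (NVar ''n'')
     (PIf (BAnd (NLess (NVar ''a'') (NVar ''b'')) (NLess (NVar ''b'') (NVar ''c'')))
       (PSeq (role_prog 1 ''a'' ''b'' ''c'') (PSeq (role_prog 2 ''b'' ''c'' ''a'') (role_prog 3 ''a'' ''c'' ''b'')))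
       PSkip)))"

lemmas expr_defs = left_size_def right_size_def node_count_def height_cap_def entry_def
  gain_inside_def gain_outside_def weight_def

lemmas prog_defs = expr_defs setup_prog_def push_prog_def discharge_prog_def pass_prog_def rounds_prog_def Let_def
  value_prog_def report_prog_def check_prog_def cut_prog_def role_prog_def separation_prog_def

lemma separation_prog_well_bounded: "well_bounded {''n'', ''d''} separation_prog"
  by (simp add: prog_defs)

lemma separation_prog_additive: "additive (compile separation_prog)"
  by (simp add: prog_defs)

section \<open>Effect of the network computation\<close>

text \<open>
  The values of the expressions above as functions of the state.
\<close>

definition entry_at :: "state \<Rightarrow> nat \<Rightarrow> nat \<Rightarrow> nat \<Rightarrow> nat \<Rightarrow> real" where
  "entry_at s i j t q = rmem s ''X'' [i, j, t, q] + rmem s ''X'' [j, i, q, t]"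

definition lefts :: "state \<Rightarrow> nat" where "lefts s = nmem s ''d'' [nmem s ''x'' []]"
definition rights :: "state \<Rightarrow> nat" where "rights s = nmem s ''d'' [nmem s ''y'' []]"
definition nodes :: "state \<Rightarrow> nat" where "nodes s = lefts s + rights s"

definition inside :: "state \<Rightarrow> nat \<Rightarrow> real" where
  "inside s u = entry_at s (nmem s ''x'' []) (nmem s ''z'' []) u (nmem s ''m'' [])"
definition outside :: "state \<Rightarrow> nat \<Rightarrow> real" where
  "outside s u = entry_at s (nmem s ''y'' []) (nmem s ''z'' []) (u - lefts s) (nmem s ''m'' [])"
definition crossing :: "state \<Rightarrow> nat \<times> nat \<Rightarrow> real" where
  "crossing s = (\<lambda>(u, v). entry_at s (nmem s ''x'' []) (nmem s ''y'' []) u (v - lefts s))"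

definition network_of :: "state \<Rightarrow> network" where
  "network_of s = (\<lambda>u. rmem s ''e'' [u], \<lambda>(u, v). rmem s ''r'' [u, v], \<lambda>u. nmem s ''h'' [u])"

lemma eval_exprs [simp]:
  "nval s left_size = lefts s" "nval s node_count = nodes s" "nval s height_cap = nodes s + 2"
  "rval s (gain_inside ue) = inside s (nval s ue)"
  "rval s (gain_outside ue) = outside s (nval s ue)"
  "rval s (weight ue ve) = crossing s (nval s ue, nval s ve)"
  by (simp_all add: expr_defs lefts_def rights_def nodes_def inside_def outside_def crossing_def entry_at_def)

definition env_names :: "string set" where
  "env_names = {''d'', ''X'', ''x'', ''y'', ''z'', ''m''}"

lemma same_env:
  assumes "same_except W s t" "W \<inter> env_names = {}"
  shows "lefts t = lefts s" "nodes t = nodes s" "inside t = inside s" "outside t = outside s"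
    "crossing t = crossing s"
proof -
  have "nmem t x = nmem s x \<and> rmem t x = rmem s x" if "x \<in> env_names" for x
    using assms that by (auto simp: same_except_def)
  then have "nmem t ''d'' = nmem s ''d''" "rmem t ''X'' = rmem s ''X''" "nmem t ''x'' = nmem s ''x''"
      "nmem t ''y'' = nmem s ''y''" "nmem t ''z'' = nmem s ''z''" "nmem t ''m'' = nmem s ''m''"
    by (simp_all add: env_names_def)
  then show "lefts t = lefts s" "nodes t = nodes s" "inside t = inside s" "outside t = outside s"
    "crossing t = crossing s"
    by (simp_all add: fun_eq_iff lefts_def rights_def nodes_def inside_def outside_def crossing_def entry_at_def)
qed

lemma same_cell:
  assumes "same_except W s t" "x \<notin> W"
  shows "nmem t x = nmem s x" "rmem t x = rmem s x"
  using assms by (auto simp: same_except_def)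

lemma env_write [simp]:
  assumes "x \<notin> env_names"
  shows "lefts (nwrite x ks k s) = lefts s" "nodes (nwrite x ks k s) = nodes s"
    "inside (nwrite x ks k s) = inside s" "outside (nwrite x ks k s) = outside s"
    "crossing (nwrite x ks k s) = crossing s"
    "lefts (rwrite x ks a s) = lefts s" "nodes (rwrite x ks a s) = nodes s"
    "inside (rwrite x ks a s) = inside s" "outside (rwrite x ks a s) = outside s"
    "crossing (rwrite x ks a s) = crossing s"
  using same_env[OF same_except_nwrite[of x "{x}" s ks k]] same_env[OF same_except_rwrite[of x "{x}" s ks a]]
    assms by auto

lemma not_env_names [simp]: "''u'' \<notin> env_names" "''v'' \<notin> env_names" "''h'' \<notin> env_names"
  "''e'' \<notin> env_names" "''r'' \<notin> env_names" "''g'' \<notin> env_names" "''val'' \<notin> env_names"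
  "''amount'' \<notin> env_names" "''r1'' \<notin> env_names" "''r2'' \<notin> env_names" "''r3'' \<notin> env_names"
  "''type'' \<notin> env_names" "''i'' \<notin> env_names" "''j'' \<notin> env_names" "''k'' \<notin> env_names"
  "''l'' \<notin> env_names" "''D1'' \<notin> env_names" "''D2'' \<notin> env_names"
  by (simp_all add: env_names_def)

lemma setup_correct:
  assumes "1 \<le> u" "u \<le> nodes s"
  shows "nmem (sem setup_prog s) ''h'' [u] = 0"
    and "rmem (sem setup_prog s) ''e'' [u] = inside s u - outside s u"
    and "\<And>v. 1 \<le> v \<Longrightarrow> v \<le> nodes s \<Longrightarrow> rmem (sem setup_prog s) ''r'' [u, v] = crossing s (u, v)"
proof -
  define filled where "filled = (\<lambda>u k (t :: state). nmem t ''h'' [u] = 0 \<and> rmem t ''e'' [u] = inside s u - outside s u \<and>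
    (\<forall>v. 1 \<le> v \<longrightarrow> v \<le> k \<longrightarrow> rmem t ''r'' [u, v] = crossing s (u, v)))" for u k :: nat and t :: state
  let ?cell = "PReal ''r'' [Nu, Nv] (weight Nu Nv)"
  let ?inner = "PFor ''v'' node_count ?cell"
  let ?body = "PSeq (PNat ''h'' [Nu] (NConst 0))
     (PSeq (PReal ''e'' [Nu] (RSub (gain_inside Nu) (gain_outside Nu))) ?inner)"
  have "\<forall>u. 1 \<le> u \<longrightarrow> u \<le> nval s node_count \<longrightarrow> filled u (nodes s) (sem (PFor ''u'' node_count ?body) s)"
  proof (rule sem_For_invariant[where I = "\<lambda>k t. \<forall>u. 1 \<le> u \<longrightarrow> u \<le> k \<longrightarrow> filled u (nodes s) t"])
    fix m t
    assume m: "1 \<le> m" and t: "same_except (insert ''u'' (writes ?body)) s t" "nmem t ''u'' [] = m"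
      and I: "\<forall>u. 1 \<le> u \<longrightarrow> u \<le> m - 1 \<longrightarrow> filled u (nodes s) t"
    have env: "nodes t = nodes s" "inside t = inside s" "outside t = outside s" "crossing t = crossing s"
      using same_env[OF t(1)] by auto
    define t0 where "t0 = rwrite ''e'' [m] (inside t m - outside t m) (nwrite ''h'' [m] 0 t)"
    have st: "sem ?body t = sem ?inner t0"
      unfolding t0_def by (simp only: sem.simps eval_exprs nval.simps rval.simps list.map t(2)) (simp add: t(2))
    have u0: "nmem t0 ''u'' [] = m" and env0: "nodes t0 = nodes s" "crossing t0 = crossing s"
      by (simp_all add: t0_def t(2) env)
    have base: "filled u (nodes s) t0" if "1 \<le> u" "u < m" for u
      using I that by (auto simp: filled_def t0_def)
    have base_m: "filled m 0 t0"
      by (simp add: filled_def t0_def env)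
    have "(\<forall>u. 1 \<le> u \<longrightarrow> u < m \<longrightarrow> filled u (nodes s) (sem ?inner t0)) \<and>
        filled m (nval t0 node_count) (sem ?inner t0)"
    proof (rule sem_For_invariant[where I = "\<lambda>k t'. (\<forall>u. 1 \<le> u \<longrightarrow> u < m \<longrightarrow> filled u (nodes s) t') \<and> filled m k t'"])
      show "(\<forall>u. 1 \<le> u \<longrightarrow> u < m \<longrightarrow> filled u (nodes s) t0) \<and> filled m 0 t0"
        using base base_m by blast
    next
      fix k t'
      assume k: "1 \<le> k" and t': "same_except (insert ''v'' (writes ?cell)) t0 t'" "nmem t' ''v'' [] = k"
        and I': "(\<forall>u. 1 \<le> u \<longrightarrow> u < m \<longrightarrow> filled u (nodes s) t') \<and> filled m (k - 1) t'"
      have u': "nmem t' ''u'' [] = m"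
        using same_cell(1)[OF t'(1), of "''u''"] u0 by simp
      have c': "crossing t' = crossing s"
        using same_env(5)[OF t'(1)] env0 by simp
      have cell: "sem ?cell t' = rwrite ''r'' [m, k] (crossing s (m, k)) t'"
        by (simp add: u' c' t'(2))
      have "filled u (nodes s) (sem ?cell t')" if "1 \<le> u" "u < m" for u
        using I' that unfolding cell by (auto simp: filled_def)
      moreover have "filled m k (sem ?cell t')"
        unfolding cell filled_def
      proof (intro conjI allI impI)
        fix v assume "1 \<le> v" "v \<le> k"
        then show "rmem (rwrite ''r'' [m, k] (crossing s (m, k)) t') ''r'' [m, v] = crossing s (m, v)"
          using I' by (cases "v = k") (auto simp: filled_def)
      qed (use I' in \<open>auto simp: filled_def\<close>)
      ultimately show "(\<forall>u. 1 \<le> u \<longrightarrow> u < m \<longrightarrow> filled u (nodes s) (sem ?cell t')) \<and> filled m k (sem ?cell t')"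
        by blast
    qed (simp add: filled_def)
    then have "filled u (nodes s) (sem ?inner t0)" if "1 \<le> u" "u \<le> m" for u
      using that env0(1) by (cases "u = m") auto
    then show "\<forall>u. 1 \<le> u \<longrightarrow> u \<le> m \<longrightarrow> filled u (nodes s) (sem ?body t)"
      unfolding st by blast
  qed (simp_all add: filled_def)
  then have "filled u (nodes s) (sem setup_prog s)"
    using assms unfolding setup_prog_def eval_exprs by blast
  then show "nmem (sem setup_prog s) ''h'' [u] = 0"
      "rmem (sem setup_prog s) ''e'' [u] = inside s u - outside s u"
      "\<And>v. 1 \<le> v \<Longrightarrow> v \<le> nodes s \<Longrightarrow> rmem (sem setup_prog s) ''r'' [u, v] = crossing s (u, v)"
    unfolding filled_def by blast+
qed

lemma push_prog_correct:
  "network_of (sem push_prog s) = push (nodes s + 2) (nmem s ''u'' []) (nmem s ''v'' []) (network_of s)"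
proof -
  define u v where "u = nmem s ''u'' []" and "v = nmem s ''v'' []"
  define e h where "e = (\<lambda>u. rmem s ''e'' [u])" and "h = (\<lambda>u. nmem s ''h'' [u])"
  define r where "r = (\<lambda>(u, v). rmem s ''r'' [u, v])"
  note defs = u_def[symmetric] v_def[symmetric]
  have net: "network_of s = (e, r, h)"
    by (simp add: network_of_def e_def h_def r_def)
  have cells: "rmem s ''e'' [w] = e w" "rmem s ''r'' [w, w'] = r (w, w')" "nmem s ''h'' [w] = h w" for w w'
    by (simp_all add: e_def h_def r_def)
  show ?thesis
  proof (cases "h u < nodes s + 2 \<and> 0 < e u \<and> 0 < r (u, v) \<and> h v < h u")
    case True
    define a where "a = min (e u) (r (u, v))"
    have uv: "u \<noteq> v" using True by auto
    have amount: "sem (PIf (RLess Eu Ruv) (PReal ''amount'' [] Eu) (PReal ''amount'' [] Ruv)) s =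
        rwrite ''amount'' [] a s"
      by (simp add: defs cells a_def min_def)
    define s1 where "s1 = rwrite ''amount'' [] a s"
    define s2 where "s2 = rwrite ''e'' [u] (e u - a) s1"
    define s3 where "s3 = rwrite ''e'' [v] (e v + a) s2"
    define s4 where "s4 = rwrite ''r'' [u, v] (r (u, v) - a) s3"
    define s5 where "s5 = rwrite ''r'' [v, u] (r (v, u) + a) s4"
    have steps: "sem (PReal ''e'' [Nu] (RSub Eu Amount)) s1 = s2" "sem (PReal ''e'' [Nv] (RAdd Ev Amount)) s2 = s3"
        "sem (PReal ''r'' [Nu, Nv] (RSub Ruv Amount)) s3 = s4" "sem (PReal ''r'' [Nv, Nu] (RAdd Rvu Amount)) s4 = s5"
      using uv by (simp_all add: s1_def s2_def s3_def s4_def s5_def defs cells)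
    have "bval s (BAnd (NLess Hu height_cap) (BAnd (RLess (RConst 0) Eu)
        (BAnd (RLess (RConst 0) Ruv) (NLess Hv Hu))))"
      using True by (simp add: defs cells)
    then have "sem push_prog s = s5"
      unfolding push_prog_def sem.simps(4) sem.simps(5)[of "BAnd b b'" for b b']
      by (simp only: if_True amount s1_def[symmetric] steps)
    moreover have "network_of s5 = push (nodes s + 2) u v (e, r, h)"
      using True uv
      by (auto simp: network_of_def push_def Let_def fun_eq_iff cells a_def[symmetric] s1_def s2_def s3_def s4_def s5_def)
    ultimately show ?thesis by (simp add: net defs)
  next
    case False
    then have "sem push_prog s = s"
      by (simp add: push_prog_def defs cells del: de_Morgan_conj)
    then show ?thesis
      using False by (auto simp: net defs push_def)
  qed
qed

lemma network_of_counter [simp]: "x \<noteq> ''h'' \<Longrightarrow> network_of (nwrite x ks k s) = network_of s"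
  by (simp add: network_of_def)

lemma discharge_prog_correct:
  "network_of (sem discharge_prog s) =
    discharge (nodes s + 2) [1..<Suc (nodes s)] (nmem s ''u'' []) (network_of s)"
proof -
  let ?u = "nmem s ''u'' []"
  let ?t = "sem (PFor ''v'' node_count push_prog) s"
  have "network_of ?t = fold (push (nodes s + 2) ?u) [1..<Suc (nval s node_count)] (network_of s)"
  proof (rule sem_For_fold)
    fix m t
    assume t: "same_except (insert ''v'' (writes push_prog)) s t" "nmem t ''v'' [] = m"
    have "nodes t = nodes s" "nmem t ''u'' = nmem s ''u''"
      using same_env(2)[OF t(1)] same_cell(1)[OF t(1), of "''u''"] by (auto simp: push_prog_def)
    then show "network_of (sem push_prog t) = push (nodes s + 2) ?u m (network_of t)"
      using t(2) by (simp add: push_prog_correct)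
  qed simp
  moreover note same = sem_same_except[of "PFor ''v'' node_count push_prog" s]
  have "nodes ?t = nodes s" "nmem ?t ''u'' = nmem s ''u''"
    using same_env(2)[OF same] same_cell(1)[OF same, of "''u''"] by (simp_all add: push_prog_def del: sem.simps)
  then have "network_of (sem discharge_prog s) = relabel (nodes s + 2) ?u (network_of ?t)"
    unfolding discharge_prog_def sem.simps(4)
    by (auto simp: network_of_def relabel_def fun_eq_iff simp del: sem.simps(6))
  ultimately show ?thesis
    by (simp add: discharge_def)
qed

lemma pass_prog_correct:
  "network_of (sem pass_prog s) = pass (nodes s + 2) [1..<Suc (nodes s)] (network_of s)"
proof -
  have "network_of (sem pass_prog s) =
      fold (discharge (nodes s + 2) [1..<Suc (nodes s)]) [1..<Suc (nval s node_count)] (network_of s)"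
    unfolding pass_prog_def
  proof (rule sem_For_fold)
    fix m t
    assume t: "same_except (insert ''u'' (writes discharge_prog)) s t" "nmem t ''u'' [] = m"
    have "nodes t = nodes s"
      using same_env(2)[OF t(1)] by (auto simp: push_prog_def discharge_prog_def)
    then show "network_of (sem discharge_prog t) = discharge (nodes s + 2) [1..<Suc (nodes s)] m (network_of t)"
      using t(2) by (simp add: discharge_prog_correct)
  qed simp
  then show ?thesis by (simp add: pass_def)
qed

lemma fold_const: "fold (\<lambda>_. f) xs = f ^^ length xs"
  by (induction xs) (simp_all add: funpow_Suc_right del: funpow.simps)

lemma repeat_prog_correct:
  assumes "\<And>t. same_except (insert x (writes p)) s t \<Longrightarrow> network_of (sem p t) = f (network_of t)" "x \<noteq> ''h''"
  shows "network_of (sem (PFor x e p) s) = (f ^^ nval s e) (network_of s)"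
  using sem_For_fold[of s e x p network_of "\<lambda>_. f"] assms by (simp add: fold_const del: sem.simps upt_Suc)

lemma rounds_prog_correct:
  "network_of (sem rounds_prog s) =
    (pass (nodes s + 2) [1..<Suc (nodes s)] ^^ (Suc (nodes s + 2) * Suc (nodes s + 2) * Suc (nodes s + 2)))
    (network_of s)"
proof -
  let ?K = "NAdd height_cap (NConst 1)"
  define f where "f = pass (nodes s + 2) [1..<Suc (nodes s)]"
  define K where "K = Suc (nodes s + 2)"
  have bound: "nval t ?K = K" if "nodes t = nodes s" for t
    using that by (simp add: K_def)
  have same: "nodes t' = nodes s"
    if "same_except (insert x (writes p)) t t'" "nodes t = nodes s"
      "insert x (writes p) \<inter> env_names = {}" for x p t t'
    using same_env(2)[OF that(1,3)] that(2) by simp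
  have writes: "writes pass_prog \<inter> env_names = {}"
    by (simp add: pass_prog_def discharge_prog_def push_prog_def)
  have 1: "network_of (sem (PFor ''r3'' ?K pass_prog) t) = (f ^^ K) (network_of t)"
    if t: "nodes t = nodes s" for t
    unfolding bound[OF t, symmetric]
  proof (rule repeat_prog_correct)
    fix t' assume "same_except (insert ''r3'' (writes pass_prog)) t t'"
    then have "nodes t' = nodes s" by (rule same[OF _ t]) (simp add: writes)
    then show "network_of (sem pass_prog t') = f (network_of t')"
      by (simp add: pass_prog_correct f_def)
  qed simp
  have 2: "network_of (sem (PFor ''r2'' ?K (PFor ''r3'' ?K pass_prog)) t) = ((f ^^ K) ^^ K) (network_of t)"
    if t: "nodes t = nodes s" for t
    unfolding bound[OF t, symmetric]
  proof (rule repeat_prog_correct)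
    fix t' assume "same_except (insert ''r2'' (writes (PFor ''r3'' ?K pass_prog))) t t'"
    then have "nodes t' = nodes s" by (rule same[OF _ t]) (simp add: writes)
    then show "network_of (sem (PFor ''r3'' ?K pass_prog) t') = (f ^^ nval t ?K) (network_of t')"
      unfolding bound[OF t] by (rule 1)
  qed simp
  have 3: "network_of (sem (PFor ''r1'' ?K (PFor ''r2'' ?K (PFor ''r3'' ?K pass_prog))) s) =
      (((f ^^ K) ^^ K) ^^ K) (network_of s)"
    unfolding bound[OF refl, symmetric]
  proof (rule repeat_prog_correct)
    fix t' assume "same_except (insert ''r1'' (writes (PFor ''r2'' ?K (PFor ''r3'' ?K pass_prog)))) s t'"
    then have "nodes t' = nodes s" by (rule same[OF _ refl]) (simp add: writes)
    then show "network_of (sem (PFor ''r2'' ?K (PFor ''r3'' ?K pass_prog)) t') =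
        ((f ^^ nval s ?K) ^^ nval s ?K) (network_of t')"
      unfolding bound[OF refl] by (rule 2)
  qed simp
  then show ?thesis
    unfolding rounds_prog_def Let_def funpow_mult f_def[symmetric] K_def[symmetric] .
qed

definition cut_value :: "state \<Rightarrow> nat set \<Rightarrow> real" where
  "cut_value s S = (\<Sum>u\<in>S. inside s u) + (\<Sum>u\<in>{1..nodes s} - S. outside s u) -
     (\<Sum>u\<in>S. \<Sum>v\<in>{1..nodes s} - S. crossing s (u, v))"

definition upper_level :: "state \<Rightarrow> nat \<Rightarrow> nat set" where
  "upper_level s g = {u \<in> {1..nodes s}. g < nmem s ''h'' [u]}"

lemma cut_value_eq_cut_gain:
  assumes "S \<subseteq> {1..nodes s}"
  shows "cut_value s S = cut_gain {1..nodes s} (\<lambda>u. inside s u - outside s u) (crossing s) S +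
    (\<Sum>u\<in>{1..nodes s}. outside s u)"
proof -
  have "(\<Sum>u\<in>{1..nodes s}. outside s u) = (\<Sum>u\<in>{1..nodes s} - S. outside s u) + (\<Sum>u\<in>S. outside s u)"
    by (rule sum.subset_diff[OF assms]) simp
  then show ?thesis
    by (simp add: cut_value_def cut_gain_def sum_subtractf)
qed

lemma cut_gain_cong:
  assumes "\<And>u. u \<in> U \<Longrightarrow> e u = e' u" "\<And>u v. u \<in> U \<Longrightarrow> v \<in> U \<Longrightarrow> r (u, v) = r' (u, v)" "S \<subseteq> U"
  shows "cut_gain U e r S = cut_gain U e' r' S"
proof -
  have "(\<Sum>u\<in>S. e u) = (\<Sum>u\<in>S. e' u)"
    using assms by (intro sum.cong) auto
  moreover have "(\<Sum>u\<in>S. \<Sum>v\<in>U - S. r (u, v)) = (\<Sum>u\<in>S. \<Sum>v\<in>U - S. r' (u, v))"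
    using assms by (intro sum.cong) auto
  ultimately show ?thesis by (simp add: cut_gain_def)
qed

text \<open>
  The value of a cut and its gain differ by the constant \<open>\<Sum>u. outside s u\<close>, so the optimal
  level for the gain is optimal for the value.
\<close>

lemma rounds_find_optimal_cut:
  fixes s :: state
  defines "t \<equiv> sem rounds_prog (sem setup_prog s)"
  assumes "\<And>u v. 0 \<le> crossing s (u, v)"
  shows "\<exists>g\<in>{1..Suc (nodes s)}. \<forall>S\<subseteq>{1..nodes s}. cut_value s S \<le> cut_value s (upper_level t g)"
proof -
  let ?U = "{1..nodes s}" and ?vs = "[1..<Suc (nodes s)]"
  define s1 where "s1 = sem setup_prog s"
  obtain e r h where 1: "network_of s1 = (e, r, h)" by (metis prod_cases3)
  obtain e' r' h' where 2: "network_of t = (e', r', h')" by (metis prod_cases3)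
  have n1: "nodes s1 = nodes s"
    unfolding s1_def by (rule same_env(2)[OF sem_same_except]) (simp add: setup_prog_def)
  have nt: "nodes t = nodes s1"
    unfolding t_def s1_def[symmetric] by (rule same_env(2)[OF sem_same_except])
      (simp add: rounds_prog_def Let_def pass_prog_def discharge_prog_def push_prog_def)
  have e: "e u = inside s u - outside s u" and h: "h u = 0" if "u \<in> ?U" for u
    using setup_correct(1,2)[of u s] that 1 by (auto simp: network_of_def s1_def)
  have r: "r (u, v) = crossing s (u, v)" if "u \<in> ?U" "v \<in> ?U" for u v
    using setup_correct(3)[of u s v] that 1 by (auto simp: network_of_def s1_def)
  have vs: "set ?vs = ?U" by auto
  have run: "(pass (nodes s + 2) ?vs ^^ (Suc (nodes s + 2) * Suc (nodes s + 2) * Suc (nodes s + 2))) (e, r, h) = (e', r', h')"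
    using rounds_prog_correct[of s1] unfolding t_def[folded s1_def, symmetric] 1 2 n1 by simp
  have "\<exists>g\<in>{1..Suc (card ?U)}. \<forall>S\<subseteq>?U. cut_gain ?U e r S \<le> cut_gain ?U e r {u \<in> ?U. g < h' u}"
    by (rule push_relabel_optimal[OF _ vs _ _ _ run]) (use r h assms(2) in auto)
  then obtain g where g: "g \<in> {1..Suc (nodes s)}"
      "\<And>S. S \<subseteq> ?U \<Longrightarrow> cut_gain ?U e r S \<le> cut_gain ?U e r {u \<in> ?U. g < h' u}"
    by auto
  have G: "{u \<in> ?U. g < h' u} = upper_level t g"
    using 2 nt n1 by (auto simp: upper_level_def network_of_def)
  have val: "cut_value s S = cut_gain ?U e r S + (\<Sum>u\<in>?U. outside s u)" if "S \<subseteq> ?U" for S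
    unfolding cut_value_eq_cut_gain[OF that] using e r that by (subst cut_gain_cong[of ?U e]) auto
  have "cut_value s S \<le> cut_value s (upper_level t g)" if "S \<subseteq> ?U" for S
  proof -
    have "upper_level t g \<subseteq> ?U" unfolding G[symmetric] by blast
    then show ?thesis using g(2)[OF that] val that unfolding G by simp
  qed
  then show ?thesis using g(1) by blast
qed

lemma value_prog_correct:
  "rmem (sem value_prog s) ''val'' [] = cut_value s (upper_level s (nmem s ''g'' []))"
proof -
  define g where "g = nmem s ''g'' []"
  define hi where "hi = (\<lambda>u. g < nmem s ''h'' [u])"
  define row where "row = (\<lambda>u. if hi u then inside s u - (\<Sum>v\<in>{1..nodes s}. if hi v then 0 else crossing s (u, v))
    else outside s u)"
  let ?cell = "PIf (NLess (NVar ''g'') Hv) PSkip (PReal ''val'' [] (RSub Val (weight Nu Nv)))"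
  let ?row = "PFor ''v'' node_count ?cell"
  let ?body = "PIf (NLess (NVar ''g'') Hu)
       (PSeq (PReal ''val'' [] (RAdd Val (gain_inside Nu))) ?row)
       (PReal ''val'' [] (RAdd Val (gain_outside Nu)))"
  let ?s = "rwrite ''val'' [] 0 s"
  have last: "{Suc 0..m} = insert m {Suc 0..m - 1}" if "Suc 0 \<le> m" for m :: nat
    using that by auto
  have "rmem (sem (PFor ''u'' node_count ?body) ?s) ''val'' [] = (\<Sum>u\<in>{1..nval ?s node_count}. row u)"
  proof (rule sem_For_invariant[where I = "\<lambda>k t. rmem t ''val'' [] = (\<Sum>u\<in>{1..k}. row u)"])
    fix m t
    assume m: "1 \<le> m" and t: "same_except (insert ''u'' (writes ?body)) ?s t" "nmem t ''u'' [] = m"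
      and I: "rmem t ''val'' [] = (\<Sum>u\<in>{1..m - 1}. row u)"
    have env: "nodes t = nodes s" "inside t = inside s" "outside t = outside s" "crossing t = crossing s"
      using same_env[OF t(1)] by auto
    have mem: "nmem t ''g'' [] = g" "nmem t ''h'' = nmem s ''h''"
      using same_cell[OF t(1), of "''g''"] same_cell[OF t(1), of "''h''"] by (auto simp: g_def)
    have row_sum: "(\<Sum>u\<in>{1..m}. row u) = row m + rmem t ''val'' []"
      using m I last[of m] by simp
    show "rmem (sem ?body t) ''val'' [] = (\<Sum>u\<in>{1..m}. row u)"
    proof (cases "hi m")
      case True
      define t0 where "t0 = rwrite ''val'' [] (rmem t ''val'' [] + inside s m) t"
      have t0: "nmem t0 = nmem t" "nodes t0 = nodes s" "crossing t0 = crossing s"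
        by (simp_all add: t0_def env)
      have body: "sem ?body t = sem ?row t0"
        using True by (simp add: t0_def mem t(2) hi_def env del: sem.simps(6))
      have "rmem (sem ?row t0) ''val'' [] = rmem t ''val'' [] + inside s m -
          (\<Sum>v\<in>{1..nval t0 node_count}. if hi v then 0 else crossing s (m, v))"
      proof (rule sem_For_invariant[where I = "\<lambda>k t'. rmem t' ''val'' [] = rmem t ''val'' [] + inside s m -
          (\<Sum>v\<in>{1..k}. if hi v then 0 else crossing s (m, v))"])
        fix k t'
        assume k: "1 \<le> k" and t': "same_except (insert ''v'' (writes ?cell)) t0 t'" "nmem t' ''v'' [] = k"
          and I': "rmem t' ''val'' [] = rmem t ''val'' [] + inside s m -
            (\<Sum>v\<in>{1..k - 1}. if hi v then 0 else crossing s (m, v))"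
        have mem': "nmem t' ''g'' [] = g" "nmem t' ''h'' = nmem s ''h''" "nmem t' ''u'' [] = m"
          using same_cell[OF t'(1), of "''g''"] same_cell[OF t'(1), of "''h''"]
            same_cell[OF t'(1), of "''u''"] by (auto simp: t0 mem t(2))
        have "crossing t' = crossing s"
          using same_env(5)[OF t'(1)] t0 by simp
        then have "rmem (sem ?cell t') ''val'' [] = rmem t' ''val'' [] - (if hi k then 0 else crossing s (m, k))"
          by (simp add: mem' t'(2) hi_def)
        also have "\<dots> = rmem t ''val'' [] + inside s m -
            (\<Sum>v\<in>{1..k}. if hi v then 0 else crossing s (m, v))"
          using k I' last[of k] by simp
        finally show "rmem (sem ?cell t') ''val'' [] = rmem t ''val'' [] + inside s m -
            (\<Sum>v\<in>{1..k}. if hi v then 0 else crossing s (m, v))" .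
      qed (simp_all add: t0_def)
      then show ?thesis
        unfolding body row_sum using True by (simp add: row_def t0)
    next
      case False
      then show ?thesis
        unfolding row_sum by (simp add: mem t(2) hi_def env row_def)
    qed
  qed simp_all
  then have "rmem (sem value_prog s) ''val'' [] = (\<Sum>u\<in>{1..nodes s}. row u)"
    unfolding value_prog_def sem.simps(4) by (simp del: sem.simps(6) add: of_rat_0)
  also have "\<dots> = (\<Sum>u\<in>{1..nodes s}. if hi u then inside s u -
      (\<Sum>v\<in>{1..nodes s}. if hi v then 0 else crossing s (u, v)) else outside s u)"
    by (simp add: row_def)
  also have "\<dots> = cut_value s {u \<in> {1..nodes s}. hi u}"
  proof -
    let ?S = "{u \<in> {1..nodes s}. hi u}"
    have comp: "{1..nodes s} - ?S = {u \<in> {1..nodes s}. \<not> hi u}" by auto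
    have row': "(\<Sum>v\<in>{1..nodes s}. if hi v then 0 else crossing s (u, v)) =
        (\<Sum>v\<in>{1..nodes s} - ?S. crossing s (u, v))" for u
      unfolding comp by (subst sum.inter_filter) (auto intro!: sum.cong)
    have "(\<Sum>u\<in>{1..nodes s}. if hi u then inside s u -
        (\<Sum>v\<in>{1..nodes s} - ?S. crossing s (u, v)) else outside s u) =
      (\<Sum>u\<in>?S. inside s u - (\<Sum>v\<in>{1..nodes s} - ?S. crossing s (u, v))) +
      (\<Sum>u\<in>{1..nodes s} - ?S. outside s u)"
    proof (subst sum.If_cases)
      have "{1..nodes s} \<inter> {u. hi u} = ?S" "{1..nodes s} \<inter> - {u. hi u} = {1..nodes s} - ?S"
        by auto
      then show "(\<Sum>u\<in>{1..nodes s} \<inter> {u. hi u}. inside s u - (\<Sum>v\<in>{1..nodes s} - ?S. crossing s (u, v))) +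
          (\<Sum>u\<in>{1..nodes s} \<inter> - {u. hi u}. outside s u) =
        (\<Sum>u\<in>?S. inside s u - (\<Sum>v\<in>{1..nodes s} - ?S. crossing s (u, v))) +
          (\<Sum>u\<in>{1..nodes s} - ?S. outside s u)"
        by (simp only:)
    qed simp
    then show ?thesis
      unfolding row' by (simp add: cut_value_def sum_subtractf)
  qed
  also have "{u \<in> {1..nodes s}. hi u} = upper_level s (nmem s ''g'' [])"
    by (simp add: upper_level_def hi_def g_def)
  finally show ?thesis .
qed

section \<open>Correctness of the separation program\<close>

lemma report_prog_correct:
  assumes "\<And>x. nmem s ''D1'' [x] = 0" "\<And>x. nmem s ''D2'' [x] = 0"
  defines "t \<equiv> sem report_prog s" and "S \<equiv> upper_level s (nmem s ''g'' [])"
  shows "nmem t ''type'' [] = nmem s ''ty'' []" "nmem t ''i'' [] = nmem s ''a'' []"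
    "nmem t ''j'' [] = nmem s ''b'' []" "nmem t ''k'' [] = nmem s ''c'' []" "nmem t ''l'' [] = nmem s ''m'' []"
    "{x. nmem t ''D1'' [x] = 1} = S \<inter> {1..lefts s}"
    "{x. nmem t ''D2'' [x] = 1} = {q \<in> {1..rights s}. lefts s + q \<notin> S}"
proof -
  define g where "g = nmem s ''g'' []"
  define hi where "hi = (\<lambda>u. g < nmem s ''h'' [u])"
  define p where "p = lefts s"
  define s0 where "s0 = nwrite ''l'' [] (nmem s ''m'' []) (nwrite ''k'' [] (nmem s ''c'' [])
    (nwrite ''j'' [] (nmem s ''b'' []) (nwrite ''i'' [] (nmem s ''a'' []) (nwrite ''type'' [] (nmem s ''ty'' []) s))))"
  let ?body = "PIf (NLess (NVar ''g'') Hu)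
         (PIf (NLess left_size Nu) PSkip (PNat ''D1'' [Nu] (NConst 1)))
         (PIf (NLess left_size Nu) (PNat ''D2'' [NSub Nu left_size] (NConst 1)) PSkip)"
  let ?loop = "PFor ''u'' node_count ?body"
  have t: "t = sem ?loop s0"
    unfolding t_def report_prog_def s0_def by (simp del: sem.simps(6))
  have same: "same_except (writes ?loop) s0 t"
    unfolding t by (rule sem_same_except)
  show "nmem t ''type'' [] = nmem s ''ty'' []" "nmem t ''i'' [] = nmem s ''a'' []"
    "nmem t ''j'' [] = nmem s ''b'' []" "nmem t ''k'' [] = nmem s ''c'' []" "nmem t ''l'' [] = nmem s ''m'' []"
    using same_cell(1)[OF same, of "''type''"] same_cell(1)[OF same, of "''i''"] same_cell(1)[OF same, of "''j''"]
      same_cell(1)[OF same, of "''k''"] same_cell(1)[OF same, of "''l''"]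
    by (simp_all add: s0_def)
  have n0: "nodes s0 = nodes s" by (simp add: s0_def)
  let ?I = "\<lambda>k t. \<forall>x. nmem t ''D1'' [x] = (if 1 \<le> x \<and> x \<le> k \<and> x \<le> p \<and> hi x then 1 else 0) \<and>
      nmem t ''D2'' [x] = (if 1 \<le> x \<and> p + x \<le> k \<and> \<not> hi (p + x) then 1 else 0)"
  have "?I (nval s0 node_count) (sem ?loop s0)"
  proof (rule sem_For_invariant[where I = ?I])
    fix m t'
    assume m: "1 \<le> m" and t': "same_except (insert ''u'' (writes ?body)) s0 t'" "nmem t' ''u'' [] = m"
      and I: "?I (m - 1) t'"
    have mem: "nmem t' ''g'' [] = g" "nmem t' ''h'' = nmem s ''h''" "lefts t' = p"
      using same_cell[OF t'(1), of "''g''"] same_cell[OF t'(1), of "''h''"] same_env(1)[OF t'(1)]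
      by (auto simp: g_def s0_def p_def)
    show "?I m (sem ?body t')"
    proof (cases "hi m")
      case True
      show ?thesis
      proof (cases "p < m")
        case pm: True
        have "sem ?body t' = t'" using True pm by (simp add: mem t'(2) hi_def)
        moreover have "nmem t' ''D1'' [x] = (if 1 \<le> x \<and> x \<le> m \<and> x \<le> p \<and> hi x then 1 else 0)" for x
          using I pm by auto
        moreover have "nmem t' ''D2'' [x] = (if 1 \<le> x \<and> p + x \<le> m \<and> \<not> hi (p + x) then 1 else 0)" for x
          using I True m by (cases "p + x = m") auto
        ultimately show ?thesis by presburger
      next
        case pm: False
        have "sem ?body t' = nwrite ''D1'' [m] 1 t'" using True pm by (simp add: mem t'(2) hi_def)
        moreover have "nmem (nwrite ''D1'' [m] 1 t') ''D1'' [x] =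
            (if 1 \<le> x \<and> x \<le> m \<and> x \<le> p \<and> hi x then 1 else 0)" for x
          using I True pm m by (cases "x = m") auto
        moreover have "nmem (nwrite ''D1'' [m] 1 t') ''D2'' [x] =
            (if 1 \<le> x \<and> p + x \<le> m \<and> \<not> hi (p + x) then 1 else 0)" for x
          using I pm by auto
        ultimately show ?thesis by presburger
      qed
    next
      case False
      show ?thesis
      proof (cases "p < m")
        case pm: True
        have "sem ?body t' = nwrite ''D2'' [m - p] 1 t'" using False pm by (simp add: mem t'(2) hi_def)
        moreover have "nmem (nwrite ''D2'' [m - p] 1 t') ''D1'' [x] =
            (if 1 \<le> x \<and> x \<le> m \<and> x \<le> p \<and> hi x then 1 else 0)" for x
          using I pm by auto
        moreover have "nmem (nwrite ''D2'' [m - p] 1 t') ''D2'' [x] =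
            (if 1 \<le> x \<and> p + x \<le> m \<and> \<not> hi (p + x) then 1 else 0)" for x
          using I False pm m by (cases "x = m - p") auto
        ultimately show ?thesis by presburger
      next
        case pm: False
        have "sem ?body t' = t'" using False pm by (simp add: mem t'(2) hi_def)
        moreover have "nmem t' ''D1'' [x] = (if 1 \<le> x \<and> x \<le> m \<and> x \<le> p \<and> hi x then 1 else 0)" for x
          using I False m by (cases "x = m") auto
        moreover have "nmem t' ''D2'' [x] = (if 1 \<le> x \<and> p + x \<le> m \<and> \<not> hi (p + x) then 1 else 0)" for x
          using I pm by auto
        ultimately show ?thesis by presburger
      qed
    qed
  next
    show "?I 0 s0" using assms(1,2) by (simp add: s0_def)
  qed simp
  then have I: "nmem t ''D1'' [x] = (if 1 \<le> x \<and> x \<le> nodes s \<and> x \<le> p \<and> hi x then 1 else 0)"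
      "nmem t ''D2'' [x] = (if 1 \<le> x \<and> p + x \<le> nodes s \<and> \<not> hi (p + x) then 1 else 0)" for x
    unfolding t eval_exprs n0 by blast+
  show "{x. nmem t ''D1'' [x] = 1} = S \<inter> {1..lefts s}"
    unfolding I S_def upper_level_def by (auto simp: hi_def g_def p_def)
  show "{x. nmem t ''D2'' [x] = 1} = {q \<in> {1..rights s}. lefts s + q \<notin> S}"
    unfolding I S_def upper_level_def by (auto simp: hi_def g_def p_def nodes_def)
qed

text \<open>
  The inequality that is stored by the output variables.
\<close>

definition cons_of :: "nat \<Rightarrow> nat \<Rightarrow> nat \<Rightarrow> nat \<Rightarrow> nat set \<Rightarrow> nat set \<Rightarrow> nat \<Rightarrow> cons_ineq" where
  "cons_of ty i j k D1 D2 l = (if ty = 1 then Cons1 i j k D1 D2 l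
     else if ty = 2 then Cons2 i j k D1 D2 l else Cons3 i j k D1 D2 l)"

text \<open>
  In the three families the third matrix index, to which \<open>l\<close> belongs, is \<open>k\<close>, \<open>i\<close> and \<open>j\<close>
  respectively; the other two keep their order.
\<close>

definition role :: "nat \<Rightarrow> nat \<Rightarrow> nat \<Rightarrow> nat \<Rightarrow> nat \<Rightarrow> nat \<Rightarrow> nat \<Rightarrow> bool" where
  "role ty i j k x y z \<longleftrightarrow> (ty = 1 \<and> x = i \<and> y = j \<and> z = k) \<or> (ty = 2 \<and> x = j \<and> y = k \<and> z = i) \<or>
     (ty = 3 \<and> x = i \<and> y = k \<and> z = j)"

definition output_names :: "string set" where
  "output_names = {''type'', ''i'', ''j'', ''k'', ''l'', ''D1'', ''D2''}"

text \<open>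
  The right nodes outside \<open>S\<close> are the elements of \<open>D\<^sub>2\<close>, shifted by \<open>p\<close>; the left nodes contribute \<open>f 0 = 0\<close>.
\<close>

lemma sum_right_nodes:
  fixes f :: "nat \<Rightarrow> real"
  assumes "f 0 = 0"
  shows "(\<Sum>v\<in>{1..p + r} - S. f (v - p)) = (\<Sum>q\<in>{q \<in> {1..r}. p + q \<notin> S}. f q)"
proof -
  let ?D = "{q \<in> {1..r}. p + q \<notin> S}"
  have "(\<Sum>q\<in>?D. f q) = (\<Sum>v\<in>(+) p ` ?D. f (v - p))"
    by (simp add: sum.reindex)
  also have "\<dots> = (\<Sum>v\<in>{1..p + r} - S. f (v - p))"
  proof (rule sum.mono_neutral_left)
    show "\<forall>v\<in>{1..p + r} - S - (+) p ` ?D. f (v - p) = 0"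
    proof
      fix v assume v: "v \<in> {1..p + r} - S - (+) p ` ?D"
      have "v \<le> p"
      proof (rule ccontr)
        assume "\<not> v \<le> p"
        then have "v = p + (v - p)" "v - p \<in> ?D" using v by auto
        then have "v \<in> (+) p ` ?D" by (rule image_eqI)
        then show False using v by blast
      qed
      then show "f (v - p) = 0" using assms by simp
    qed
  qed auto
  finally show ?thesis by simp
qed

lemma sum_left_nodes:
  fixes f :: "nat \<Rightarrow> real"
  assumes "finite S" "\<And>u. u \<notin> {1..p} \<Longrightarrow> f u = 0"
  shows "(\<Sum>u\<in>S. f u) = (\<Sum>u\<in>S \<inter> {1..p}. f u)"
  by (rule sum.mono_neutral_right) (use assms in auto)

locale separation_instance =
  fixes n :: nat and d :: "nat \<Rightarrow> nat" and X :: matrices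
  assumes input: "(n, d, X) \<in> sep_inputs"
begin

definition loaded :: "state \<Rightarrow> bool" where
  "loaded s \<longleftrightarrow> nmem s ''n'' = nmem (sep_load (n, d, X)) ''n'' \<and>
     nmem s ''d'' = nmem (sep_load (n, d, X)) ''d'' \<and> rmem s ''X'' = rmem (sep_load (n, d, X)) ''X''"

definition fresh :: "state \<Rightarrow> bool" where
  "fresh s \<longleftrightarrow> nmem s ''type'' [] = 0 \<and> (\<forall>x. nmem s ''D1'' [x] = 0 \<and> nmem s ''D2'' [x] = 0)"

definition found :: "state \<Rightarrow> bool" where
  "found s \<longleftrightarrow> nmem s ''type'' [] \<noteq> 0 \<and>
     (\<exists>c. sep_output s = Some c \<and> is_cons_ineq n d c \<and> 1 < cons_lhs X c)"

definition sound :: "state \<Rightarrow> bool" where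
  "sound s \<longleftrightarrow> fresh s \<or> found s"

text \<open>
  Programs only add information: \<open>p\<close> keeps the memory sound, and if nothing has been reported at the end,
  then nothing had been reported before and \<open>D\<close> holds. In the use below, \<open>D\<close> says that the inequalities
  treated by \<open>p\<close> are satisfied. This form makes loops and sequences compose.
\<close>

definition settles :: "state \<Rightarrow> prog \<Rightarrow> bool \<Rightarrow> bool" where
  "settles s p D \<longleftrightarrow> (sound s \<longrightarrow> sound (sem p s) \<and>
     (nmem (sem p s) ''type'' [] = 0 \<longrightarrow> nmem s ''type'' [] = 0 \<and> D))"

lemma output_same:
  assumes "same_except W s t" "W \<inter> output_names = {}"
  shows "sound t = sound s" "nmem t ''type'' = nmem s ''type''"
proof -
  have "nmem t x = nmem s x" if "x \<in> output_names" for x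
    using assms that by (auto simp: same_except_def)
  then have eq: "nmem t ''type'' = nmem s ''type''" "nmem t ''i'' = nmem s ''i''" "nmem t ''j'' = nmem s ''j''"
      "nmem t ''k'' = nmem s ''k''" "nmem t ''l'' = nmem s ''l''" "nmem t ''D1'' = nmem s ''D1''"
      "nmem t ''D2'' = nmem s ''D2''"
    by (simp_all add: output_names_def)
  then show "sound t = sound s" "nmem t ''type'' = nmem s ''type''"
    by (simp_all add: sound_def fresh_def found_def sep_output_def)
qed

lemma settles_For:
  assumes "\<And>m t. 1 \<le> m \<Longrightarrow> m \<le> nval s e \<Longrightarrow> same_except (insert x (writes p)) s t \<Longrightarrow>
      nmem t x [] = m \<Longrightarrow> settles t p (D m)"
    and "x \<notin> output_names"
  shows "settles s (PFor x e p) (\<forall>m. 1 \<le> m \<longrightarrow> m \<le> nval s e \<longrightarrow> D m)"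
proof -
  let ?I = "\<lambda>k t. sound s \<longrightarrow> sound t \<and> (nmem t ''type'' [] = 0 \<longrightarrow> nmem s ''type'' [] = 0 \<and>
    (\<forall>m. 1 \<le> m \<longrightarrow> m \<le> k \<longrightarrow> D m))"
  have "?I (nval s e) (sem (PFor x e p) s)"
  proof (rule sem_For_invariant[where I = ?I])
    fix m t
    assume m: "1 \<le> m" "m \<le> nval s e" "same_except (insert x (writes p)) s t" "nmem t x [] = m"
      and I: "?I (m - 1) t"
    have "settles t p (D m)" by (rule assms(1)[OF m])
    moreover have "k \<le> m \<longleftrightarrow> k = m \<or> k \<le> m - 1" for k using m(1) by auto
    ultimately show "?I m (sem p t)" using I by (auto simp: settles_def)
  next
    fix m k t
    assume "?I m t"
    then show "?I m (nwrite x [] k t)"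
      using output_same[OF same_except_nwrite[of x "{x}" t "[]" k]] assms(2) by simp
  qed simp
  then show ?thesis by (simp add: settles_def)
qed

lemma settles_Seq:
  "settles s p C \<Longrightarrow> settles (sem p s) q D \<Longrightarrow> settles s (PSeq p q) (C \<and> D)"
  by (auto simp: settles_def)

lemma settles_prefix:
  assumes "writes p \<inter> output_names = {}" "settles (sem p s) q D"
  shows "settles s (PSeq p q) D"
  using assms(2) output_same[OF sem_same_except assms(1), of s] by (simp add: settles_def)

lemma settles_weaken: "settles s p C \<Longrightarrow> (C \<Longrightarrow> D) \<Longrightarrow> settles s p D"
  by (auto simp: settles_def)

definition sym_entry :: "nat \<Rightarrow> nat \<Rightarrow> nat \<Rightarrow> nat \<Rightarrow> real" where
  "sym_entry i j t q = entry_at (sep_load (n, d, X)) i j t q"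

lemma sym_entry_less:
  assumes "1 \<le> i" "i < j" "j \<le> n" "t \<in> {1..d i}" "q \<in> {1..d j}"
  shows "sym_entry i j t q = X i j t q" "sym_entry j i q t = X i j t q"
  using assms by (auto simp: sym_entry_def entry_at_def)

lemma sym_entry_outside: "t \<notin> {1..d i} \<or> q \<notin> {1..d j} \<Longrightarrow> sym_entry i j t q = 0"
  by (auto simp: sym_entry_def entry_at_def)

lemma sym_entry_nonneg: "0 \<le> sym_entry i j t q"
proof -
  have "0 \<le> rmem (sep_load (n, d, X)) ''X'' [i, j, t, q]" for i j t q
    using input by (auto simp: sep_inputs_def)
  then show ?thesis unfolding sym_entry_def entry_at_def by (intro add_nonneg_nonneg)
qed

lemma sym_entry_sum_le_1:
  assumes "i \<in> {1..n}" "j \<in> {1..n}" "i \<noteq> j" "q \<in> {1..d j}" "T \<subseteq> {1..d i}"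
  shows "(\<Sum>t\<in>T. sym_entry i j t q) \<le> 1"
proof -
  have "(\<Sum>t\<in>T. sym_entry i j t q) \<le> (\<Sum>t\<in>{1..d i}. sym_entry i j t q)"
    using assms(5) by (intro sum_mono2) (auto simp: sym_entry_nonneg)
  also have "\<dots> \<le> 1"
  proof (cases "i < j")
    case True
    have "(\<Sum>t\<in>{1..d i}. sym_entry i j t q) = (\<Sum>t\<in>{1..d i}. X i j t q)"
      using assms True by (intro sum.cong sym_entry_less(1)) auto
    then show ?thesis using input assms True by (auto simp: sep_inputs_def)
  next
    case False
    have "(\<Sum>t\<in>{1..d i}. sym_entry i j t q) = (\<Sum>t\<in>{1..d i}. X j i q t)"
      using assms False by (intro sum.cong sym_entry_less(2)) auto
    then show ?thesis using input assms False by (auto simp: sep_inputs_def)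
  qed
  finally show ?thesis .
qed

text \<open>
  In terms of the symmetrized entries the three families have the same form.
\<close>

lemma cons_lhs_cons_of:
  assumes "role ty i j k x y z" "1 \<le> i" "i < j" "j < k" "k \<le> n"
    "D1 \<subseteq> {1..d x}" "D2 \<subseteq> {1..d y}" "l \<in> {1..d z}"
  shows "cons_lhs X (cons_of ty i j k D1 D2 l) =
    (\<Sum>t\<in>D1. sym_entry x z t l) + (\<Sum>q\<in>D2. sym_entry y z q l) - (\<Sum>t\<in>D1. \<Sum>q\<in>D2. sym_entry x y t q)"
proof -
  have less: "(\<Sum>t\<in>T. sym_entry u v t w) = (\<Sum>t\<in>T. X u v t w)"
    if "1 \<le> u" "u < v" "v \<le> n" "T \<subseteq> {1..d u}" "w \<in> {1..d v}" for u v w T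
    using that by (intro sum.cong sym_entry_less(1)) auto
  have greater: "(\<Sum>t\<in>T. sym_entry u v t w) = (\<Sum>t\<in>T. X v u w t)"
    if "1 \<le> v" "v < u" "u \<le> n" "T \<subseteq> {1..d u}" "w \<in> {1..d v}" for u v w T
    using that by (intro sum.cong sym_entry_less(2)) auto
  have rect: "(\<Sum>t\<in>T. \<Sum>w\<in>W. sym_entry u v t w) = (\<Sum>t\<in>T. \<Sum>w\<in>W. X u v t w)"
    if "1 \<le> u" "u < v" "v \<le> n" "T \<subseteq> {1..d u}" "W \<subseteq> {1..d v}" for u v W T
    using that by (intro sum.cong sym_entry_less(1)) auto
  consider "ty = 1" "x = i" "y = j" "z = k" | "ty = 2" "x = j" "y = k" "z = i" | "ty = 3" "x = i" "y = k" "z = j"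
    using assms(1) by (auto simp: role_def)
  then show ?thesis
  proof cases
    case 1
    then show ?thesis
      using assms(2-) less[of i k D1 l] less[of j k D2 l] rect[of i j D1 D2] by (simp add: cons_of_def)
  next
    case 2
    then show ?thesis
      using assms(2-) greater[of i j D1 l] greater[of i k D2 l] rect[of j k D1 D2] by (simp add: cons_of_def)
  next
    case 3
    then show ?thesis
      using assms(2-) less[of i j D1 l] greater[of j k D2 l] rect[of i k D1 D2] by (simp add: cons_of_def)
  qed
qed

text \<open>
  If \<open>D\<^sub>1\<close> or \<open>D\<^sub>2\<close> is empty, the left-hand side is a partial row or column sum.
\<close>

lemma violated_is_cons_ineq:
  assumes "role ty i j k x y z" "1 \<le> i" "i < j" "j < k" "k \<le> n"
    "D1 \<subseteq> {1..d x}" "D2 \<subseteq> {1..d y}" "l \<in> {1..d z}" "1 < cons_lhs X (cons_of ty i j k D1 D2 l)"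
  shows "is_cons_ineq n d (cons_of ty i j k D1 D2 l)"
proof -
  have range: "x \<in> {1..n}" "y \<in> {1..n}" "z \<in> {1..n}" "x \<noteq> z" "y \<noteq> z"
    using assms(1-5) by (auto simp: role_def)
  have "D1 \<noteq> {}"
  proof
    assume "D1 = {}"
    then have "cons_lhs X (cons_of ty i j k D1 D2 l) \<le> 1"
      unfolding cons_lhs_cons_of[OF assms(1-8)]
      using sym_entry_sum_le_1[OF range(2,3,5) assms(8,7)] by simp
    then show False using assms(9) by simp
  qed
  moreover have "D2 \<noteq> {}"
  proof
    assume "D2 = {}"
    then have "cons_lhs X (cons_of ty i j k D1 D2 l) \<le> 1"
      unfolding cons_lhs_cons_of[OF assms(1-8)]
      using sym_entry_sum_le_1[OF range(1,3,4) assms(8,6)] by simp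
    then show False using assms(9) by simp
  qed
  ultimately show ?thesis
    using assms(1-8) by (auto simp: role_def cons_of_def)
qed

text \<open>
  The situation in which \<open>cut_prog\<close> is started: the roles belong to a triple \<open>a < b < c\<close> and
  the family \<open>ty\<close>.
\<close>

definition positioned :: "state \<Rightarrow> bool" where
  "positioned s \<longleftrightarrow> loaded s \<and>
     role (nmem s ''ty'' []) (nmem s ''a'' []) (nmem s ''b'' []) (nmem s ''c'' [])
       (nmem s ''x'' []) (nmem s ''y'' []) (nmem s ''z'' []) \<and>
     1 \<le> nmem s ''a'' [] \<and> nmem s ''a'' [] < nmem s ''b'' [] \<and> nmem s ''b'' [] < nmem s ''c'' [] \<and>
     nmem s ''c'' [] \<le> n \<and> nmem s ''m'' [] \<in> {1..d (nmem s ''z'' [])}"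

definition current :: "state \<Rightarrow> nat set \<Rightarrow> nat set \<Rightarrow> cons_ineq" where
  "current s D1 D2 = cons_of (nmem s ''ty'' []) (nmem s ''a'' []) (nmem s ''b'' []) (nmem s ''c'' [])
     D1 D2 (nmem s ''m'' [])"

definition position_names :: "string set" where
  "position_names = {''n'', ''d'', ''X'', ''ty'', ''a'', ''b'', ''c'', ''x'', ''y'', ''z'', ''m''}"

lemma positioned_same:
  assumes "same_except W s t" "W \<inter> position_names = {}"
  shows "positioned t = positioned s" "current t = current s"
    "lefts t = lefts s" "rights t = rights s" "nodes t = nodes s" "cut_value t = cut_value s"
proof -
  have "nmem t x = nmem s x \<and> rmem t x = rmem s x" if "x \<in> position_names" for x
    using assms that by (auto simp: same_except_def)
  then have eq: "nmem t ''n'' = nmem s ''n''" "nmem t ''d'' = nmem s ''d''" "rmem t ''X'' = rmem s ''X''"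
      "nmem t ''ty'' = nmem s ''ty''" "nmem t ''a'' = nmem s ''a''" "nmem t ''b'' = nmem s ''b''"
      "nmem t ''c'' = nmem s ''c''" "nmem t ''x'' = nmem s ''x''" "nmem t ''y'' = nmem s ''y''"
      "nmem t ''z'' = nmem s ''z''" "nmem t ''m'' = nmem s ''m''"
    by (simp_all add: position_names_def)
  then show "positioned t = positioned s" "current t = current s" "rights t = rights s"
    by (simp_all add: positioned_def loaded_def current_def rights_def fun_eq_iff)
  have "W \<inter> env_names = {}"
    using assms(2) by (auto simp: position_names_def env_names_def)
  note env = same_env[OF assms(1) this]
  then show "lefts t = lefts s" "nodes t = nodes s" "cut_value t = cut_value s"
    by (simp_all add: fun_eq_iff cut_value_def)
qed

lemma positioned_sizes:
  assumes "positioned s"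
  shows "lefts s = d (nmem s ''x'' [])" "rights s = d (nmem s ''y'' [])"
  using assms by (auto simp: positioned_def loaded_def lefts_def rights_def role_def)

text \<open>
  A node set encodes \<open>D\<^sub>1\<close> by the left nodes that it contains and \<open>D\<^sub>2\<close> by the right nodes that it
  misses. Only arcs from left to right have positive capacity, so the arcs leaving it are the pairs in
  \<open>D\<^sub>1 \<times> D\<^sub>2\<close>.
\<close>

lemma positioned_cut_value:
  assumes "positioned s" "S \<subseteq> {1..nodes s}"
  shows "cut_value s S = cons_lhs X (current s (S \<inter> {1..lefts s}) {q \<in> {1..rights s}. lefts s + q \<notin> S})"
proof -
  define x y z l where "x = nmem s ''x'' []" and "y = nmem s ''y'' []" and "z = nmem s ''z'' []"
    and "l = nmem s ''m'' []"
  note names = x_def y_def z_def l_def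
  let ?D1 = "S \<inter> {1..lefts s}" and ?D2 = "{q \<in> {1..rights s}. lefts s + q \<notin> S}"
  have size: "lefts s = d x" "rights s = d y"
    using positioned_sizes[OF assms(1)] by (simp_all add: names)
  have entry: "entry_at s = sym_entry"
    using assms(1) by (auto simp: positioned_def loaded_def sym_entry_def entry_at_def fun_eq_iff)
  have fin: "finite S" using assms(2) finite_subset by blast
  have lhs: "cons_lhs X (current s ?D1 ?D2) =
      (\<Sum>t\<in>?D1. sym_entry x z t l) + (\<Sum>q\<in>?D2. sym_entry y z q l) - (\<Sum>t\<in>?D1. \<Sum>q\<in>?D2. sym_entry x y t q)"
    unfolding current_def names
    by (rule cons_lhs_cons_of)
      (use assms(1) positioned_sizes[OF assms(1)] in \<open>auto simp: positioned_def\<close>)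
  have "(\<Sum>u\<in>S. inside s u) = (\<Sum>t\<in>?D1. sym_entry x z t l)"
    unfolding inside_def entry names[symmetric] by (rule sum_left_nodes[OF fin]) (simp add: sym_entry_outside size)
  moreover have "(\<Sum>u\<in>{1..nodes s} - S. outside s u) = (\<Sum>q\<in>?D2. sym_entry y z q l)"
    unfolding outside_def entry names[symmetric] nodes_def by (rule sum_right_nodes) (simp add: sym_entry_outside)
  moreover have "(\<Sum>v\<in>{1..nodes s} - S. crossing s (u, v)) = (\<Sum>q\<in>?D2. sym_entry x y u q)" for u
    unfolding crossing_def entry names[symmetric] nodes_def prod.case
    by (rule sum_right_nodes) (simp add: sym_entry_outside)
  moreover have "(\<Sum>u\<in>S. \<Sum>q\<in>?D2. sym_entry x y u q) = (\<Sum>t\<in>?D1. \<Sum>q\<in>?D2. sym_entry x y t q)"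
    by (rule sum_left_nodes[OF fin]) (simp add: sym_entry_outside size)
  ultimately show ?thesis
    unfolding lhs cut_value_def by simp
qed

text \<open>
  A report is verified directly, since the program has computed the left-hand side of the
  reported inequality. So soundness rests on \<open>value_prog_correct\<close> and
  \<open>report_prog_correct\<close>.
\<close>

lemma settles_check_prog:
  assumes "positioned s"
  shows "settles s check_prog (\<forall>g. 1 \<le> g \<longrightarrow> g \<le> Suc (nodes s) \<longrightarrow> cut_value s (upper_level s g) \<le> 1)"
proof -
  let ?report = "PIf (BAnd (NLess (NVar ''type'') (NConst 1)) (RLess (RConst 1) Val)) report_prog PSkip"
  let ?body = "PSeq value_prog ?report"
  have disj: "insert ''g'' (writes ?body) \<inter> position_names = {}"
    by (simp add: value_prog_def report_prog_def position_names_def)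
  have "settles s (PFor ''g'' (NAdd node_count (NConst 1)) ?body)
      (\<forall>g. 1 \<le> g \<longrightarrow> g \<le> nval s (NAdd node_count (NConst 1)) \<longrightarrow> cut_value s (upper_level s g) \<le> 1)"
  proof (rule settles_For)
    fix g t
    assume t: "same_except (insert ''g'' (writes ?body)) s t" "nmem t ''g'' [] = g"
    note pos = positioned_same[OF t(1) disj]
    have "nmem t ''h'' = nmem s ''h''"
      using same_cell(1)[OF t(1), of "''h''"] by (simp add: value_prog_def report_prog_def)
    then have upper: "upper_level t g = upper_level s g"
      by (simp add: upper_level_def pos)
    define t1 where "t1 = sem value_prog t"
    have same1: "same_except (writes value_prog) t t1"
      unfolding t1_def by (rule sem_same_except)
    have disj1: "writes value_prog \<inter> position_names = {}"
      by (simp add: value_prog_def position_names_def)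
    note pos1 = positioned_same[OF same1 disj1]
    have mem1: "nmem t1 ''h'' = nmem s ''h''" "nmem t1 ''g'' [] = g"
      using same_cell(1)[OF same1, of "''h''"] same_cell(1)[OF same1, of "''g''"] t(2) \<open>nmem t ''h'' = nmem s ''h''\<close>
      by (simp_all add: value_prog_def)
    have upper1: "upper_level t1 g = upper_level s g"
      by (simp add: upper_level_def pos pos1 mem1)
    have val: "rmem t1 ''val'' [] = cut_value s (upper_level s g)"
      unfolding t1_def value_prog_correct by (simp add: t(2) upper pos)
    have p1: "positioned t1" using assms pos pos1 by simp
    have "settles t1 ?report (cut_value s (upper_level s g) \<le> 1)"
    proof (cases "nmem t1 ''type'' [] = 0 \<and> 1 < cut_value s (upper_level s g)")
      case True
      let ?S = "upper_level s g"
      let ?D1 = "?S \<inter> {1..lefts t1}" and ?D2 = "{q \<in> {1..rights t1}. lefts t1 + q \<notin> ?S}"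
      have sem: "sem ?report t1 = sem report_prog t1"
        using True val by (simp add: of_rat_1)
      have "found (sem report_prog t1)" if "sound t1"
      proof -
        have zero: "nmem t1 ''D1'' [x] = 0" "nmem t1 ''D2'' [x] = 0" for x
          using that True by (auto simp: sound_def fresh_def found_def)
        note rep = report_prog_correct[OF zero, unfolded mem1 upper1]
        have ty: "nmem t1 ''ty'' [] \<in> {1, 2, 3}"
          using p1 by (auto simp: positioned_def role_def)
        have out: "sep_output (sem report_prog t1) = Some (current t1 ?D1 ?D2)"
          unfolding sep_output_def Let_def rep current_def cons_of_def using ty by auto
        have "cut_value t1 ?S = cons_lhs X (current t1 ?D1 ?D2)"
          by (rule positioned_cut_value[OF p1]) (auto simp: upper_level_def pos pos1)
        then have viol: "1 < cons_lhs X (current t1 ?D1 ?D2)"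
          using True pos pos1 by simp
        moreover have "is_cons_ineq n d (current t1 ?D1 ?D2)"
          unfolding current_def
          by (rule violated_is_cons_ineq[OF _ _ _ _ _ _ _ _ viol[unfolded current_def]])
            (use p1 positioned_sizes[OF p1] in \<open>auto simp: positioned_def\<close>)
        ultimately show ?thesis
          unfolding found_def using out ty rep(1) by auto
      qed
      then show ?thesis
        unfolding settles_def sem by (auto simp: sound_def found_def)
    next
      case False
      then have "sem ?report t1 = t1"
        using val by (auto simp: of_rat_1)
      then show ?thesis using False by (auto simp: settles_def)
    qed
    then show "settles t ?body (cut_value s (upper_level s g) \<le> 1)"
      unfolding t1_def by (rule settles_prefix[rotated]) (simp add: value_prog_def output_names_def)
  qed (simp add: output_names_def)
  then show ?thesis by (simp add: check_prog_def)
qed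

text \<open>
  Completeness: every pair \<open>(D\<^sub>1, D\<^sub>2)\<close> comes from a node set, and the value of any node set is at
  most that of some upper level, which has been compared with 1.
\<close>

lemma settles_cut_prog:
  assumes "positioned s"
  shows "settles s cut_prog (\<forall>D1 D2. D1 \<subseteq> {1..d (nmem s ''x'' [])} \<longrightarrow> D2 \<subseteq> {1..d (nmem s ''y'' [])} \<longrightarrow>
    cons_lhs X (current s D1 D2) \<le> 1)"
proof -
  define t where "t = sem rounds_prog (sem setup_prog s)"
  have same: "same_except (writes (PSeq setup_prog rounds_prog)) s t"
    using sem_same_except[of "PSeq setup_prog rounds_prog" s] by (simp add: t_def)
  have disj: "writes (PSeq setup_prog rounds_prog) \<inter> position_names = {}"
    by (simp add: setup_prog_def rounds_prog_def Let_def pass_prog_def discharge_prog_def push_prog_def position_names_def)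
  note pos = positioned_same[OF same disj]
  have "0 \<le> crossing s (u, v)" for u v
    using assms sym_entry_nonneg by (auto simp: crossing_def positioned_def loaded_def sym_entry_def entry_at_def)
  then obtain g where g: "1 \<le> g" "g \<le> Suc (nodes s)"
      "\<And>S. S \<subseteq> {1..nodes s} \<Longrightarrow> cut_value s S \<le> cut_value s (upper_level t g)"
    using rounds_find_optimal_cut[of s] unfolding t_def by (auto simp del: sem.simps)
  have "settles t check_prog (\<forall>D1 D2. D1 \<subseteq> {1..d (nmem s ''x'' [])} \<longrightarrow> D2 \<subseteq> {1..d (nmem s ''y'' [])} \<longrightarrow>
    cons_lhs X (current s D1 D2) \<le> 1)"
  proof (rule settles_weaken[OF settles_check_prog])
    show "positioned t" using assms pos by simp
    assume "\<forall>g. 1 \<le> g \<longrightarrow> g \<le> Suc (nodes t) \<longrightarrow> cut_value t (upper_level t g) \<le> 1"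
    then have all: "cut_value s S \<le> 1" if "S \<subseteq> {1..nodes s}" for S
      using g pos that by (metis order_trans)
    show "\<forall>D1 D2. D1 \<subseteq> {1..d (nmem s ''x'' [])} \<longrightarrow> D2 \<subseteq> {1..d (nmem s ''y'' [])} \<longrightarrow>
      cons_lhs X (current s D1 D2) \<le> 1"
    proof (intro allI impI)
      fix D1 D2
      assume D: "D1 \<subseteq> {1..d (nmem s ''x'' [])}" "D2 \<subseteq> {1..d (nmem s ''y'' [])}"
      \<comment> \<open>\<open>D2\<close> consists of the right nodes outside the cut set, shifted down by \<open>lefts s\<close>.\<close>
      let ?S = "D1 \<union> {v. lefts s < v \<and> v \<le> nodes s \<and> v - lefts s \<notin> D2}"
      note size = positioned_sizes[OF assms]
      have S: "?S \<subseteq> {1..nodes s}" using D size by (auto simp: nodes_def)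
      have "?S \<inter> {1..lefts s} = D1" using D size by auto
      moreover have "{q \<in> {1..rights s}. lefts s + q \<notin> ?S} = D2"
      proof -
        have "lefts s + q \<notin> D1" if "1 \<le> q" for q
        proof
          assume "lefts s + q \<in> D1"
          then have "lefts s + q \<in> {1..lefts s}" using D(1) size(1) by auto
          then show False using that by simp
        qed
        moreover have "1 \<le> q \<and> q \<le> rights s" if "q \<in> D2" for q
          using D(2) size(2) that by auto
        ultimately show ?thesis by (auto simp: nodes_def)
      qed
      ultimately have "cons_lhs X (current s D1 D2) = cut_value s ?S"
        using positioned_cut_value[OF assms S] by simp
      then show "cons_lhs X (current s D1 D2) \<le> 1" using all[OF S] by simp
    qed
  qed
  then show ?thesis
    unfolding cut_prog_def t_def
    by (intro settles_prefix)
      (simp_all add: setup_prog_def rounds_prog_def Let_def pass_prog_def discharge_prog_def push_prog_def output_names_def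
        del: sem.simps)
qed

lemma writes_cut_prog:
  "writes cut_prog \<inter> (position_names \<union> {''n'', ''d'', ''X'', ''a'', ''b'', ''c'', ''x'', ''y'', ''z'', ''ty''}) = {}"
  by (simp add: prog_defs position_names_def)

definition satisfied :: "nat \<Rightarrow> nat \<Rightarrow> nat \<Rightarrow> nat \<Rightarrow> nat \<Rightarrow> nat \<Rightarrow> nat \<Rightarrow> bool" where
  "satisfied ty i j k x y z \<longleftrightarrow> (\<forall>l D1 D2. 1 \<le> l \<longrightarrow> l \<le> d z \<longrightarrow> D1 \<subseteq> {1..d x} \<longrightarrow> D2 \<subseteq> {1..d y} \<longrightarrow>
     cons_lhs X (cons_of ty i j k D1 D2 l) \<le> 1)"

lemma settles_role_prog:
  assumes "loaded s" "{x, y, z} \<subseteq> {''a'', ''b'', ''c''}"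
    "nmem s ''a'' [] = i" "nmem s ''b'' [] = j" "nmem s ''c'' [] = k" "1 \<le> i" "i < j" "j < k" "k \<le> n"
    "role ty i j k (nmem s x []) (nmem s y []) (nmem s z [])"
  shows "settles s (role_prog ty x y z) (satisfied ty i j k (nmem s x []) (nmem s y []) (nmem s z []))"
proof -
  define s1 where "s1 = nwrite ''z'' [] (nmem s z []) (nwrite ''y'' [] (nmem s y [])
    (nwrite ''x'' [] (nmem s x []) (nwrite ''ty'' [] ty s)))"
  have ne: "w \<noteq> ''ty'' \<and> w \<noteq> ''x'' \<and> w \<noteq> ''y'' \<and> w \<noteq> ''z''" if "w \<in> {x, y, z}" for w
    using assms(2) that by auto
  have mem1: "nmem s1 ''ty'' [] = ty" "nmem s1 ''x'' [] = nmem s x []" "nmem s1 ''y'' [] = nmem s y []"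
      "nmem s1 ''z'' [] = nmem s z []" "nmem s1 ''a'' [] = i" "nmem s1 ''b'' [] = j" "nmem s1 ''c'' [] = k"
    using assms(3-5) by (simp_all add: s1_def)
  have load1: "loaded s1" using assms(1) by (simp add: loaded_def s1_def)
  have "nmem s z [] \<in> {1..n}"
    using assms(6-10) by (auto simp: role_def)
  then have dz: "nval s1 (NArr ''d'' [NVar ''z'']) = d (nmem s z [])"
    using load1 by (simp add: mem1 loaded_def)
  have "settles s1 (PFor ''m'' (NArr ''d'' [NVar ''z'']) cut_prog)
     (\<forall>l. 1 \<le> l \<longrightarrow> l \<le> nval s1 (NArr ''d'' [NVar ''z'']) \<longrightarrow>
       (\<forall>D1 D2. D1 \<subseteq> {1..d (nmem s x [])} \<longrightarrow> D2 \<subseteq> {1..d (nmem s y [])} \<longrightarrow>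
         cons_lhs X (cons_of ty i j k D1 D2 l) \<le> 1))"
  proof (rule settles_For)
    fix l t
    assume l: "1 \<le> l" "l \<le> nval s1 (NArr ''d'' [NVar ''z''])"
      and t: "same_except (insert ''m'' (writes cut_prog)) s1 t" "nmem t ''m'' [] = l"
    have keep: "nmem t w = nmem s1 w \<and> rmem t w = rmem s1 w"
      if "w \<in> {''n'', ''d'', ''X'', ''a'', ''b'', ''c'', ''x'', ''y'', ''z'', ''ty''}" for w
      using same_cell[OF t(1), of w] writes_cut_prog that by auto
    then have mem: "nmem t ''ty'' = nmem s1 ''ty''" "nmem t ''x'' = nmem s1 ''x''" "nmem t ''y'' = nmem s1 ''y''"
      "nmem t ''z'' = nmem s1 ''z''" "nmem t ''a'' = nmem s1 ''a''" "nmem t ''b'' = nmem s1 ''b''"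
      "nmem t ''c'' = nmem s1 ''c''" "nmem t ''n'' = nmem s1 ''n''" "nmem t ''d'' = nmem s1 ''d''"
      "rmem t ''X'' = rmem s1 ''X''"
      by simp_all
    have "positioned t"
      using load1 assms(6-10) l t(2) dz unfolding positioned_def loaded_def mem mem1 by auto
    from settles_cut_prog[OF this]
    show "settles t cut_prog (\<forall>D1 D2. D1 \<subseteq> {1..d (nmem s x [])} \<longrightarrow> D2 \<subseteq> {1..d (nmem s y [])} \<longrightarrow>
         cons_lhs X (cons_of ty i j k D1 D2 l) \<le> 1)"
      unfolding current_def mem mem1 t(2) .
  qed (simp add: output_names_def)
  then have main: "settles s1 (PFor ''m'' (NArr ''d'' [NVar ''z'']) cut_prog)
      (satisfied ty i j k (nmem s x []) (nmem s y []) (nmem s z []))"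
    unfolding dz satisfied_def by (rule settles_weaken) blast
  have s1: "s1 = sem (PNat ''z'' [] (NVar z)) (sem (PNat ''y'' [] (NVar y))
      (sem (PNat ''x'' [] (NVar x)) (sem (PNat ''ty'' [] (NConst ty)) s)))"
    using ne by (simp add: s1_def)
  show ?thesis
    unfolding role_prog_def
    by (intro settles_prefix main[unfolded s1]) (simp_all add: output_names_def)
qed

lemma loaded_same:
  assumes "same_except W s t" "W \<inter> {''n'', ''d'', ''X''} = {}" "loaded s"
  shows "loaded t"
  using assms same_cell[OF assms(1), of "''n''"] same_cell[OF assms(1), of "''d''"] same_cell[OF assms(1), of "''X''"]
  by (auto simp: loaded_def)

lemma settles_triple:
  assumes "loaded s" "nmem s ''a'' [] = i" "nmem s ''b'' [] = j" "nmem s ''c'' [] = k" "1 \<le> i" "k \<le> n"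
  shows "settles s (PIf (BAnd (NLess (NVar ''a'') (NVar ''b'')) (NLess (NVar ''b'') (NVar ''c'')))
       (PSeq (role_prog 1 ''a'' ''b'' ''c'') (PSeq (role_prog 2 ''b'' ''c'' ''a'') (role_prog 3 ''a'' ''c'' ''b'')))
       PSkip)
     (i < j \<longrightarrow> j < k \<longrightarrow> satisfied 1 i j k i j k \<and> satisfied 2 i j k j k i \<and> satisfied 3 i j k i k j)"
proof (cases "i < j \<and> j < k")
  case True
  have keep: "loaded (sem (role_prog ty x y z) t)" "nmem (sem (role_prog ty x y z) t) ''a'' [] = nmem t ''a'' []"
      "nmem (sem (role_prog ty x y z) t) ''b'' [] = nmem t ''b'' []"
      "nmem (sem (role_prog ty x y z) t) ''c'' [] = nmem t ''c'' []" if "loaded t" for ty x y z t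
  proof -
    note same = sem_same_except[of "role_prog ty x y z" t]
    have W: "writes (role_prog ty x y z) \<inter> {''n'', ''d'', ''X'', ''a'', ''b'', ''c''} = {}"
      using writes_cut_prog by (auto simp: role_prog_def)
    show "loaded (sem (role_prog ty x y z) t)"
      by (rule loaded_same[OF same _ that]) (use W in auto)
    show "nmem (sem (role_prog ty x y z) t) ''a'' [] = nmem t ''a'' []"
      "nmem (sem (role_prog ty x y z) t) ''b'' [] = nmem t ''b'' []"
      "nmem (sem (role_prog ty x y z) t) ''c'' [] = nmem t ''c'' []"
      using same_cell(1)[OF same, of "''a''"] same_cell(1)[OF same, of "''b''"] same_cell(1)[OF same, of "''c''"] W
      by auto
  qed
  define s1 where "s1 = sem (role_prog 1 ''a'' ''b'' ''c'') s"
  define s2 where "s2 = sem (role_prog 2 ''b'' ''c'' ''a'') s1"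
  have s1: "loaded s1" "nmem s1 ''a'' [] = i" "nmem s1 ''b'' [] = j" "nmem s1 ''c'' [] = k"
    unfolding s1_def using keep[OF assms(1)] assms by auto
  have s2: "loaded s2" "nmem s2 ''a'' [] = i" "nmem s2 ''b'' [] = j" "nmem s2 ''c'' [] = k"
    unfolding s2_def using keep[OF s1(1)] s1 by auto
  have 1: "settles s (role_prog 1 ''a'' ''b'' ''c'') (satisfied 1 i j k i j k)"
    using settles_role_prog[of s "''a''" "''b''" "''c''" i j k 1] assms True by (simp add: role_def)
  have 2: "settles s1 (role_prog 2 ''b'' ''c'' ''a'') (satisfied 2 i j k j k i)"
    using settles_role_prog[of s1 "''b''" "''c''" "''a''" i j k 2] s1 assms True by (simp add: role_def)
  have 3: "settles s2 (role_prog 3 ''a'' ''c'' ''b'') (satisfied 3 i j k i k j)"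
    using settles_role_prog[of s2 "''a''" "''c''" "''b''" i j k 3] s2 assms True by (simp add: role_def)
  have "settles s (PSeq (role_prog 1 ''a'' ''b'' ''c'') (PSeq (role_prog 2 ''b'' ''c'' ''a'') (role_prog 3 ''a'' ''c'' ''b'')))
      (satisfied 1 i j k i j k \<and> satisfied 2 i j k j k i \<and> satisfied 3 i j k i k j)"
    by (intro settles_Seq 1 2[unfolded s1_def] 3[unfolded s1_def s2_def])
  then show ?thesis
    using True assms(2-4) by (auto simp: settles_def simp del: sem.simps(4))
next
  case False
  then show ?thesis using assms(2-4) by (auto simp: settles_def)
qed

lemma settles_separation_prog:
  assumes "loaded s"
  shows "settles s separation_prog (\<forall>i j k. 1 \<le> i \<longrightarrow> i < j \<longrightarrow> j < k \<longrightarrow> k \<le> n \<longrightarrow>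
    satisfied 1 i j k i j k \<and> satisfied 2 i j k j k i \<and> satisfied 3 i j k i k j)"
proof -
  let ?c = "PIf (BAnd (NLess (NVar ''a'') (NVar ''b'')) (NLess (NVar ''b'') (NVar ''c'')))
       (PSeq (role_prog 1 ''a'' ''b'' ''c'') (PSeq (role_prog 2 ''b'' ''c'' ''a'') (role_prog 3 ''a'' ''c'' ''b'')))
       PSkip"
  let ?C = "PFor ''c'' (NVar ''n'') ?c"
  let ?B = "PFor ''b'' (NVar ''n'') ?C"
  have W: "writes ?c \<inter> {''n'', ''d'', ''X'', ''a'', ''b'', ''c''} = {}"
    using writes_cut_prog by (auto simp: role_prog_def)
  have n: "nval t (NVar ''n'') = n" if "loaded t" for t
    using that by (simp add: loaded_def)
  let ?D = "\<lambda>i j k. i < j \<longrightarrow> j < k \<longrightarrow> satisfied 1 i j k i j k \<and> satisfied 2 i j k j k i \<and> satisfied 3 i j k i k j"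
  have "settles s (PFor ''a'' (NVar ''n'') ?B) (\<forall>i. 1 \<le> i \<longrightarrow> i \<le> nval s (NVar ''n'') \<longrightarrow>
      (\<forall>j. 1 \<le> j \<longrightarrow> j \<le> n \<longrightarrow> (\<forall>k. 1 \<le> k \<longrightarrow> k \<le> n \<longrightarrow> ?D i j k)))"
  proof (rule settles_For)
    fix i t
    assume i: "1 \<le> i" and t: "same_except (insert ''a'' (writes ?B)) s t" "nmem t ''a'' [] = i"
    have lt: "loaded t" by (rule loaded_same[OF t(1) _ assms]) (use W in auto)
    have "settles t ?B (\<forall>j. 1 \<le> j \<longrightarrow> j \<le> nval t (NVar ''n'') \<longrightarrow> (\<forall>k. 1 \<le> k \<longrightarrow> k \<le> n \<longrightarrow> ?D i j k))"
    proof (rule settles_For)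
      fix j u
      assume u: "same_except (insert ''b'' (writes ?C)) t u" "nmem u ''b'' [] = j"
      have lu: "loaded u" by (rule loaded_same[OF u(1) _ lt]) (use W in auto)
      have ua: "nmem u ''a'' [] = i"
        using same_cell(1)[OF u(1), of "''a''"] W t(2) by auto
      have "settles u ?C (\<forall>k. 1 \<le> k \<longrightarrow> k \<le> nval u (NVar ''n'') \<longrightarrow> ?D i j k)"
      proof (rule settles_For)
        fix k v
        assume k: "k \<le> nval u (NVar ''n'')" and v: "same_except (insert ''c'' (writes ?c)) u v" "nmem v ''c'' [] = k"
        have lv: "loaded v" by (rule loaded_same[OF v(1) _ lu]) (use W in auto)
        have "nmem v ''a'' [] = i" "nmem v ''b'' [] = j"
          using same_cell(1)[OF v(1), of "''a''"] same_cell(1)[OF v(1), of "''b''"] W ua u(2) by auto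
        then show "settles v ?c (?D i j k)"
          using settles_triple[OF lv _ _ v(2)] i k n[OF lu] by simp
      qed (simp add: output_names_def)
      then show "settles u ?C (\<forall>k. 1 \<le> k \<longrightarrow> k \<le> n \<longrightarrow> ?D i j k)"
        unfolding n[OF lu] .
    qed (simp add: output_names_def)
    then show "settles t ?B (\<forall>j. 1 \<le> j \<longrightarrow> j \<le> n \<longrightarrow> (\<forall>k. 1 \<le> k \<longrightarrow> k \<le> n \<longrightarrow> ?D i j k))"
      unfolding n[OF lt] .
  qed (simp add: output_names_def)
  then show ?thesis
    unfolding separation_prog_def n[OF assms] by (rule settles_weaken) force
qed

lemma separation_prog_correct:
  "sep_correct (n, d, X) (sem separation_prog (sep_load (n, d, X)))"
proof -
  let ?s = "sep_load (n, d, X)"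
  let ?t = "sem separation_prog ?s"
  have "loaded ?s" by (simp add: loaded_def)
  moreover have "sound ?s" by (simp add: sound_def fresh_def)
  ultimately have t: "sound ?t" and sat: "nmem ?t ''type'' [] = 0 \<Longrightarrow> \<forall>i j k. 1 \<le> i \<longrightarrow> i < j \<longrightarrow> j < k \<longrightarrow> k \<le> n \<longrightarrow>
    satisfied 1 i j k i j k \<and> satisfied 2 i j k j k i \<and> satisfied 3 i j k i k j"
    using settles_separation_prog[of ?s] unfolding settles_def by blast+
  show ?thesis
  proof (cases "nmem ?t ''type'' [] = 0")
    case True
    have "cons_lhs X c \<le> 1" if c: "is_cons_ineq n d c" for c
    proof (cases c)
      case (Cons1 i j k D1 D2 l)
      then have "satisfied 1 i j k i j k" using sat[OF True] c by auto
      then show ?thesis using Cons1 c by (force simp: satisfied_def cons_of_def)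
    next
      case (Cons2 i j k D1 D2 l)
      then have "satisfied 2 i j k j k i" using sat[OF True] c by auto
      then show ?thesis using Cons2 c by (force simp: satisfied_def cons_of_def)
    next
      case (Cons3 i j k D1 D2 l)
      then have "satisfied 3 i j k i k j" using sat[OF True] c by auto
      then show ?thesis using Cons3 c by (force simp: satisfied_def cons_of_def)
    qed
    moreover have "sep_output ?t = None" using True by (simp add: sep_output_def)
    ultimately show ?thesis by simp
  next
    case False
    then show ?thesis
      using t by (auto simp: sound_def fresh_def found_def simp del: sep_load.simps)
  qed
qed

end

theorem proposition2:
  shows "\<exists>P. solves P sep_inputs sep_load sep_correct \<and>
             strongly_polynomial P sep_inputs sep_load sep_dim sep_rational sep_length"
proof (intro exI conjI)
  show "solves (compile separation_prog) sep_inputs sep_load sep_correct"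
    unfolding solves_def
  proof
    fix x assume x: "x \<in> sep_inputs"
    obtain n d X where nX: "x = (n, d, X)" by (metis prod_cases3)
    interpret separation_instance n d X
      by unfold_locales (use x nX in simp)
    obtain k b where "exec (compile separation_prog) (sep_load x) k b (sem separation_prog (sep_load x))"
      using exec_on_input[OF separation_prog_well_bounded x] by blast
    then show "\<exists>k b t. exec (compile separation_prog) (sep_load x) k b t \<and> sep_correct x t"
      using separation_prog_correct nX by blast
  qed
  show "strongly_polynomial (compile separation_prog) sep_inputs sep_load sep_dim sep_rational sep_length"
    by (rule loop_program_strongly_polynomial[OF separation_prog_well_bounded separation_prog_additive])
qed

end
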